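(* Let $\delta_s=C_d(k\log(C_d''s))^{1/d}$ with $k>d+1$. There exist constants $C_1,C_2>0$ depending only on $d$ such that for all $s>1$ sufficiently large and all $h$ with $\delta_s\le h\le s$ it holds $$\left|\frac{\mathbb{E}\left[d_{h,\mathcal{X}_s}(0,se_1)\right]}{\mathbb{E}\left[d_{h,\mathcal{X}_s}(0,2se_1)\right]}-\frac12\right|\le C_1\frac hs+C_2\sqrt{\frac{\delta_s^2}{h}}\,\frac{\log(s)}{\sqrt s}.$$
   Context: Let $d\in\mathbb{N}$, let $|\cdot|$ be the Euclidean norm and $e_1=(1,0,\dots,0)\in\mathbb{R}^d$. Let $X$ be a Poisson point process on $\mathbb{R}^d$ with unit intensity. Distances: for a set $P\subset\mathbb{R}^d$ and $x\in\mathbb{R}^d$ let $\pi_P(x)=\{\hat x\in P: |x-\hat x|=\min_{y\in P}|x-y|\}$. For $h>0$ and $x,y\in\mathbb{R}^d$ let $\Pi_{h,P}(x,y)$ be the set of all finite tuples $p=(p_1,\dots,p_m)\in P^m$, $m\in\mathbb{N}$, with $p_1\in\pi_P(x)$, $p_m\in\pi_P(y)$, $|x-p_1|\le h/2$, $|y-p_m|\le h/2$ and $|p_i-p_{i+1}|\le h$ for $1\le i\le m-1$. The length is $L(p)=\sum_{i=1}^{m-1}|p_{i+1}-p_i|$ and $d_{h,P}(x,y)=\inf\{L(p):p\in\Pi_{h,P}(x,y)\}$ (with $\inf\emptyset=+\infty$). Constants: $C_d:=2\sqrt d$; $C_d'\ge1$ is a fixed sufficiently large constant depending only on $d$ (at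 least $C_d+3/2$); $C_d'':=\max\{2C_dC_d',\,4C_d+2\}$. Enriched process: for given $s$, cover $\mathbb{R}^d$ by the closed cubes $\{B_k\}_{k\in\mathbb{N}}$ of a fixed (deterministic) grid with side length $\delta_s/C_d$. For every cube $B_i$ with $B_i\cap X=\emptyset$ add one point $x_i\in B_i$ (for instance its center) to $X$; the resulting set of points is denoted $\mathcal{X}_s$. *)

theory Defs
  imports "HOL-Probability.Probability"
begin

text \<open>A point process is a random locally finite set of points. Since counts are taken of bounded
  Borel sets only, they are natural numbers. The counting probabilities are written out, rather than
  taken from \<open>poisson_pmf\<close>, because that requires a positive rate and Borel null sets have rate 0.\<close>

definition point_count :: "('w \<Rightarrow> (real ^ 'd) set) \<Rightarrow> (real ^ 'd) set \<Rightarrow> 'w \<Rightarrow> nat" where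
  "point_count X B \<omega> = card (X \<omega> \<inter> B)"

definition unit_poisson_process :: "'w measure \<Rightarrow> ('w \<Rightarrow> (real ^ 'd) set) \<Rightarrow> bool" where
  "unit_poisson_process M X \<longleftrightarrow>
     prob_space M \<and>
     (\<forall>\<omega>\<in>space M. \<forall>B. bounded B \<longrightarrow> finite (X \<omega> \<inter> B)) \<and>
     (\<forall>B. B \<in> sets borel \<and> bounded B \<longrightarrow>
        point_count X B \<in> M \<rightarrow>\<^sub>M count_space UNIV \<and>
        (\<forall>n. measure M {\<omega> \<in> space M. point_count X B \<omega> = n} =
               exp (- measure lborel B) * measure lborel B ^ n / fact n)) \<and>
     (\<forall>\<B>. finite \<B> \<and> disjoint \<B> \<and> (\<forall>B\<in>\<B>. B \<in> sets borel \<and> bounded B) \<longrightarrow>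
        prob_space.indep_vars M (\<lambda>_. count_space UNIV) (point_count X) \<B>)"

definition closest_points :: "(real ^ 'd) set \<Rightarrow> real ^ 'd \<Rightarrow> (real ^ 'd) set" where
  "closest_points P x = {p \<in> P. \<forall>y\<in>P. norm (x - p) \<le> norm (x - y)}"

definition paths :: "real \<Rightarrow> (real ^ 'd) set \<Rightarrow> real ^ 'd \<Rightarrow> real ^ 'd \<Rightarrow> (real ^ 'd) list set" where
  "paths h P x y =
     {p. p \<noteq> [] \<and> set p \<subseteq> P \<and>
         hd p \<in> closest_points P x \<and> last p \<in> closest_points P y \<and>
         norm (x - hd p) \<le> h / 2 \<and> norm (y - last p) \<le> h / 2 \<and>
         (\<forall>i. Suc i < length p \<longrightarrow> norm (p ! i - p ! Suc i) \<le> h)}"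

definition path_len :: "(real ^ 'd) list \<Rightarrow> real" where
  "path_len p = (\<Sum>i<length p - 1. norm (p ! Suc i - p ! i))"

text \<open>The infimum over the empty set is \<open>\<infinity>\<close> in \<^typ>\<open>ennreal\<close>.\<close>

definition graph_dist :: "real \<Rightarrow> (real ^ 'd) set \<Rightarrow> real ^ 'd \<Rightarrow> real ^ 'd \<Rightarrow> ennreal" where
  "graph_dist h P x y = (INF p\<in>paths h P x y. ennreal (path_len p))"

text \<open>The dimension is passed as a number \<open>d\<close>, to be instantiated with \<open>CARD('d)\<close>;
  \<open>C'\<close> stands for $C_d'$.\<close>

definition const_C :: "nat \<Rightarrow> real" where
  "const_C d = 2 * sqrt (real d)"

definition const_C'' :: "nat \<Rightarrow> real \<Rightarrow> real" where
  "const_C'' d C' = max (2 * const_C d * C') (4 * const_C d + 2)"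

definition delta :: "nat \<Rightarrow> real \<Rightarrow> real \<Rightarrow> real \<Rightarrow> real" where
  "delta d C' k s = const_C d * (k * ln (const_C'' d C' * s)) powr (1 / real d)"

text \<open>The cubes of the axis-parallel grid with side length \<open>l\<close> and a vertex at \<open>a\<close> are indexed by
  integer vectors. The point added to the cube with index \<open>z\<close>, should that cube be empty,
  is \<open>c z\<close>.\<close>

definition grid_cube :: "real \<Rightarrow> real ^ 'd \<Rightarrow> int ^ 'd \<Rightarrow> (real ^ 'd) set" where
  "grid_cube l a z =
     cbox (\<chi> i. a $ i + l * real_of_int (z $ i)) (\<chi> i. a $ i + l * (real_of_int (z $ i) + 1))"

definition enrich ::
    "real \<Rightarrow> real ^ 'd \<Rightarrow> (int ^ 'd \<Rightarrow> real ^ 'd) \<Rightarrow> (real ^ 'd) set \<Rightarrow> (real ^ 'd) set" where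
  "enrich l a c P = P \<union> c ` {z. grid_cube l a z \<inter> P = {}}"

text \<open>An infinite integral, like a vanishing one in the denominator, makes a quotient of two such
  expectations 0.\<close>

definition expected_dist ::
    "'w measure \<Rightarrow> ('w \<Rightarrow> (real ^ 'd) set) \<Rightarrow> real \<Rightarrow> real ^ 'd \<Rightarrow> real ^ 'd \<Rightarrow> real" where
  "expected_dist M Y h x y = enn2real (\<integral>\<^sup>+ \<omega>. graph_dist h (Y \<omega>) x y \<partial>M)"

end

theory Submission imports Defs begin

text \<open>Up to an error of order \<open>h\<close>, the distance may be replaced by the length \<open>T(x,y)\<close> of a shortest
  route from \<open>x\<close> to \<open>y\<close> whose intermediate vertices are points of the process. As every cube contains a
  point, any segment can be followed at bounded relative cost, so \<open>T\<close> satisfies the triangle inequality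
  up to a multiple of \<open>\<delta>\<close>, which makes the expectation nearly subadditive. Conversely, a route from
  \<open>0\<close> to \<open>2 s e\<^sub>1\<close> crosses the sphere of radius \<open>s\<close> about each of its ends. Polynomially many points suffice to
  discretise both spheres, and all of them have nearly the same expected distance to the centre, because
  rigid motions preserve the law of the process and enrichment matters only on an event of probability
  \<open>O(s\<^sup>d\<^sup>-\<^sup>k)\<close>. So near superadditivity follows from a bound on the deviations of \<open>T\<close> below its mean.

  For this bound the process is approximated by finitely many independent occupation variables of small
  cells. Changing the process in one cube increases \<open>T\<close> by at most a multiple of \<open>\<delta>\<close>, and not at all if a
  nearly shortest route avoids the cube; such a route visits \<open>O(s/h)\<close> cubes. Feeding this into the
  Efron--Stein inequality for \<open>exp (-\<lambda> T)\<close> yields exponential moments at the scale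
  \<open>sqrt (\<delta>\<^sup>2 s / h)\<close>.\<close>

section \<open>Shortest routes\<close>

text \<open>A route has free ends, while the ends of an element of \<open>paths\<close> depend on
  the configuration; this lets routes be cut and compared at fixed points. Gluing two routes at a
  point outside the process is not allowed, and repairing the joint is the source of
  \<open>detour\<close>. Only deviations below the mean matter, and this decides the form of the
  variance bound. An increase of the distance under resampling is controlled by a nearly shortest
  route of the original configuration, a decrease only by a route of the resampled one. Hence the
  positive parts in the Efron--Stein inequality. The finite approximation meets a discontinuity:
  displacing points may break a step of length exactly \<open>h\<close>. The approximating model
  therefore gets a slightly larger step, and right-continuity in the step removes it in the limit.
  Each visited cube contributes \<delta> squared to the variance, which explains the fluctuation
  scale; a union bound over the sphere points adds \<open>ln s\<close>, and dividing by a
  denominator of at least \<open>s\<close> gives both terms of the rate.\<close>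

fun route :: "real \<Rightarrow> 'a::metric_space set \<Rightarrow> 'a \<Rightarrow> 'a list \<Rightarrow> 'a \<Rightarrow> bool" where
  "route h P x [] y \<longleftrightarrow> dist x y \<le> h"
| "route h P x (v # p) y \<longleftrightarrow> v \<in> P \<and> dist x v \<le> h \<and> route h P v p y"

fun rlen :: "'a::metric_space \<Rightarrow> 'a list \<Rightarrow> 'a \<Rightarrow> real" where
  "rlen x [] y = dist x y"
| "rlen x (v # p) y = dist x v + rlen v p y"

text \<open>Length bounds are carried through \<open>reach\<close> because \<open>tdist\<close> is
  an infimum in the reals, which says nothing when no route exists; \<open>reach\<close> supplies
  nonemptiness and bound at once.\<close>

definition reach :: "real \<Rightarrow> 'a::metric_space set \<Rightarrow> 'a \<Rightarrow> 'a \<Rightarrow> real \<Rightarrow> bool" where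
  "reach h P x y L \<longleftrightarrow> (\<exists>p. route h P x p y \<and> rlen x p y \<le> L)"

definition tdist :: "real \<Rightarrow> 'a::metric_space set \<Rightarrow> 'a \<Rightarrow> 'a \<Rightarrow> real" where
  "tdist h P x y = (INF p\<in>{p. route h P x p y}. rlen x p y)"

lemma route_append: "route h P x (p @ v # q) y \<longleftrightarrow> v \<in> P \<and> route h P x p v \<and> route h P v q y"
  by (induction p arbitrary: x) auto

lemma rlen_append: "rlen x (p @ v # q) y = rlen x p v + rlen v q y"
  by (induction p arbitrary: x) auto

lemma rlen_ge_dist: "dist x y \<le> rlen x p y"
proof (induction p arbitrary: x)
  case (Cons v p)
  show ?case using dist_triangle[of x y v] Cons.IH[of v] by simp
qed simp

lemma rlen_nonneg: "0 \<le> rlen x p y"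
  using rlen_ge_dist[of x y p] zero_le_dist[of x y] by linarith

lemma rlen_vertex: "v \<in> set p \<Longrightarrow> dist x v \<le> rlen x p y"
  by (metis split_list rlen_append rlen_ge_dist rlen_nonneg add_increasing2)

lemma route_subset: "route h P x p y \<Longrightarrow> set p \<subseteq> P"
  by (induction p arbitrary: x) auto

lemma route_mono: "route h P x p y \<Longrightarrow> set p \<subseteq> Q \<Longrightarrow> h \<le> h' \<Longrightarrow> route h' Q x p y"
  by (induction p arbitrary: x) auto

lemma route_rev: "route h P x p y \<Longrightarrow> route h P y (rev p) x"
  by (induction p arbitrary: x) (auto simp: route_append dist_commute)

lemma rlen_rev: "rlen y (rev p) x = rlen x p y"
  by (induction p arbitrary: x) (auto simp: rlen_append dist_commute)

text \<open>If the far ends of two consecutive steps are within \<open>h\<close>, the vertex between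
  them is dropped; otherwise the pair has total length above \<open>h\<close>. So a thinned route of
  length \<open>L\<close> has at most \<open>2 * L / h + 1\<close> vertices, the origin of every
  count of order s/h below.\<close>

lemma route_shortcut:
  assumes "0 \<le> h" "route h P x p y"
  shows "\<exists>p'. route h P x p' y \<and> rlen x p' y \<le> rlen x p y \<and> set p' \<subseteq> set p \<and>
    h * real (length p') \<le> 2 * rlen x p' y + h"
  using assms(2)
proof (induction p arbitrary: x rule: length_induct)
  case (1 p)
  show ?case
  proof (cases p)
    case Nil
    then show ?thesis using 1 assms(1) by (intro exI[of _ "[]"]) (auto simp: add_nonneg_nonneg)
  next
    case (Cons u p')
    show ?thesis
    proof (cases p')
      case Nil
      then show ?thesis using 1 Cons by (intro exI[of _ "[u]"]) (auto simp: add_nonneg_nonneg)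
    next
      case (Cons v r)
      note p = \<open>p = u # p'\<close> Cons
      have u: "u \<in> P" "v \<in> P" "dist x u \<le> h" "dist u v \<le> h" "route h P v r y" using 1(2) p by auto
      show ?thesis
      proof (cases "dist x v \<le> h")
        case True
        then have "route h P x (v # r) y" using u by auto
        with 1(1)[rule_format, of "v # r" x] p obtain q where q: "route h P x q y"
            "rlen x q y \<le> rlen x (v # r) y"
            "set q \<subseteq> set (v # r)" "h * real (length q) \<le> 2 * rlen x q y + h"
          by auto
        have "rlen x (v # r) y \<le> rlen x p y" using p dist_triangle[of x v u] by simp
        then show ?thesis using q p by (intro exI[of _ q]) auto
      next
        case False
        from 1(1)[rule_format, of r v] p u(5) obtain q where q: "route h P v q y"
            "rlen v q y \<le> rlen v r y"
            "set q \<subseteq> set r" "h * real (length q) \<le> 2 * rlen v q y + h"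
          by auto
        have "h \<le> dist x u + dist u v" using False dist_triangle[of x v u] by simp
        then show ?thesis using q u p by (intro exI[of _ "u # v # q"]) (auto simp: algebra_simps)
      qed
    qed
  qed
qed

text \<open>A step between two displaced points grows by at most \<open>2 * e\<close>, the last one
  only by \<open>e\<close> because \<open>y\<close> stays fixed. The start may move as well, so that
  the induction can continue from a displaced vertex.\<close>

lemma route_perturb:
  assumes "\<And>v. v \<in> set p \<Longrightarrow> \<exists>v'\<in>P'. dist v v' \<le> e" "route h P x p y" "dist x x' \<le> e" "0 \<le> e"
  shows "\<exists>p'. route (h + 2 * e) P' x' p' y \<and> rlen x' p' y \<le> rlen x p y + e + 2 * e * real (length p)"
  using assms
proof (induction p arbitrary: x x')
  case Nil
  then show ?case using dist_triangle[of x' y x]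
    by (intro exI[of _ "[]"]) (auto simp: dist_commute)
next
  case (Cons v p)
  then obtain v' where v': "v' \<in> P'" "dist v v' \<le> e" by (meson list.set_intros(1))
  then obtain q where q: "route (h + 2 * e) P' v' q y"
      "rlen v' q y \<le> rlen v p y + e + 2 * e * real (length p)"
    using Cons.IH[of v v'] Cons.prems by auto
  have "dist x' v' \<le> dist x v + 2 * e"
    using Cons.prems(3) v' dist_triangle[of x' v' x] dist_triangle[of x v' v] by (simp add: dist_commute)
  then show ?case using q v' Cons.prems(2) by (intro exI[of _ "v' # q"]) (auto simp: algebra_simps)
qed

lemma reach_mono: "reach h P x y L \<Longrightarrow> L \<le> L' \<Longrightarrow> P \<subseteq> Q \<Longrightarrow> h \<le> h' \<Longrightarrow> reach h' Q x y L'"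
  unfolding reach_def by (meson order_trans route_mono route_subset)

lemma reach_sym: "reach h P x y L \<Longrightarrow> reach h P y x L"
  unfolding reach_def by (metis route_rev rlen_rev)

lemma reach_direct: "dist x y \<le> h \<Longrightarrow> dist x y \<le> L \<Longrightarrow> reach h P x y L"
  unfolding reach_def by (rule exI[of _ "[]"]) simp

lemma reach_trans: "reach h P x v L \<Longrightarrow> reach h P v y L' \<Longrightarrow> v \<in> P \<Longrightarrow> reach h P x y (L + L')"
  unfolding reach_def
proof (elim exE conjE)
  fix p q assume "v \<in> P" "route h P x p v" "rlen x p v \<le> L" "route h P v q y" "rlen v q y \<le> L'"
  then show "\<exists>p. route h P x p y \<and> rlen x p y \<le> L + L'"
    by (intro exI[of _ "p @ v # q"]) (auto simp: route_append rlen_append)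
qed

lemma bdd_below_rlen: "bdd_below ((\<lambda>p. rlen x p y) ` S)"
  by (rule bdd_belowI2[of _ 0]) (rule rlen_nonneg)

lemma tdist_le: "reach h P x y L \<Longrightarrow> tdist h P x y \<le> L"
  unfolding tdist_def reach_def
  by (elim exE conjE) (rule order_trans[OF cINF_lower[OF bdd_below_rlen]], auto)

lemma tdist_ge:
  assumes "reach h P x y L0" "\<And>p. route h P x p y \<Longrightarrow> L \<le> rlen x p y" shows "L \<le> tdist h P x y"
  unfolding tdist_def using assms by (intro cINF_greatest) (auto simp: reach_def)

lemma tdist_ge_dist: "reach h P x y L0 \<Longrightarrow> dist x y \<le> tdist h P x y"
  by (rule tdist_ge) (auto intro: rlen_ge_dist)

lemma tdist_attain:
  assumes "reach h P x y L0" "0 < \<eta>"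
  shows "\<exists>p. route h P x p y \<and> rlen x p y < tdist h P x y + \<eta>"
proof -
  have "{p. route h P x p y} \<noteq> {}" using assms by (auto simp: reach_def)
  then show ?thesis
    using cInf_lessD[of "(\<lambda>p. rlen x p y) ` {p. route h P x p y}" "tdist h P x y + \<eta>"] assms(2)
    unfolding tdist_def by auto
qed

lemma tdist_attain_short:
  assumes "reach h P x y L0" "0 < \<eta>" "0 \<le> h"
  shows "\<exists>p. route h P x p y \<and> rlen x p y < tdist h P x y + \<eta> \<and> h * real (length p) \<le> 2 * rlen x p y + h"
proof -
  obtain p where "route h P x p y" "rlen x p y < tdist h P x y + \<eta>"
    using tdist_attain[OF assms(1,2)] by blast
  then show ?thesis using route_shortcut[OF assms(3), of P x p y] by force
qed

section \<open>Nets: rerouting at bounded extra cost\<close>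

definition detour :: "real \<Rightarrow> real" where "detour A = 2 * A + 5"

text \<open>This isolates what the nonempty cubes guarantee for every configuration. All
  deterministic rerouting rests on it, and it holds alike for the enriched process, its
  discretisation and its preimage under a rigid motion.\<close>

locale net =
  fixes h \<delta> A :: real and P :: "'a::real_normed_vector set"
  assumes delta_pos: "0 < \<delta>" and delta_le: "\<delta> \<le> h" and A_nonneg: "0 \<le> A"
    and cover: "\<exists>q\<in>P. dist u q \<le> \<delta> / 2"
    and chain: "reach h P u v (A * dist u v + 4 * \<delta>)"
begin

lemma tdist_bound: "tdist h P x y \<le> A * dist x y + 4 * \<delta>"
  by (rule tdist_le[OF chain])

lemma tdist_nonneg: "0 \<le> tdist h P x y"
  by (rule order_trans[OF zero_le_dist tdist_ge_dist[OF chain]])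

text \<open>A step that is slightly too long is replaced by a hop of length at most \<open>h\<close>
  to a point of \<open>P\<close> near its far end, followed by a chain of length at most
  \<open>2 * A * \<delta> + 4 * \<delta>\<close>. The half \<delta> withheld from
  \<open>detour A\<close> pays for the displaced endpoint in \<open>move_end\<close>.\<close>

lemma reach_stretch:
  assumes "dist u v \<le> h + \<delta> / 2"
  shows "reach h P u v (dist u v + (detour A - 1/2) * \<delta>)"
proof (cases "dist u v \<le> h")
  case True
  then show ?thesis using A_nonneg delta_pos by (intro reach_direct) (auto simp: detour_def)
next
  case False
  \<comment> \<open>The point \<open>m\<close> is placed at distance \<open>h - \<delta> / 2\<close>
    from \<open>u\<close>, so that a point of \<open>P\<close> within \<open>\<delta> / 2\<close> of
    \<open>m\<close> is still one step away from \<open>u\<close>.\<close>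
  define t where "t = (h - \<delta> / 2) / dist u v"
  have d0: "0 < dist u v" using False delta_pos delta_le by linarith
  have t: "0 \<le> t" "t \<le> 1" using False delta_pos delta_le d0 by (auto simp: t_def)
  define m where "m = u + t *\<^sub>R (v - u)"
  have um: "dist u m = h - \<delta> / 2"
    using d0 t delta_pos delta_le unfolding m_def dist_norm by (simp add: t_def dist_norm norm_minus_commute)
  have "v - m = (1 - t) *\<^sub>R (v - u)" by (simp add: m_def algebra_simps)
  then have "norm (v - m) = (1 - t) * norm (v - u)" using t by simp
  then have "dist m v = (1 - t) * dist u v" by (simp add: dist_norm norm_minus_commute)
  also have "\<dots> = dist u v - t * dist u v" by (simp add: left_diff_distrib)
  also have "t * dist u v = h - \<delta> / 2" using d0 by (simp add: t_def)
  finally have mv: "dist m v \<le> \<delta>" using assms by simp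
  obtain q where q: "q \<in> P" "dist m q \<le> \<delta> / 2" using cover by blast
  have uq: "dist u q \<le> h" using um q dist_triangle[of u q m] by simp
  have qv: "dist q v \<le> 2 * \<delta>" using mv q dist_triangle[of q v m] delta_pos by (simp add: dist_commute)
  have "reach h P u v (h + (A * dist q v + 4 * \<delta>))"
    by (rule reach_trans[OF reach_direct chain q(1)]) (use uq in auto)
  moreover have "h + (A * dist q v + 4 * \<delta>) \<le> dist u v + (detour A - 1/2) * \<delta>"
    using False mult_left_mono[OF qv A_nonneg] delta_pos by (simp add: detour_def algebra_simps)
  ultimately show ?thesis by (auto intro: reach_mono)
qed

lemma move_end:
  assumes "reach h P x v L" "dist v q \<le> \<delta> / 2" shows "reach h P x q (L + detour A * \<delta>)"
proof -
  obtain p where p: "route h P x p v" "rlen x p v \<le> L" using assms by (auto simp: reach_def)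
  show ?thesis
  proof (cases p rule: rev_cases)
    case Nil
    then have "dist x q \<le> dist x v + \<delta> / 2" "dist x v \<le> h"
      using p assms(2) dist_triangle[of x q v] by auto
    then have "reach h P x q (dist x q + (detour A - 1/2) * \<delta>)" by (intro reach_stretch) simp
    then show ?thesis
      by (rule reach_mono) (use p Nil \<open>dist x q \<le> _\<close> in \<open>auto simp: algebra_simps\<close>)
  next
    case (snoc p' u)
    then have r: "route h P x p' u" "u \<in> P" "dist u v \<le> h" "rlen x p v = rlen x p' u + dist u v"
      using p by (auto simp: route_append rlen_append)
    have uq: "dist u q \<le> dist u v + \<delta> / 2" using assms(2) dist_triangle[of u q v] by simp
    then have "reach h P u q (dist u q + (detour A - 1/2) * \<delta>)" using r by (intro reach_stretch) simp
    moreover have "reach h P x u (rlen x p' u)" using r by (auto simp: reach_def)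
    ultimately have "reach h P x q (rlen x p' u + (dist u q + (detour A - 1/2) * \<delta>))"
      using r by (intro reach_trans[of h P x u])
    then show ?thesis
      by (rule reach_mono) (use p r uq in \<open>auto simp: algebra_simps\<close>)
  qed
qed

text \<open>Routes can be joined only at points of \<open>P\<close>; both inner ends are therefore
  moved to \<open>q\<close>, and each move costs \<open>detour A * \<delta>\<close>.\<close>

lemma reach_via:
  assumes "reach h P x u L" "reach h P v y L'" "q \<in> P" "dist u q \<le> \<delta> / 2" "dist v q \<le> \<delta> / 2"
  shows "reach h P x y (L + L' + 2 * detour A * \<delta>)"
  using reach_trans[OF move_end[OF assms(1,4)] reach_sym[OF move_end[OF reach_sym[OF assms(2)] assms(5)]] assms(3)]
  by (simp add: algebra_simps)

lemma reach_triangle: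
  assumes "reach h P x v L" "reach h P v y L'" shows "reach h P x y (L + L' + 2 * detour A * \<delta>)"
  using reach_via[OF assms] cover[of v] by blast

lemma tdist_triangle: "tdist h P x y \<le> tdist h P x v + tdist h P v y + 2 * detour A * \<delta>"
proof (rule field_le_epsilon)
  fix e :: real assume "0 < e"
  then have e: "0 < e / 2" by simp
  have "reach h P x v (tdist h P x v + e / 2)" "reach h P v y (tdist h P v y + e / 2)"
    using tdist_attain[OF chain e] unfolding reach_def by (meson less_imp_le)+
  from tdist_le[OF reach_triangle[OF this]]
  show "tdist h P x y \<le> tdist h P x v + tdist h P v y + 2 * detour A * \<delta> + e" by simp
qed

lemma tdist_sym: "tdist h P x y = tdist h P y x"
proof -
  have "tdist h P x y \<le> tdist h P y x" for x y
  proof (rule field_le_epsilon)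
    fix e :: real assume "0 < e"
    then have "reach h P y x (tdist h P y x + e)"
      using tdist_attain[OF chain] unfolding reach_def by (meson less_imp_le)
    then show "tdist h P x y \<le> tdist h P y x + e" by (intro tdist_le reach_sym[of h P y x])
  qed
  then show ?thesis by (meson antisym)
qed

text \<open>Only the portion between the first and the last visit to \<open>S\<close> is rerouted, through \<open>q\<close>.\<close>

lemma reach_avoiding:
  assumes "route h Q x p y" "set p - S \<subseteq> P" "q \<in> P" "\<And>u. u \<in> S \<Longrightarrow> dist u q \<le> \<delta> / 2"
  shows "reach h P x y (rlen x p y + 2 * detour A * \<delta>)"
proof (cases "set p \<inter> S = {}")
  case True
  then have "route h P x p y" using assms by (intro route_mono[OF assms(1)]) auto
  moreover have "0 \<le> detour A * \<delta>" using A_nonneg delta_pos by (simp add: detour_def)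
  ultimately show ?thesis unfolding reach_def by (intro exI[of _ p]) (simp add: mult.commute)
next
  case False
  then obtain p1 u p2 where p: "p = p1 @ u # p2" "u \<in> S" "\<forall>v\<in>set p1. v \<notin> S"
    using split_list_first_prop[of p "\<lambda>v. v \<in> S"] by blast
  \<comment> \<open>The last visit is sought in \<open>u # p2\<close>, not in \<open>p2\<close>, so
    that it may coincide with the first.\<close>
  obtain p3 v p4 where r: "u # p2 = p3 @ v # p4" "v \<in> S" "\<forall>v\<in>set p4. v \<notin> S"
    using split_list_last_prop[of "u # p2" "\<lambda>v. v \<in> S"] p(2) by auto
  have p': "p = (p1 @ p3) @ v # p4" using p r by simp
  have 1: "route h Q x p1 u" "route h Q v p4 y"
    using assms(1) route_append[of h Q x p1 u p2 y] route_append[of h Q x "p1 @ p3" v p4 y]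
    unfolding p(1)[symmetric] p'[symmetric] by auto
  have le: "rlen x p1 u + rlen v p4 y \<le> rlen x p y"
  proof (cases p3)
    case Nil
    then show ?thesis using r by (simp add: p rlen_append)
  next
    case (Cons w p3')
    then have "p2 = p3' @ v # p4" using r by simp
    then show ?thesis by (simp add: p rlen_append rlen_nonneg)
  qed
  have "reach h P x u (rlen x p1 u)" "reach h P v y (rlen v p4 y)"
    using route_mono[OF 1(1), of P h] route_mono[OF 1(2), of P h] p r p' assms(2)
    unfolding reach_def by fastforce+
  from reach_via[OF this assms(3) assms(4)[OF p(2)] assms(4)[OF r(2)]]
  show ?thesis by (rule reach_mono) (use le in auto)
qed

end

section \<open>Stability under small displacements of the points\<close>

lemma dist_gap:
  fixes F :: "'a::metric_space set" assumes "finite F"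
  shows "\<exists>\<gamma>>0. \<forall>u\<in>F. \<forall>v\<in>F. dist u v \<le> h + \<gamma> \<longrightarrow> dist u v \<le> h"
proof -
  define D where "D = (\<lambda>(u, v). dist u v - h) ` (F \<times> F) \<inter> {0<..}"
  have "finite D" using assms by (auto simp: D_def)
  define g where "g = Min (insert 1 D) / 2"
  have "0 < Min (insert 1 D)" using \<open>finite D\<close> by (auto simp: D_def)
  then have g: "0 < g" "g < Min (insert 1 D)" by (auto simp: g_def)
  have "dist u v \<le> h" if "u \<in> F" "v \<in> F" "dist u v \<le> h + g" for u v
  proof (rule ccontr)
    assume "\<not> ?thesis"
    then have "dist u v - h \<in> D" using that unfolding D_def by (auto simp: image_iff intro!: bexI[of _ "(u, v)"])
    then have "Min (insert 1 D) \<le> dist u v - h" using \<open>finite D\<close> by simp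
    then show False using that g by simp
  qed
  then show ?thesis using g by blast
qed

lemma route_tighten:
  assumes "route h' P x p y" "\<forall>u\<in>F. \<forall>v\<in>F. dist u v \<le> h' \<longrightarrow> dist u v \<le> h" "x \<in> F" "y \<in> F" "set p \<subseteq> F"
  shows "route h P x p y"
  using assms by (induction p arbitrary: x) auto

text \<open>The error grows with the number of steps, hence the thinned route: if its length is at
  most \<open>R\<close>, it has at most \<open>1 + 2 * R / h\<close> vertices, and
  \<open>e + 2 * e * (1 + 2 * R / h)\<close> is the stated error. The summand 1 in the radius leaves
  room for a route that is only nearly shortest.\<close>

lemma tdist_perturb_le:
  assumes "net h \<delta> A P" "net (h + 2 * e) \<delta> A P'" "0 \<le> e"
    and "\<And>p. p \<in> P \<Longrightarrow> dist x p \<le> A * dist x y + 4 * \<delta> + 1 \<Longrightarrow> \<exists>p'\<in>P'. dist p p' \<le> e"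
  shows "tdist (h + 2 * e) P' x y \<le> tdist h P x y + e * (3 + 4 * (A * dist x y + 4 * \<delta> + 1) / h)"
proof (rule field_le_epsilon)
  interpret net h \<delta> A P by fact
  have h: "0 < h" using delta_pos delta_le by simp
  fix r :: real assume "0 < r"
  then have "0 < min r 1" by simp
  from tdist_attain_short[OF chain this, of x y] h obtain p where p: "route h P x p y"
    "rlen x p y < tdist h P x y + min r 1" "h * real (length p) \<le> 2 * rlen x p y + h" by auto
  define R where "R = A * dist x y + 4 * \<delta> + 1"
  have R: "rlen x p y \<le> R" using p tdist_bound[of x y] by (auto simp: R_def)
  have "\<exists>v'\<in>P'. dist v v' \<le> e" if "v \<in> set p" for v
    using assms(4)[of v] that route_subset[OF p(1)] rlen_vertex[OF that, of x y] R by (auto simp: R_def)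
  from route_perturb[OF this p(1), of x] assms(3) obtain p' where p': "route (h + 2 * e) P' x p' y"
    "rlen x p' y \<le> rlen x p y + e + 2 * e * real (length p)" by auto
  have "real (length p) \<le> (2 * rlen x p y + h) / h" using p h by (simp add: field_simps)
  also have "\<dots> \<le> (2 * R + h) / h" using R h by (intro divide_right_mono) auto
  also have "\<dots> = 1 + 2 * R / h" using h by (simp add: field_simps)
  finally have "2 * e * real (length p) \<le> 2 * e * (1 + 2 * R / h)" using assms(3) by (intro mult_left_mono) auto
  then have "rlen x p' y \<le> tdist h P x y + e * (3 + 4 * R / h) + r" using p' p by (simp add: algebra_simps)
  moreover have "tdist (h + 2 * e) P' x y \<le> rlen x p' y" using p' by (auto intro!: tdist_le simp: reach_def)
  ultimately show "tdist (h + 2 * e) P' x y \<le> tdist h P x y + e * (3 + 4 * (A * dist x y + 4 * \<delta> + 1) / h) + r"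
    by (simp add: R_def)
qed

lemma net_mono: "net h \<delta> A P \<Longrightarrow> h \<le> h' \<Longrightarrow> net h' \<delta> A P"
  unfolding net_def using reach_mono[of h P _ _ _ _ P h', OF _ order_refl order_refl] by auto

text \<open>Finitely many candidate vertices have finitely many mutual distances, so a slightly
  larger step bound admits no new step. From the left this can fail, namely when some distance
  equals \<open>h\<close>.\<close>

lemma tdist_step_right_continuous:
  assumes "net h \<delta> A P" "finite (P \<inter> cball x (A * dist x y + 4 * \<delta> + 1))"
  shows "\<exists>\<gamma>>0. tdist h P x y \<le> tdist (h + \<gamma>) P x y"
proof -
  interpret net h \<delta> A P by fact
  define R where "R = A * dist x y + 4 * \<delta> + 1"
  let ?F = "insert x (insert y (P \<inter> cball x R))"
  obtain g where g: "0 < g" "\<forall>u\<in>?F. \<forall>v\<in>?F. dist u v \<le> h + g \<longrightarrow> dist u v \<le> h"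
    using dist_gap[of ?F h] assms(2) by (auto simp: R_def)
  interpret g: net "h + g" \<delta> A P using assms(1) g by (intro net_mono[OF assms(1)]) auto
  have "tdist h P x y \<le> tdist (h + g) P x y"
  proof (rule field_le_epsilon)
    fix r :: real assume "0 < r"
    then have "0 < min r 1" by simp
    from tdist_attain[OF g.chain this, of x y] obtain p where p: "route (h + g) P x p y"
      "rlen x p y < tdist (h + g) P x y + min r 1" by auto
    then have R: "rlen x p y \<le> R" using g.tdist_bound[of x y] by (auto simp: R_def)
    have "set p \<subseteq> ?F" using rlen_vertex[of _ p x y] R route_subset[OF p(1)] by force
    then have "route h P x p y" using route_tighten[OF p(1) g(2)] by auto
    then show "tdist h P x y \<le> tdist (h + g) P x y + r"
      using p by (intro tdist_le) (auto simp: reach_def intro!: exI[of _ p])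
  qed
  then show ?thesis using g by blast
qed

text \<open>With points displaced by \<open>e n\<close>, the step \<open>h + 2 * e n\<close> keeps
  every old step admissible, which gives the upper bound. Comparing back raises the step to
  \<open>h + 4 * e n\<close>, and right-continuity for the fixed set \<open>P\<close> absorbs
  this.\<close>

lemma tdist_limit:
  assumes "net h \<delta> A P" "finite (P \<inter> cball x (A * dist x y + 4 * \<delta> + 1))"
    and "\<And>n. net (h + 2 * e n) \<delta> A (P' n)" "\<And>n. 0 \<le> e n" "e \<longlonglongrightarrow> 0"
    and "\<And>n p. p \<in> P \<Longrightarrow> dist x p \<le> A * dist x y + 4 * \<delta> + 1 \<Longrightarrow> \<exists>p'\<in>P' n. dist p p' \<le> e n"
    and "\<And>n p. p \<in> P' n \<Longrightarrow> dist x p \<le> A * dist x y + 4 * \<delta> + 1 \<Longrightarrow> \<exists>p'\<in>P. dist p p' \<le> e n"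
  shows "(\<lambda>n. tdist (h + 2 * e n) (P' n) x y) \<longlonglongrightarrow> tdist h P x y"
proof -
  interpret net h \<delta> A P by fact
  have h: "0 < h" using delta_pos delta_le by simp
  obtain g where g: "0 < g" "tdist h P x y \<le> tdist (h + g) P x y"
    using tdist_step_right_continuous[OF assms(1,2)] by blast
  define R where "R = A * dist x y + 4 * \<delta> + 1"
  have R0: "0 \<le> R" using A_nonneg delta_pos by (simp add: R_def)
  have up: "tdist (h + 2 * e n) (P' n) x y \<le> tdist h P x y + e n * (3 + 4 * R / h)" for n
    unfolding R_def using assms by (intro tdist_perturb_le) auto
  have lo: "\<forall>\<^sub>F n in sequentially. tdist h P x y - e n * (3 + 4 * R / h) \<le> tdist (h + 2 * e n) (P' n) x y"
  proof -
    have "\<forall>\<^sub>F n in sequentially. e n < g / 4" using assms(5) g by (intro order_tendstoD(2)) auto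
    then show ?thesis
    proof eventually_elim
      case (elim n)
      have n4: "net (h + 2 * e n + 2 * e n) \<delta> A P" using assms(4) by (intro net_mono[OF assms(1)]) auto
      have "tdist (h + g) P x y \<le> tdist (h + 2 * e n + 2 * e n) P x y"
      proof (rule tdist_ge[OF net.chain[OF n4]])
        fix p assume "route (h + 2 * e n + 2 * e n) P x p y"
        then have "route (h + g) P x p y" using elim route_subset[of _ P x p y]
            route_mono[of _ P x p y P "h + g"] by auto
        then show "tdist (h + g) P x y \<le> rlen x p y" by (intro tdist_le) (auto simp: reach_def)
      qed
      also have "\<dots> \<le> tdist (h + 2 * e n) (P' n) x y + e n * (3 + 4 * R / (h + 2 * e n))"
        unfolding R_def using assms n4 by (intro tdist_perturb_le) auto
      also have "\<dots> \<le> tdist (h + 2 * e n) (P' n) x y + e n * (3 + 4 * R / h)"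
        using h assms(4) R0 by (intro add_left_mono mult_left_mono divide_left_mono) (auto simp: add_pos_nonneg)
      finally show ?case using g by simp
    qed
  qed
  have "(\<lambda>n. tdist h P x y - e n * (3 + 4 * R / h)) \<longlonglongrightarrow> tdist h P x y - 0 * (3 + 4 * R / h)"
    "(\<lambda>n. tdist h P x y + e n * (3 + 4 * R / h)) \<longlonglongrightarrow> tdist h P x y + 0 * (3 + 4 * R / h)"
    by (intro tendsto_intros assms(5))+
  from real_tendsto_sandwich[OF lo always_eventually[OF allI[OF up]]] this
  show ?thesis by simp
qed

section \<open>Grids\<close>

definition gidx :: "real \<Rightarrow> real ^ 'd \<Rightarrow> real ^ 'd \<Rightarrow> int ^ 'd" where
  "gidx l a x = (\<chi> i. \<lfloor>(x $ i - a $ i) / l\<rfloor>)"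

lemma mem_grid_cube:
  "x \<in> grid_cube l a z \<longleftrightarrow> (\<forall>i. a $ i + l * of_int (z $ i) \<le> x $ i \<and> x $ i \<le> a $ i + l * (of_int (z $ i) + 1))"
  by (auto simp: grid_cube_def mem_box_cart)

lemma gidx_mem_grid_cube: "0 < l \<Longrightarrow> x \<in> grid_cube l a (gidx l a x)"
proof -
  assume l: "0 < l"
  have "l * real_of_int \<lfloor>(x $ i - a $ i) / l\<rfloor> \<le> x $ i - a $ i" for i
    using mult_left_mono[OF of_int_floor_le[of "(x $ i - a $ i) / l"], of l] l by simp
  moreover have "x $ i - a $ i \<le> l * (real_of_int \<lfloor>(x $ i - a $ i) / l\<rfloor> + 1)" for i
    using mult_left_mono[OF less_imp_le[OF floor_correct[of "(x $ i - a $ i) / l", THEN conjunct2]], of l] l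
    by simp
  ultimately show ?thesis
    by (auto simp: mem_grid_cube gidx_def algebra_simps)
qed

lemma norm_le_sqrt_card:
  fixes x :: "real ^ 'd"
  assumes "\<And>i. \<bar>x $ i\<bar> \<le> b" shows "norm x \<le> sqrt (real CARD('d)) * b"
proof -
  have b: "0 \<le> b" using assms[of undefined] by linarith
  have "(\<Sum>i\<in>UNIV. (norm (x $ i))\<^sup>2) \<le> (\<Sum>i\<in>(UNIV :: 'd set). b\<^sup>2)"
    using assms by (intro sum_mono) (metis abs_ge_zero abs_le_square_iff abs_of_nonneg b power2_abs real_norm_def)
  then have "norm x \<le> sqrt (real CARD('d) * b\<^sup>2)"
    by (auto simp: norm_vec_def L2_set_def)
  then show ?thesis using b by (simp add: real_sqrt_mult)
qed

lemma grid_cube_dist_adjacent: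
  fixes x y :: "real ^ 'd"
  assumes "0 \<le> l" "x \<in> grid_cube l a z" "y \<in> grid_cube l a z'" "\<And>i. \<bar>z $ i - z' $ i\<bar> \<le> k"
  shows "dist x y \<le> sqrt (real CARD('d)) * ((of_int k + 1) * l)"
  unfolding dist_norm
proof (rule norm_le_sqrt_card)
  fix i
  have "l * of_int (z $ i) - l * of_int (z' $ i) \<le> l * of_int k"
    "l * of_int (z' $ i) - l * of_int (z $ i) \<le> l * of_int k"
    using assms(4)[of i] assms(1)
    by (auto simp: abs_le_iff right_diff_distrib[symmetric] simp flip: of_int_diff intro!: mult_left_mono)
  moreover have "a $ i + l * of_int (z $ i) \<le> x $ i" "x $ i \<le> a $ i + l * of_int (z $ i) + l"
    "a $ i + l * of_int (z' $ i) \<le> y $ i" "y $ i \<le> a $ i + l * of_int (z' $ i) + l"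
    using assms(2,3) by (auto simp: mem_grid_cube distrib_left add.assoc)
  ultimately show "\<bar>(x - y) $ i\<bar> \<le> (of_int k + 1) * l" by (simp add: algebra_simps abs_le_iff)
qed

lemma grid_cube_dist:
  fixes x y :: "real ^ 'd"
  assumes "0 \<le> l" "x \<in> grid_cube l a z" "y \<in> grid_cube l a z"
  shows "dist x y \<le> sqrt (real CARD('d)) * l"
  using grid_cube_dist_adjacent[OF assms, of 0] by simp

lemma gidx_adjacent:
  fixes u v :: "real ^ 'd"
  assumes "0 < l" "dist u v \<le> l" shows "\<bar>gidx l a u $ i - gidx l a v $ i\<bar> \<le> 1"
proof -
  have "\<bar>u $ i - v $ i\<bar> \<le> l"
    using assms(2) component_le_norm_cart[of "u - v" i] by (simp add: dist_norm)
  then have "\<bar>(u $ i - a $ i) / l - (v $ i - a $ i) / l\<bar> \<le> 1"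
    using assms(1) by (simp add: diff_divide_distrib[symmetric] abs_le_iff divide_le_eq le_divide_eq)
  then show ?thesis unfolding gidx_def vec_lambda_beta by linarith
qed

text \<open>Advancing by at most \<open>l\<close> changes each grid index by at most 1, and points
  of cubes adjacent in this sense are at most \<open>2 * sqrt d * l\<close> apart. This is where the
  value of \<open>const_C\<close> comes from.\<close>

lemma reach_along_segment:
  fixes u v :: "real ^ 'd"
  assumes "0 < l" "\<And>z. grid_cube l a z \<inter> P \<noteq> {}" "const_C CARD('d) * l \<le> h"
    and "q \<in> P" "q \<in> grid_cube l a (gidx l a u)" "dist u v \<le> l * real m"
  shows "reach h P q v (const_C CARD('d) * l * (real m + 1))"
  using assms(4-6)
proof (induction m arbitrary: u q)
  case 0
  then have "dist q v \<le> sqrt (real CARD('d)) * l"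
    using assms(1) gidx_mem_grid_cube[of l v a] by (intro grid_cube_dist[of l _ a "gidx l a v"]) auto
  also have "\<dots> \<le> const_C CARD('d) * l" using assms(1) by (simp add: const_C_def)
  finally show ?case using assms(3) by (intro reach_direct) auto
next
  case (Suc m)
  define t where "t = 1 / real (Suc m)"
  define u' where "u' = u + t *\<^sub>R (v - u)"
  have t: "0 \<le> t" "t \<le> 1" "t * (1 + real m) = 1" by (auto simp: t_def)
  have "dist u u' = t * dist u v" using t by (simp add: u'_def dist_norm norm_minus_commute)
  also have "\<dots> \<le> t * (l * real (Suc m))" using Suc.prems t by (intro mult_left_mono) auto
  finally have uu': "dist u u' \<le> l" by (simp add: t_def)
  have "v - u' = (1 - t) *\<^sub>R (v - u)" by (simp add: u'_def algebra_simps)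
  then have "norm (v - u') = (1 - t) * norm (v - u)" using t by simp
  then have "dist u' v = (1 - t) * dist u v" by (simp add: dist_norm norm_minus_commute)
  also have "\<dots> \<le> (1 - t) * (l * real (Suc m))" using Suc.prems t by (intro mult_left_mono) auto
  also have "\<dots> = l * real m" using t by (simp add: t_def field_simps)
  finally have u'v: "dist u' v \<le> l * real m" .
  obtain q' where q': "q' \<in> P" "q' \<in> grid_cube l a (gidx l a u')" using assms(2) by blast
  have "dist q q' \<le> sqrt (real CARD('d)) * ((of_int 1 + 1) * l)"
    using assms(1) Suc.prems q' gidx_adjacent[OF assms(1) uu']
    by (intro grid_cube_dist_adjacent[of l _ a "gidx l a u" _ "gidx l a u'"]) auto
  then have "dist q q' \<le> const_C CARD('d) * l" by (simp add: const_C_def)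
  then have "reach h P q q' (const_C CARD('d) * l)" using assms(3) by (intro reach_direct) auto
  from reach_trans[OF this Suc.IH[OF q' u'v] q'(1)]
  show ?case by (simp add: algebra_simps)
qed

text \<open>Half a \<delta> for entering the net, one for rounding up the number of pieces and one
  for the last hop make 5/2 \<delta>, within the allowance of \<open>4 * \<delta>\<close>.\<close>

lemma grid_net:
  fixes P :: "(real ^ 'd) set"
  assumes "0 < l" "\<And>z. grid_cube l a z \<inter> P \<noteq> {}" "const_C CARD('d) * l \<le> h"
  shows "net h (const_C CARD('d) * l) (const_C CARD('d)) P"
proof
  let ?C = "const_C CARD('d)"
  have C: "0 < ?C" by (simp add: const_C_def)
  show "0 < ?C * l" "0 \<le> ?C" "?C * l \<le> h" using assms C by auto
  have cover: "\<exists>q\<in>P. q \<in> grid_cube l a (gidx l a u) \<and> dist u q \<le> ?C * l / 2" for u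
  proof -
    obtain q where q: "q \<in> P" "q \<in> grid_cube l a (gidx l a u)" using assms(2) by blast
    have "dist u q \<le> sqrt (real CARD('d)) * l"
      by (rule grid_cube_dist[OF _ gidx_mem_grid_cube q(2)]) (use assms(1) in auto)
    then show ?thesis using q by (auto simp: const_C_def)
  qed
  then show "\<exists>q\<in>P. dist u q \<le> ?C * l / 2" for u by blast
  fix u v :: "real ^ 'd"
  obtain q where q: "q \<in> P" "q \<in> grid_cube l a (gidx l a u)" "dist u q \<le> ?C * l / 2" using cover by blast
  define m where "m = nat \<lceil>dist u v / l\<rceil>"
  have m: "dist u v / l \<le> real m" "real m \<le> dist u v / l + 1"
    unfolding m_def using assms(1) of_int_ceiling_le_add_one[of "dist u v / l"] by (auto simp: le_nat_iff)
  have "dist u v \<le> l * real m" using m(1) assms(1) by (simp add: field_simps)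
  from reach_along_segment[OF assms q(1,2) this]
  have "reach h P q v (?C * l * (real m + 1))" .
  moreover have "reach h P u q (?C * l / 2)"
    using q(3) assms(3) C assms(1) mult_pos_pos[OF C assms(1)] by (intro reach_direct) linarith+
  ultimately have "reach h P u v (?C * l / 2 + ?C * l * (real m + 1))"
    using q(1) by (intro reach_trans[of h P u q])
  moreover have "?C * l * (real m + 1) \<le> ?C * l * (dist u v / l + 2)"
    using m(2) C assms(1) by (intro mult_left_mono) auto
  then have "?C * l / 2 + ?C * l * (real m + 1) \<le> ?C * dist u v + 4 * (?C * l)"
    using assms(1) mult_pos_pos[OF C assms(1)] by (simp add: distrib_left mult.commute[of l])
  ultimately show "reach h P u v (?C * dist u v + 4 * (?C * l))" by (rule reach_mono) auto
qed

section \<open>Discretisation: fine cells refining the cubes\<close>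

definition cell :: "real \<Rightarrow> real \<Rightarrow> real ^ 'd \<Rightarrow> int ^ 'd \<Rightarrow> int ^ 'd \<Rightarrow> (real ^ 'd) set" where
  "cell l e a z w = {x. gidx l a x = z \<and> gidx e a x = w}"

text \<open>The half-open cubes \<open>gidx l a -` {z}\<close> are disjoint, so that \<open>henrich\<close> treats cubes independently; it
  differs from \<open>enrich\<close> only if a point lies on the boundary of a cube, an event of probability 0.\<close>

definition cube_pts :: "real \<Rightarrow> real ^ 'd \<Rightarrow> (int ^ 'd \<Rightarrow> real ^ 'd) \<Rightarrow> (real ^ 'd) set \<Rightarrow> int ^ 'd \<Rightarrow> (real ^ 'd) set" where
  "cube_pts l a c P z = (if P \<inter> gidx l a -` {z} = {} then {c z} else P \<inter> gidx l a -` {z})"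

definition henrich :: "real \<Rightarrow> real ^ 'd \<Rightarrow> (int ^ 'd \<Rightarrow> real ^ 'd) \<Rightarrow> (real ^ 'd) set \<Rightarrow> (real ^ 'd) set" where
  "henrich l a c P = (\<Union>z. cube_pts l a c P z)"

text \<open>The intersection with \<open>{w. cell l e a z w \<noteq> {}}\<close> keeps the points of \<open>disc_pts\<close> inside
  the cube with index \<open>z\<close> even for sets \<open>S\<close> that do not arise from a configuration.\<close>

definition disc_pts :: "real \<Rightarrow> real \<Rightarrow> real ^ 'd \<Rightarrow> (int ^ 'd \<Rightarrow> real ^ 'd) \<Rightarrow> int ^ 'd \<Rightarrow> (int ^ 'd) set \<Rightarrow> (real ^ 'd) set" where
  "disc_pts l e a c z S = (let S' = S \<inter> {w. cell l e a z w \<noteq> {}} in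
     if S' = {} then {c z} else (\<lambda>w. SOME x. x \<in> cell l e a z w) ` S')"

text \<open>Outside \<open>I\<close> the value is \<open>{}\<close>, for which
  \<open>disc_pts\<close> yields the single point \<open>c z\<close>. This agrees with the default
  of the product law \<open>Pi_pmf I {}\<close> and keeps the discretised point set a net.\<close>

definition disc_conf :: "real \<Rightarrow> real \<Rightarrow> real ^ 'd \<Rightarrow> (int ^ 'd) set \<Rightarrow> (real ^ 'd) set \<Rightarrow> int ^ 'd \<Rightarrow> (int ^ 'd) set" where
  "disc_conf l e a I P z = (if z \<in> I then gidx e a ` (P \<inter> gidx l a -` {z}) else {})"

definition region :: "real \<Rightarrow> real ^ 'd \<Rightarrow> real ^ 'd \<Rightarrow> real \<Rightarrow> (int ^ 'd) set" where
  "region l a x R = {z. grid_cube l a z \<inter> cball x R \<noteq> {}}"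

context
  fixes l :: real and a :: "real ^ 'd" and c :: "int ^ 'd \<Rightarrow> real ^ 'd"
  assumes l: "0 < l" and c: "\<And>z. c z \<in> grid_cube l a z"
begin

lemma cube_pts_subset: "cube_pts l a c P z \<subseteq> grid_cube l a z"
  using gidx_mem_grid_cube[OF l, of _ a] c by (auto simp: cube_pts_def)

lemma cube_pts_nonempty: "cube_pts l a c P z \<noteq> {}"
  by (simp add: cube_pts_def)

lemma cell_nonempty_some: "cell l e a z w \<noteq> {} \<Longrightarrow> (SOME x. x \<in> cell l e a z w) \<in> cell l e a z w"
  by (rule someI_ex) blast

lemma disc_pts_subset: "disc_pts l e a c z S \<subseteq> grid_cube l a z"
proof -
  have "x \<in> grid_cube l a z" if "x \<in> cell l e a z w" for x w
    using gidx_mem_grid_cube[OF l, of x a] that by (auto simp: cell_def)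
  then have "cell l e a z w \<noteq> {} \<Longrightarrow> (SOME x. x \<in> cell l e a z w) \<in> grid_cube l a z" for w
    using cell_nonempty_some[of e z w] by blast
  then show ?thesis using c by (auto simp: disc_pts_def Let_def)
qed

lemma disc_pts_nonempty: "disc_pts l e a c z S \<noteq> {}"
  by (simp add: disc_pts_def Let_def)

lemma henrich_net: "const_C CARD('d) * l \<le> h \<Longrightarrow> net h (const_C CARD('d) * l) (const_C CARD('d)) (henrich l a c P)"
  using cube_pts_subset[of P] cube_pts_nonempty[of P] by (intro grid_net[OF l]) (fastforce simp: henrich_def)+

lemma disc_net: "const_C CARD('d) * l \<le> h \<Longrightarrow>
    net h (const_C CARD('d) * l) (const_C CARD('d)) (\<Union>z. disc_pts l e a c z (S z))"
  using disc_pts_subset[of e] disc_pts_nonempty[of e] by (intro grid_net[OF l]) fastforce+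

text \<open>A point and the representative of its cell share a fine cube, whose diameter is the
  bound; an empty cube contributes \<open>c z\<close> on both sides.\<close>

lemma disc_approx:
  assumes e: "0 < e" and z: "z \<in> I"
  shows "p \<in> cube_pts l a c P z \<Longrightarrow>
      \<exists>p'\<in>disc_pts l e a c z (disc_conf l e a I P z). dist p p' \<le> sqrt (real CARD('d)) * e" (is "_ \<Longrightarrow> ?A")
    and "p \<in> disc_pts l e a c z (disc_conf l e a I P z) \<Longrightarrow>
      \<exists>p'\<in>cube_pts l a c P z. dist p p' \<le> sqrt (real CARD('d)) * e" (is "_ \<Longrightarrow> ?B")
proof -
  let ?S = "disc_conf l e a I P z"
  have S: "?S \<inter> {w. cell l e a z w \<noteq> {}} = ?S" "?S = {} \<longleftrightarrow> P \<inter> gidx l a -` {z} = {}"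
    using z by (auto simp: disc_conf_def cell_def)
  have near: "dist p (SOME x. x \<in> cell l e a z (gidx e a p)) \<le> sqrt (real CARD('d)) * e"
    if "gidx l a p = z" for p
  proof -
    have "(SOME x. x \<in> cell l e a z (gidx e a p)) \<in> cell l e a z (gidx e a p)"
      by (rule cell_nonempty_some) (use that in \<open>auto simp: cell_def\<close>)
    then have "(SOME x. x \<in> cell l e a z (gidx e a p)) \<in> grid_cube e a (gidx e a p)"
      using gidx_mem_grid_cube[OF e, of "SOME x. x \<in> cell l e a z (gidx e a p)" a]
      by (auto simp: cell_def)
    then show ?thesis using gidx_mem_grid_cube[OF e, of p a] e by (intro grid_cube_dist) auto
  qed
  {
    assume p: "p \<in> cube_pts l a c P z"
    show ?A
    proof (cases "P \<inter> gidx l a -` {z} = {}")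
      case True
      then show ?thesis using p S e by (auto simp: disc_pts_def Let_def cube_pts_def)
    next
      case False
      then have "p \<in> P" "gidx l a p = z" using p by (auto simp: cube_pts_def)
      moreover from this have "gidx e a p \<in> ?S" using z by (auto simp: disc_conf_def)
      ultimately show ?thesis using near[of p] S False by (auto simp: disc_pts_def Let_def)
    qed
  next
    assume p: "p \<in> disc_pts l e a c z ?S"
    show ?B
    proof (cases "P \<inter> gidx l a -` {z} = {}")
      case True
      then show ?thesis using p S e by (auto simp: disc_pts_def Let_def cube_pts_def)
    next
      case False
      then have "p \<in> (\<lambda>w. SOME x. x \<in> cell l e a z w) ` ?S" using p S by (simp add: disc_pts_def Let_def)
      then obtain q where q: "q \<in> P" "gidx l a q = z" "p = (SOME x. x \<in> cell l e a z (gidx e a q))"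
        using z by (auto simp: disc_conf_def)
      then show ?thesis using near[of q] False by (auto simp: cube_pts_def dist_commute)
    qed
  }
qed

end


section \<open>Counting the cubes that meet a ball\<close>

lemma finite_vec_box:
  fixes S :: "'d::finite \<Rightarrow> 'a set"
  assumes "\<And>i. finite (S i)"
  shows "finite {z :: 'a ^ 'd. \<forall>i. z $ i \<in> S i}" "card {z :: 'a ^ 'd. \<forall>i. z $ i \<in> S i} = (\<Prod>i\<in>UNIV. card (S i))"
proof -
  have eq: "{z :: 'a ^ 'd. \<forall>i. z $ i \<in> S i} = vec_lambda ` PiE UNIV S"
    by (auto simp: PiE_UNIV_domain image_iff) (metis Pi_I vec_lambda_eta)
  have "inj_on (vec_lambda :: _ \<Rightarrow> 'a ^ 'd) (PiE UNIV S)" by (auto simp: inj_on_def vec_lambda_inject)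
  then show "card {z :: 'a ^ 'd. \<forall>i. z $ i \<in> S i} = (\<Prod>i\<in>UNIV. card (S i))"
    unfolding eq by (simp add: card_image card_PiE)
  show "finite {z :: 'a ^ 'd. \<forall>i. z $ i \<in> S i}" unfolding eq using assms by (intro finite_imageI finite_PiE) auto
qed

lemma region_bound:
  fixes a x :: "real ^ 'd"
  assumes l: "0 < l" and R: "0 \<le> R"
  shows "finite (region l a x R)" "real (card (region l a x R)) \<le> (2 * R / l + 2) ^ CARD('d)"
proof -
  define S where "S i = {\<lceil>(x $ i - R - a $ i) / l - 1\<rceil>..\<lfloor>(x $ i + R - a $ i) / l\<rfloor>}" for i
  let ?T = "{z :: int ^ 'd. \<forall>i. z $ i \<in> S i}"
  have sub: "region l a x R \<subseteq> ?T"
  proof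
    fix z assume "z \<in> region l a x R"
    then obtain y where y: "y \<in> grid_cube l a z" "dist x y \<le> R" by (auto simp: region_def)
    have "z $ i \<in> S i" for i
    proof -
      have "\<bar>x $ i - y $ i\<bar> \<le> R" using y(2) component_le_norm_cart[of "x - y" i] by (simp add: dist_norm)
      then have "x $ i - R - a $ i \<le> l * (of_int (z $ i) + 1)" "l * of_int (z $ i) \<le> x $ i + R - a $ i"
        using y(1)[unfolded mem_grid_cube, rule_format, of i] by (auto simp: abs_le_iff)
      then show ?thesis using l by (simp add: S_def ceiling_le_iff le_floor_iff field_simps)
    qed
    then show "z \<in> ?T" by simp
  qed
  have S: "finite (S i)" "real (card (S i)) \<le> 2 * R / l + 2" for i
  proof -
    have "(x $ i + R - a $ i) / l - (x $ i - R - a $ i) / l = 2 * R / l"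
      by (simp add: diff_divide_distrib[symmetric])
    moreover have "0 \<le> 2 * R / l" using l R by simp
    ultimately show "real (card (S i)) \<le> 2 * R / l + 2"
      unfolding S_def card_atLeastAtMost_int by linarith
  qed (simp add: S_def)
  show "finite (region l a x R)" by (rule finite_subset[OF sub finite_vec_box(1)]) (rule S)
  have "card (region l a x R) \<le> card ?T" by (rule card_mono[OF finite_vec_box(1) sub]) (rule S)
  then have "real (card (region l a x R)) \<le> (\<Prod>i\<in>(UNIV :: 'd set). real (card (S i)))"
    using finite_vec_box(2)[of S] S by (simp flip: of_nat_prod)
  also have "\<dots> \<le> (\<Prod>i\<in>(UNIV :: 'd set). 2 * R / l + 2)" by (intro prod_mono) (use S in auto)
  finally show "real (card (region l a x R)) \<le> (2 * R / l + 2) ^ CARD('d)" by simp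
qed

section \<open>Exponential moments on finite product spaces\<close>

lemma expectation_pair_pmf_finite:
  fixes f :: "'a \<times> 'b \<Rightarrow> real"
  assumes "finite (set_pmf p)" "finite (set_pmf q)"
  shows "measure_pmf.expectation (pair_pmf p q) f =
    measure_pmf.expectation p (\<lambda>a. measure_pmf.expectation q (\<lambda>b. f (a, b)))"
proof -
  have "measure_pmf.expectation (pair_pmf p q) f = (\<Sum>x\<in>set_pmf p \<times> set_pmf q. f x * pmf (pair_pmf p q) x)"
    using assms by (intro integral_measure_pmf_real) auto
  also have "\<dots> = (\<Sum>a\<in>set_pmf p. \<Sum>b\<in>set_pmf q. f (a, b) * (pmf p a * pmf q b))"
    unfolding sum.cartesian_product by (intro sum.cong) (auto simp: pmf_pair)
  also have "\<dots> = (\<Sum>a\<in>set_pmf p. (\<Sum>b\<in>set_pmf q. f (a, b) * pmf q b) * pmf p a)"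
    by (intro sum.cong refl) (simp add: sum_distrib_left mult_ac)
  also have "\<dots> = (\<Sum>a\<in>set_pmf p. measure_pmf.expectation q (\<lambda>b. f (a, b)) * pmf p a)"
    using integral_measure_pmf_real[OF assms(2), of q] by simp
  also have "\<dots> = measure_pmf.expectation p (\<lambda>a. measure_pmf.expectation q (\<lambda>b. f (a, b)))"
    using assms by (subst integral_measure_pmf_real[OF assms(1), of p]) auto
  finally show ?thesis .
qed

lemma expectation_swap_pmf_finite:
  fixes f :: "'a \<Rightarrow> 'b \<Rightarrow> real"
  assumes "finite (set_pmf p)" "finite (set_pmf q)"
  shows "measure_pmf.expectation p (\<lambda>a. measure_pmf.expectation q (\<lambda>b. f a b)) =
    measure_pmf.expectation q (\<lambda>b. measure_pmf.expectation p (\<lambda>a. f a b))"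
proof -
  have "measure_pmf.expectation (pair_pmf p q) (\<lambda>(a, b). f a b) =
      measure_pmf.expectation (pair_pmf q p) (\<lambda>(b, a). f a b)"
    by (subst pair_commute_pmf) (simp add: case_prod_unfold)
  then show ?thesis using assms by (simp add: expectation_pair_pmf_finite)
qed

lemma expectation_mono_pmf_finite:
  fixes f g :: "'a \<Rightarrow> real"
  assumes "finite (set_pmf p)" "\<And>x. x \<in> set_pmf p \<Longrightarrow> f x \<le> g x"
  shows "measure_pmf.expectation p f \<le> measure_pmf.expectation p g"
  using assms by (intro integral_mono_AE integrable_measure_pmf_finite) (auto intro: AE_pmfI)

text \<open>Twice the variance is the mean squared difference of two independent copies, and by
  symmetry the positive part carries exactly half of that.\<close>

lemma variance_pmf_finite:
  fixes f :: "'a \<Rightarrow> real"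
  assumes p: "finite (set_pmf p)"
  shows "measure_pmf.expectation p (\<lambda>x. (f x)\<^sup>2) - (measure_pmf.expectation p f)\<^sup>2 =
    measure_pmf.expectation p (\<lambda>x. measure_pmf.expectation p (\<lambda>y. (max 0 (f x - f y))\<^sup>2))"
    (is "_ = ?V")
proof -
  note [simp] = integrable_measure_pmf_finite[OF p]
  have "?V = measure_pmf.expectation p (\<lambda>x. measure_pmf.expectation p (\<lambda>y. (max 0 (f y - f x))\<^sup>2))"
    by (rule expectation_swap_pmf_finite[OF p p])
  then have "2 * ?V = measure_pmf.expectation p (\<lambda>x. measure_pmf.expectation p
      (\<lambda>y. (max 0 (f x - f y))\<^sup>2 + (max 0 (f y - f x))\<^sup>2))" by simp
  also have "(\<lambda>x y. (max 0 (f x - f y))\<^sup>2 + (max 0 (f y - f x))\<^sup>2) =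
      (\<lambda>x y. (f x)\<^sup>2 + ((f y)\<^sup>2 - 2 * f x * f y))"
    by (intro ext) (auto simp: max_def power2_eq_square algebra_simps)
  also have "measure_pmf.expectation p (\<lambda>x. measure_pmf.expectation p
      (\<lambda>y. (f x)\<^sup>2 + ((f y)\<^sup>2 - 2 * f x * f y))) =
      2 * (measure_pmf.expectation p (\<lambda>x. (f x)\<^sup>2) - (measure_pmf.expectation p f)\<^sup>2)"
    by (simp add: power2_eq_square mult.assoc)
  finally show ?thesis by simp
qed

lemma square_expectation_pmf_finite:
  fixes f :: "'a \<Rightarrow> real"
  assumes p: "finite (set_pmf p)"
  shows "(measure_pmf.expectation p f)\<^sup>2 \<le> measure_pmf.expectation p (\<lambda>x. (f x)\<^sup>2)"
proof -
  have "0 \<le> measure_pmf.expectation p (\<lambda>x. measure_pmf.expectation p (\<lambda>y. (max 0 (f x - f y))\<^sup>2))"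
    by (intro Bochner_Integration.integral_nonneg) auto
  then show ?thesis unfolding variance_pmf_finite[OF p, of f, symmetric] by linarith
qed

lemma finite_set_Pi_pmf:
  assumes "finite I" "\<And>i. finite (set_pmf (p i))" shows "finite (set_pmf (Pi_pmf I d p))"
  by (rule finite_subset[OF set_Pi_pmf_subset'[OF assms(1)]]) (use assms in auto)

text \<open>Induction on the coordinates by the law of total variance: the conditional variance in
  the old coordinates is the induction hypothesis, the variance of the conditional mean
  \<open>G\<close> in the new one is handled by Jensen's inequality. In this one-sided form only
  decreases of \<open>f\<close> under resampling count.\<close>

theorem efron_stein_pmf:
  fixes f :: "('i \<Rightarrow> 'v) \<Rightarrow> real"
  assumes "finite I" "\<And>i. finite (set_pmf (p i))"
  shows "measure_pmf.expectation (Pi_pmf I d p) (\<lambda>x. (f x)\<^sup>2) - (measure_pmf.expectation (Pi_pmf I d p) f)\<^sup>2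
    \<le> (\<Sum>i\<in>I. measure_pmf.expectation (Pi_pmf I d p)
        (\<lambda>x. measure_pmf.expectation (p i) (\<lambda>y. (max 0 (f x - f (x(i := y))))\<^sup>2)))"
  using assms(1)
proof (induction I arbitrary: f rule: finite_induct)
  case empty
  then show ?case by simp
next
  case (insert i I)
  let ?P = "Pi_pmf I d p"
  let ?E = "measure_pmf.expectation"
  have fin: "finite (set_pmf ?P)" by (rule finite_set_Pi_pmf[OF insert(1) assms(2)])
  note fini = assms(2)[of i]
  note [simp] = integrable_measure_pmf_finite[OF fin] integrable_measure_pmf_finite[OF fini]
  have split: "?E (Pi_pmf (insert i I) d p) g = ?E (p i) (\<lambda>y. ?E ?P (\<lambda>x. g (x(i := y))))"
    for g :: "_ \<Rightarrow> real"
    by (simp add: Pi_pmf_insert[OF insert(1,2)] case_prod_unfold expectation_pair_pmf_finite[OF fini fin])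
  define G where "G y = ?E ?P (\<lambda>x. f (x(i := y)))" for y
  have "?E (p i) (\<lambda>y. ?E ?P (\<lambda>x. (f (x(i := y)))\<^sup>2) - (G y)\<^sup>2) \<le> ?E (p i) (\<lambda>y. \<Sum>j\<in>I. ?E ?P
      (\<lambda>x. ?E (p j) (\<lambda>y'. (max 0 (f (x(i := y)) - f ((x(j := y'))(i := y))))\<^sup>2)))"
    unfolding G_def by (intro expectation_mono_pmf_finite[OF fini] insert.IH)
  also have "\<dots> = (\<Sum>j\<in>I. ?E (p i) (\<lambda>y. ?E ?P
      (\<lambda>x. ?E (p j) (\<lambda>y'. (max 0 (f (x(i := y)) - f ((x(i := y))(j := y'))))\<^sup>2))))"
  proof -
    have "(x(j := y'))(i := y) = (x(i := y))(j := y')" if "j \<in> I" for x :: "'i \<Rightarrow> 'v" and j y y'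
      using that insert(2) by (intro fun_upd_twist) auto
    then show ?thesis by (subst Bochner_Integration.integral_sum) (auto intro!: sum.cong)
  qed
  finally have 1: "?E (p i) (\<lambda>y. ?E ?P (\<lambda>x. (f (x(i := y)))\<^sup>2)) - ?E (p i) (\<lambda>y. (G y)\<^sup>2) \<le> \<dots>"
    by simp
  have "(max 0 (G y - G y'))\<^sup>2 \<le> ?E ?P (\<lambda>x. (max 0 (f (x(i := y)) - f (x(i := y'))))\<^sup>2)" for y y'
  proof -
    have "G y - G y' = ?E ?P (\<lambda>x. f (x(i := y)) - f (x(i := y')))" by (simp add: G_def)
    also have "\<dots> \<le> ?E ?P (\<lambda>x. max 0 (f (x(i := y)) - f (x(i := y'))))"
      by (intro expectation_mono_pmf_finite[OF fin]) auto
    finally have "(max 0 (G y - G y'))\<^sup>2 \<le> (?E ?P (\<lambda>x. max 0 (f (x(i := y)) - f (x(i := y')))))\<^sup>2"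
      by (intro power_mono) (auto intro: Bochner_Integration.integral_nonneg)
    then show ?thesis using square_expectation_pmf_finite[OF fin] by (rule order_trans)
  qed
  then have "?E (p i) (\<lambda>y. ?E (p i) (\<lambda>y'. (max 0 (G y - G y'))\<^sup>2)) \<le>
      ?E (p i) (\<lambda>y. ?E (p i) (\<lambda>y'. ?E ?P (\<lambda>x. (max 0 (f (x(i := y)) - f (x(i := y'))))\<^sup>2)))"
    by (intro expectation_mono_pmf_finite[OF fini]) auto
  also have "\<dots> = ?E (p i) (\<lambda>y. ?E ?P (\<lambda>x. ?E (p i) (\<lambda>y'. (max 0 (f (x(i := y)) - f (x(i := y'))))\<^sup>2)))"
    by (simp add: expectation_swap_pmf_finite[OF fini fin])
  finally have 2: "?E (p i) (\<lambda>y. (G y)\<^sup>2) - (?E (p i) G)\<^sup>2 \<le> \<dots>"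
    using variance_pmf_finite[OF fini, of G] by simp
  show ?case unfolding split sum.insert[OF insert(1,2)] G_def[symmetric] using 1 2 by simp
qed

lemma exp_le_quadratic: fixes x :: real assumes "x \<le> 1" shows "exp x \<le> 1 + x + x\<^sup>2"
proof (cases "0 \<le> x")
  case True
  then show ?thesis using assms exp_bound[of x] by simp
next
  case False
  define u where "u = - x"
  have u: "0 < u" using False by (simp add: u_def)
  \<comment> \<open>With \<open>exp u\<close> replaced by its second Taylor polynomial, the desired
    product becomes 1 plus monomials with positive coefficients.\<close>
  have "(1 - u + u\<^sup>2) * (1 + u + u\<^sup>2 / 2) = 1 + u\<^sup>2 / 2 + u^3 / 2 + u^4 / 2"
    by (simp add: power2_eq_square power3_eq_cube power4_eq_xxxx field_simps)
  also have "\<dots> \<ge> 1" using u by simp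
  finally have "1 \<le> (1 - u + u\<^sup>2) * (1 + u + u\<^sup>2 / 2)" .
  also have "\<dots> \<le> (1 - u + u\<^sup>2) * exp u"
  proof (intro mult_left_mono)
    have "0 \<le> (1 - u)\<^sup>2 + u" using u by simp
    then show "0 \<le> 1 - u + u\<^sup>2" using u zero_le_power2[of "u - 1/2"]
      by (simp add: power2_eq_square algebra_simps)
  qed (use u exp_lower_Taylor_quadratic[of u] in auto)
  finally show ?thesis using u by (simp add: u_def exp_minus field_simps)
qed

lemma exp_diff_le: fixes a b :: real shows "exp a - exp b \<le> exp a * (a - b)"
proof -
  have "exp a * (1 + (b - a)) \<le> exp a * exp (b - a)" by (intro mult_left_mono exp_ge_add_one_self) auto
  then show ?thesis by (simp add: exp_diff algebra_simps)
qed

text \<open>Applying the Efron--Stein inequality to \<open>exp (t * f / 2)\<close> compares the moment generating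
  function at \<open>t\<close> with its square at \<open>t / 2\<close>; the recursion is then iterated.\<close>

theorem exponential_moment_pmf:
  fixes f :: "('i \<Rightarrow> 'v) \<Rightarrow> real"
  assumes I: "finite I" and p: "\<And>i. finite (set_pmf (p i))" and c: "0 \<le> c"
    and mean: "measure_pmf.expectation (Pi_pmf I d p) f = 0"
    and diff: "\<And>x. x \<in> set_pmf (Pi_pmf I d p) \<Longrightarrow>
      (\<Sum>i\<in>I. measure_pmf.expectation (p i) (\<lambda>y. (max 0 (f x - f (x(i := y))))\<^sup>2)) \<le> c"
    and t: "0 \<le> t" "c * t\<^sup>2 \<le> 1"
  shows "measure_pmf.expectation (Pi_pmf I d p) (\<lambda>x. exp (t * f x)) \<le> exp (c * t\<^sup>2)"
proof -
  let ?P = "Pi_pmf I d p"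
  let ?E = "measure_pmf.expectation"
  have fin: "finite (set_pmf ?P)" by (rule finite_set_Pi_pmf[OF I p])
  note [simp] = integrable_measure_pmf_finite[OF fin] integrable_measure_pmf_finite[OF p]
  define F where "F t = ?E ?P (\<lambda>x. exp (t * f x))" for t
  have F0: "0 \<le> F t" for t unfolding F_def by (intro Bochner_Integration.integral_nonneg) auto
  have rec: "F t * (1 - t\<^sup>2 * c / 4) \<le> (F (t / 2))\<^sup>2" if t: "0 \<le> t" for t
  proof -
    let ?g = "\<lambda>x. exp (t / 2 * f x)"
    have sq: "(\<lambda>x. (?g x)\<^sup>2) = (\<lambda>x. exp (t * f x))"
      by (simp add: power2_eq_square flip: exp_add)
    \<comment> \<open>The exponential is taken at the larger of the two values, that is at
      \<open>x\<close>. It thus leaves the inner expectation and the sum over coordinates, to which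
      \<open>diff\<close> then applies.\<close>
    have *: "(max 0 (?g x - ?g x'))\<^sup>2 \<le> (t\<^sup>2 / 4 * exp (t * f x)) * (max 0 (f x - f x'))\<^sup>2" for x x'
    proof -
      have "max 0 (?g x - ?g x') \<le> ?g x * (t / 2 * max 0 (f x - f x'))"
      proof (cases "f x' \<le> f x")
        case True
        then show ?thesis using t exp_diff_le[of "t / 2 * f x" "t / 2 * f x'"]
          by (auto simp: max_def right_diff_distrib mult_left_mono)
      next
        case False
        then have "?g x \<le> ?g x'" using t by (simp add: mult_left_mono)
        then show ?thesis using t by (simp add: max_def)
      qed
      then have "(max 0 (?g x - ?g x'))\<^sup>2 \<le> (?g x * (t / 2 * max 0 (f x - f x')))\<^sup>2"
        by (intro power_mono) auto
      also have "\<dots> = (?g x)\<^sup>2 * (t\<^sup>2 / 4 * (max 0 (f x - f x'))\<^sup>2)"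
        by (simp add: power_mult_distrib power_divide)
      also have "(?g x)\<^sup>2 = exp (t * f x)" using sq by meson
      finally show ?thesis by (simp add: mult_ac)
    qed
    have "F t - (F (t / 2))\<^sup>2 \<le> (\<Sum>i\<in>I. ?E ?P (\<lambda>x. ?E (p i) (\<lambda>y. (max 0 (?g x - ?g (x(i := y))))\<^sup>2)))"
      using efron_stein_pmf[OF I p, where f = ?g and d = d] unfolding sq F_def by simp
    also have "\<dots> \<le> (\<Sum>i\<in>I. ?E ?P (\<lambda>x. ?E (p i) (\<lambda>y. (t\<^sup>2 / 4 * exp (t * f x)) * (max 0 (f x - f (x(i := y))))\<^sup>2)))"
      by (intro sum_mono expectation_mono_pmf_finite[OF fin] expectation_mono_pmf_finite[OF p] *)
    also have "\<dots> = ?E ?P (\<lambda>x. (t\<^sup>2 / 4 * exp (t * f x)) * (\<Sum>i\<in>I. ?E (p i) (\<lambda>y. (max 0 (f x - f (x(i := y))))\<^sup>2)))"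
      by (subst Bochner_Integration.integral_sum[symmetric]) (auto simp: sum_distrib_left)
    also have "\<dots> \<le> ?E ?P (\<lambda>x. (t\<^sup>2 / 4 * exp (t * f x)) * c)"
      by (intro expectation_mono_pmf_finite[OF fin] mult_left_mono diff) auto
    also have "\<dots> = F t * (t\<^sup>2 * c / 4)" by (simp add: F_def)
    finally show ?thesis by (simp add: algebra_simps)
  qed
  \<comment> \<open>The crude bound on \<open>f\<close> only starts the recursion at small
    \<open>t\<close>, where mean zero removes the linear term. Its share
    \<open>b\<^sup>2 / 2 ^ j\<close> vanishes as \<open>j\<close> grows.\<close>
  define b where "b = Max (insert 0 ((\<lambda>x. \<bar>f x\<bar>) ` set_pmf ?P))"
  have b: "\<bar>f x\<bar> \<le> b" if "x \<in> set_pmf ?P" for x using fin that by (auto simp: b_def)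
  have b0: "0 \<le> b" using fin by (auto simp: b_def)
  have small: "F t \<le> exp (t\<^sup>2 * b\<^sup>2)" if t: "0 \<le> t" "t * b \<le> 1" for t
  proof -
    have "F t \<le> ?E ?P (\<lambda>x. 1 + t * f x + t\<^sup>2 * b\<^sup>2)"
      unfolding F_def
    proof (rule expectation_mono_pmf_finite[OF fin])
      fix x assume x: "x \<in> set_pmf ?P"
      have "t * f x \<le> t * b" using b[OF x] t by (intro mult_left_mono) auto
      then have "exp (t * f x) \<le> 1 + t * f x + (t * f x)\<^sup>2" using t by (intro exp_le_quadratic) auto
      also have "(f x)\<^sup>2 \<le> b\<^sup>2" using b[OF x] b0 by (simp add: abs_le_square_iff[symmetric])
      then have "(t * f x)\<^sup>2 \<le> t\<^sup>2 * b\<^sup>2" by (simp add: power_mult_distrib mult_left_mono)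
      finally show "exp (t * f x) \<le> 1 + t * f x + t\<^sup>2 * b\<^sup>2" by simp
    qed
    also have "\<dots> = 1 + t\<^sup>2 * b\<^sup>2" using mean by simp
    also have "\<dots> \<le> exp (t\<^sup>2 * b\<^sup>2)" by (rule exp_ge_add_one_self)
    finally show ?thesis .
  qed
  have "F t \<le> exp (t\<^sup>2 * (c + b\<^sup>2 / 2 ^ j))" if "0 \<le> t" "c * t\<^sup>2 \<le> 1" "t * b \<le> 2 ^ j" for j t
    using that
  proof (induction j arbitrary: t)
    case 0
    then have "F t \<le> exp (t\<^sup>2 * b\<^sup>2)" by (intro small) auto
    also have "\<dots> \<le> exp (t\<^sup>2 * (c + b\<^sup>2))" using c by (simp add: mult_left_mono)
    finally show ?case by simp
  next
    case (Suc j)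
    have "c * (t / 2)\<^sup>2 \<le> 1" using Suc.prems c by (simp add: power_divide)
    then have IH: "F (t / 2) \<le> exp ((t / 2)\<^sup>2 * (c + b\<^sup>2 / 2 ^ j))" using Suc.prems by (intro Suc.IH) auto
    \<comment> \<open>The restriction \<open>c * t\<^sup>2 \<le> 1\<close> gives
      \<open>x \<le> 1 / 4\<close>, a range in which the factor \<open>1 / (1 - x)\<close> of the
      recursion is at most \<open>exp (2 * x)\<close>.\<close>
    define x where "x = t\<^sup>2 * c / 4"
    have x: "0 \<le> x" "x \<le> 1 / 4" using Suc.prems c by (auto simp: x_def mult.commute)
    have "1 \<le> (1 - x) * exp (2 * x)"
    proof -
      have "1 \<le> (1 - x) * (1 + 2 * x)" using x mult_left_mono[of x "1/2" x] by (simp add: algebra_simps)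
      also have "\<dots> \<le> (1 - x) * exp (2 * x)" using x by (intro mult_left_mono exp_ge_add_one_self) auto
      finally show ?thesis .
    qed
    then have "F t \<le> F t * ((1 - x) * exp (2 * x))" using F0[of t] by (simp add: mult_le_cancel_left1)
    also have "\<dots> = (F t * (1 - x)) * exp (2 * x)" by simp
    also have "\<dots> \<le> (F (t / 2))\<^sup>2 * exp (2 * x)"
      using rec[OF Suc.prems(1)] by (intro mult_right_mono) (auto simp: x_def)
    also have "\<dots> \<le> (exp ((t / 2)\<^sup>2 * (c + b\<^sup>2 / 2 ^ j)))\<^sup>2 * exp (2 * x)"
      using IH F0 by (intro mult_right_mono power_mono) auto
    also have "\<dots> = exp (2 * ((t / 2)\<^sup>2 * (c + b\<^sup>2 / 2 ^ j)) + 2 * x)"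
      by (simp add: power2_eq_square flip: exp_add)
    \<comment> \<open>The constant \<open>c\<close> reproduces itself: half of it comes from the two
      factors at \<open>t / 2\<close>, the other half from \<open>2 * x\<close>. The share of
      \<open>b\<close> is halved.\<close>
    also have "2 * ((t / 2)\<^sup>2 * (c + b\<^sup>2 / 2 ^ j)) + 2 * x = t\<^sup>2 * (c + b\<^sup>2 / 2 ^ Suc j)"
      by (simp add: x_def power_divide field_simps)
    finally show ?case .
  qed
  moreover obtain j0 :: nat where "t * b < 2 ^ j0" using real_arch_pow[of 2 "t * b"] by auto
  then have "t * b \<le> 2 ^ j" if "j0 \<le> j" for j
    using power_increasing[OF that, of "2::real"] by linarith
  ultimately have "\<forall>j\<ge>j0. F t \<le> exp (t\<^sup>2 * (c + b\<^sup>2 / 2 ^ j))" using t by blast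
  moreover have "(\<lambda>j. exp (t\<^sup>2 * (c + b\<^sup>2 / 2 ^ j))) \<longlonglongrightarrow> exp (t\<^sup>2 * (c + 0))"
    by (intro tendsto_intros LIMSEQ_divide_realpow_zero) auto
  ultimately have "F t \<le> exp (t\<^sup>2 * (c + 0))" by (intro LIMSEQ_le_const[rotated]) auto
  then show ?thesis by (simp add: F_def mult.commute)
qed

section \<open>Poisson processes\<close>

lemma nn_integral_lborel_translate:
  fixes g :: "'a::euclidean_space \<Rightarrow> ennreal"
  assumes [measurable]: "g \<in> borel_measurable borel"
  shows "(\<integral>\<^sup>+x. g (t + x) \<partial>lborel) = (\<integral>\<^sup>+x. g x \<partial>lborel)"
proof -
  have "(\<integral>\<^sup>+x. g x \<partial>lborel) = (\<integral>\<^sup>+x. g x \<partial>distr lborel borel ((+) t))" by (simp add: lborel_distr_plus)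
  also have "\<dots> = (\<integral>\<^sup>+x. g (t + x) \<partial>lborel)" by (subst nn_integral_distr) auto
  finally show ?thesis by simp
qed

lemma nn_integral_lborel_uminus:
  fixes g :: "'a::euclidean_space \<Rightarrow> ennreal"
  assumes [measurable]: "g \<in> borel_measurable borel"
  shows "(\<integral>\<^sup>+x. g (- x) \<partial>lborel) = (\<integral>\<^sup>+x. g x \<partial>lborel)"
proof -
  have "(lborel :: 'a measure) = distr lborel borel uminus"
    using lborel_affine[of "-1" "0 :: 'a"] by (simp add: density_1)
  then have "(\<integral>\<^sup>+x. g x \<partial>lborel) = (\<integral>\<^sup>+x. g x \<partial>distr lborel borel uminus)" by metis
  also have "\<dots> = (\<integral>\<^sup>+x. g (- x) \<partial>lborel)" by (subst nn_integral_distr) auto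
  finally show ?thesis by simp
qed

text \<open>Uniqueness of Haar measure up to a factor, the factor being determined by the unit ball.\<close>

lemma distr_lborel_orthogonal:
  fixes f :: "'a::euclidean_space \<Rightarrow> 'a"
  assumes f: "orthogonal_transformation f"
  shows "distr lborel borel f = lborel"
proof -
  have lin: "linear f" using f by (rule orthogonal_transformation_linear)
  have [measurable]: "f \<in> borel_measurable borel"
    by (intro borel_measurable_continuous_onI linear_continuous_on linear_conv_bounded_linear[THEN iffD1] lin)
  define \<mu> where "\<mu> = distr lborel borel f"
  have [simp, measurable_cong]: "sets \<mu> = sets borel" and [simp]: "space \<mu> = UNIV" by (auto simp: \<mu>_def)
  have inv: "(\<integral>\<^sup>+x. g (t + x) \<partial>\<mu>) = (\<integral>\<^sup>+x. g x \<partial>\<mu>)" if [measurable]: "g \<in> borel_measurable borel" for g t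
  proof -
    obtain t' where t': "t = f t'" using orthogonal_transformation_surj[OF f] by (auto simp: surj_def)
    have "(\<integral>\<^sup>+x. g (t + x) \<partial>\<mu>) = (\<integral>\<^sup>+x. g (f (t' + x)) \<partial>lborel)"
      unfolding \<mu>_def by (subst nn_integral_distr) (auto simp: t' linear_add[OF lin])
    also have "\<dots> = (\<integral>\<^sup>+x. g (f x) \<partial>lborel)" by (rule nn_integral_lborel_translate) simp
    also have "\<dots> = (\<integral>\<^sup>+x. g x \<partial>\<mu>)" unfolding \<mu>_def by (subst nn_integral_distr) auto
    finally show ?thesis .
  qed
  have vim: "f -` ball 0 r = ball (0 :: 'a) r" for r
    using orthogonal_transformation_norm[OF f] by (auto simp: dist_norm)
  have ball: "emeasure \<mu> (ball 0 r) = emeasure lborel (ball (0 :: 'a) r)" for r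
    unfolding \<mu>_def using vim by (subst emeasure_distr) auto
  interpret \<mu>: sigma_finite_measure \<mu>
  proof
    show "\<exists>A. countable A \<and> A \<subseteq> sets \<mu> \<and> \<Union> A = space \<mu> \<and> (\<forall>a\<in>A. emeasure \<mu> a \<noteq> \<infinity>)"
    proof (intro exI[of _ "range (\<lambda>n::nat. ball 0 (real n))"] conjI)
      show "\<Union> (range (\<lambda>n::nat. ball (0::'a) (real n))) = space \<mu>"
        using reals_Archimedean2 by (auto simp: dist_norm)
      show "\<forall>a\<in>range (\<lambda>n::nat. ball 0 (real n)). emeasure \<mu> a \<noteq> \<infinity>"
        using ball emeasure_lborel_ball_finite[of 0] by (auto simp: less_top[symmetric])
    qed auto
  qed
  interpret pair_sigma_finite \<mu> lborel ..
  let ?b = "ball (0::'a) 1"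
  \<comment> \<open>The double integral of \<open>i x * j (x + y)\<close> is evaluated in both
    orders; translation invariance of both measures and the reflection of \<open>lborel\<close>
    separate the factors.\<close>
  have main: "emeasure \<mu> A * emeasure lborel ?b = emeasure \<mu> ?b * emeasure lborel A"
    if [measurable]: "A \<in> sets borel" for A
  proof -
    define i j :: "'a \<Rightarrow> ennreal" where "i = indicator A" and "j = indicator ?b"
    have [measurable]: "i \<in> borel_measurable borel" "j \<in> borel_measurable borel" 
      unfolding i_def j_def by (auto intro!: borel_measurable_indicator)
    have "emeasure \<mu> A * emeasure lborel ?b = (\<integral>\<^sup>+x. i x \<partial>\<mu>) * (\<integral>\<^sup>+y. j y \<partial>lborel)"
      by (simp add: i_def j_def)
    also have "\<dots> = (\<integral>\<^sup>+x. i x * (\<integral>\<^sup>+y. j (x + y) \<partial>lborel) \<partial>\<mu>)"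
      by (simp add: nn_integral_lborel_translate nn_integral_multc)
    also have "\<dots> = (\<integral>\<^sup>+x. (\<integral>\<^sup>+y. i x * j (x + y) \<partial>lborel) \<partial>\<mu>)"
      by (intro nn_integral_cong) (simp add: nn_integral_cmult)
    also have "\<dots> = (\<integral>\<^sup>+y. (\<integral>\<^sup>+x. i x * j (x + y) \<partial>\<mu>) \<partial>lborel)"
      by (rule Fubini'[symmetric]) simp
    also have "\<dots> = (\<integral>\<^sup>+y. (\<integral>\<^sup>+x. i (x - y) * j x \<partial>\<mu>) \<partial>lborel)"
    proof (rule nn_integral_cong)
      fix y
      show "(\<integral>\<^sup>+x. i x * j (x + y) \<partial>\<mu>) = (\<integral>\<^sup>+x. i (x - y) * j x \<partial>\<mu>)"
        using inv[of "\<lambda>x. i (x - y) * j x" y] by (simp add: add.commute)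
    qed
    also have "\<dots> = (\<integral>\<^sup>+x. (\<integral>\<^sup>+y. i (x - y) * j x \<partial>lborel) \<partial>\<mu>)"
      by (rule Fubini') simp
    also have "\<dots> = (\<integral>\<^sup>+x. (\<integral>\<^sup>+y. i y \<partial>lborel) * j x \<partial>\<mu>)"
    proof (rule nn_integral_cong)
      fix x
      have "(\<integral>\<^sup>+y. i (x - y) \<partial>lborel) = (\<integral>\<^sup>+y. i (x + y) \<partial>lborel)"
        using nn_integral_lborel_uminus[of "\<lambda>y. i (x + y)"] by simp
      then show "(\<integral>\<^sup>+y. i (x - y) * j x \<partial>lborel) = (\<integral>\<^sup>+y. i y \<partial>lborel) * j x"
        by (simp add: nn_integral_multc nn_integral_lborel_translate)
    qed
    also have "\<dots> = (\<integral>\<^sup>+y. i y \<partial>lborel) * (\<integral>\<^sup>+x. j x \<partial>\<mu>)" by (rule nn_integral_cmult) simp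
    also have "\<dots> = emeasure \<mu> ?b * emeasure lborel A" by (simp add: i_def j_def mult.commute)
    finally show ?thesis .
  qed
  have b: "emeasure lborel ?b \<noteq> 0" "emeasure lborel ?b \<noteq> top"
    using emeasure_lborel_ball_finite[of "0::'a" 1] content_ball_gt_0_iff[of "0::'a" 1]
    by (auto simp: measure_def)
  show ?thesis unfolding \<mu>_def[symmetric]
  proof (rule measure_eqI)
    fix A assume "A \<in> sets \<mu>"
    then have "emeasure lborel ?b * emeasure \<mu> A = emeasure lborel ?b * emeasure lborel A"
      using main[of A] ball by (simp add: mult.commute)
    then show "emeasure \<mu> A = emeasure lborel A" using b by (simp add: ennreal_mult_cancel_left)
  qed simp
qed

lemma distr_lborel_rigid:
  fixes f :: "'a::euclidean_space \<Rightarrow> 'a"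
  assumes f: "orthogonal_transformation f"
  shows "distr lborel borel (\<lambda>v. b + f v) = lborel"
proof -
  have [measurable]: "f \<in> borel_measurable borel"
    by (intro borel_measurable_continuous_onI linear_continuous_on linear_conv_bounded_linear[THEN iffD1]
        orthogonal_transformation_linear f)
  have "distr (distr lborel borel f) borel ((+) b) = lborel"
    unfolding distr_lborel_orthogonal[OF f] by (rule lborel_distr_plus)
  then show ?thesis by (subst (asm) distr_distr) (auto simp: comp_def)
qed

lemma bounded_isometry_vimage:
  fixes \<phi> :: "'a::metric_space \<Rightarrow> 'a"
  assumes "\<And>u v. dist (\<phi> u) (\<phi> v) = dist u v" "bounded B" shows "bounded (\<phi> -` B)"
proof -
  obtain e where e: "\<And>y. y \<in> B \<Longrightarrow> dist (\<phi> undefined) y \<le> e" using assms(2) unfolding bounded_any_center[of _ "\<phi> undefined"] by blast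
  show ?thesis unfolding bounded_any_center[of _ undefined] using e assms(1) by (metis vimage_eq)
qed

text \<open>The counts of a point process are indexed by the sets themselves, so replacing sets by
  their preimages under a motion is a change of index.\<close>

lemma (in prob_space) indep_sets_reindex:
  assumes inj: "inj_on g I" and F: "indep_sets F (g ` I)"
  shows "indep_sets (\<lambda>i. F (g i)) I"
proof (rule indep_setsI)
  show "F (g i) \<subseteq> events" if "i \<in> I" for i using F that by (auto simp: indep_sets_def)
next
  fix A J assume J: "J \<noteq> {}" "J \<subseteq> I" "finite J" "\<forall>j\<in>J. A j \<in> F (g j)"
  have injJ: "inj_on g J" using inj J(2) by (rule inj_on_subset)
  let ?A = "\<lambda>b. A (the_inv_into J g b)"
  have A: "?A (g j) = A j" if "j \<in> J" for j using the_inv_into_f_f[OF injJ that] by simp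
  have "prob (\<Inter>b\<in>g ` J. ?A b) = (\<Prod>b\<in>g ` J. prob (?A b))"
    using J A by (intro indep_setsD[OF F]) auto
  then show "prob (\<Inter>j\<in>J. A j) = (\<Prod>j\<in>J. prob (A j))"
    using A by (simp add: prod.reindex[OF injJ])
qed

text \<open>The moved points in \<open>B\<close> are counted by the original points in the preimage
  of \<open>B\<close>, which is again bounded and Borel, has the same volume and preserves
  disjointness.\<close>

lemma unit_poisson_process_rigid:
  fixes \<phi> :: "real ^ 'd \<Rightarrow> real ^ 'd"
  assumes X: "unit_poisson_process M X" and f: "orthogonal_transformation f" and \<phi>: "\<phi> = (\<lambda>v. b + f v)"
  shows "unit_poisson_process M (\<lambda>\<omega>. \<phi> ` X \<omega>)"
proof -
  interpret prob_space M using X by (simp add: unit_poisson_process_def)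
  have iso: "dist (\<phi> u) (\<phi> v) = dist u v" for u v
    using orthogonal_transformation_isometry[of f] f by (simp add: \<phi>)
  have inj: "inj \<phi>" using orthogonal_transformation_inj[OF f] by (auto simp: \<phi> inj_def)
  have surj: "surj \<phi>"
  proof -
    have "\<exists>v. y = b + f v" for y
      using orthogonal_transformation_surj[OF f] by (metis surj_def add.commute diff_add_cancel)
    then show ?thesis by (auto simp: \<phi> surj_def)
  qed
  have [measurable]: "\<phi> \<in> borel_measurable borel" unfolding \<phi>
    by (intro borel_measurable_continuous_onI continuous_intros linear_continuous_on
        linear_conv_bounded_linear[THEN iffD1] orthogonal_transformation_linear f)
  have meas: "measure lborel (\<phi> -` B) = measure lborel B" if "B \<in> sets borel" for B
  proof -
    have "measure (distr lborel borel \<phi>) B = measure lborel (\<phi> -` B)"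
      using that by (subst measure_distr) auto
    then show ?thesis using distr_lborel_rigid[OF f, of b] by (simp add: \<phi>)
  qed
  have vim: "\<phi> ` A \<inter> B = \<phi> ` (A \<inter> \<phi> -` B)" for A B by auto
  have count: "point_count (\<lambda>\<omega>. \<phi> ` X \<omega>) B = point_count X (\<phi> -` B)" for B
    by (intro ext) (simp add: point_count_def vim card_image[OF inj_on_subset[OF inj]])
  have B: "\<phi> -` B \<in> sets borel \<and> bounded (\<phi> -` B)" if "B \<in> sets borel \<and> bounded B" for B
    using that measurable_sets[of \<phi> borel borel B] bounded_isometry_vimage[of \<phi> B] iso by auto
  have ind: "indep_vars (\<lambda>_. count_space UNIV) (point_count (\<lambda>\<omega>. \<phi> ` X \<omega>)) \<B>"
    if \<B>: "finite \<B>" "disjoint \<B>" "\<forall>B\<in>\<B>. B \<in> sets borel \<and> bounded B" for \<B>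
  proof -
    have injv: "inj_on (\<lambda>B. \<phi> -` B) \<B>" by (rule inj_onI) (metis surj surj_image_vimage_eq)
    have "disjoint ((\<lambda>B. \<phi> -` B) ` \<B>)" using \<B>(2) by (force simp: disjoint_def)
    then have "indep_vars (\<lambda>_. count_space UNIV) (point_count X) ((\<lambda>B. \<phi> -` B) ` \<B>)"
      using X \<B> B by (auto simp: unit_poisson_process_def)
    then show ?thesis
      unfolding count indep_vars_def2
      using indep_sets_reindex[OF injv, of "\<lambda>C. {point_count X C -` A \<inter> space M | A. A \<in> sets (count_space UNIV)}"]
      by auto
  qed
  show ?thesis unfolding unit_poisson_process_def
  proof (intro conjI ballI allI impI)
    fix \<omega> B assume "\<omega> \<in> space M" "bounded (B :: (real ^ 'd) set)"
    then have "finite (X \<omega> \<inter> \<phi> -` B)"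
      using X bounded_isometry_vimage[of \<phi> B] iso by (auto simp: unit_poisson_process_def)
    then show "finite (\<phi> ` X \<omega> \<inter> B)" by (simp add: vim)
  next
    fix B :: "(real ^ 'd) set" assume "B \<in> sets borel \<and> bounded B"
    then show "point_count (\<lambda>\<omega>. \<phi> ` X \<omega>) B \<in> M \<rightarrow>\<^sub>M count_space UNIV"
      "\<And>n. measure M {\<omega> \<in> space M. point_count (\<lambda>\<omega>. \<phi> ` X \<omega>) B \<omega> = n} =
        exp (- measure lborel B) * measure lborel B ^ n / fact n"
      using X B[of B] meas[of B] by (auto simp: unit_poisson_process_def count)
  qed (use ind in \<open>auto intro: prob_space_axioms\<close>)
qed

section \<open>Occupied cells as independent variables\<close>

lemma unit_poisson_process_occupancy:
  fixes B :: "'j \<Rightarrow> (real ^ 'd) set"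
  assumes X: "unit_poisson_process M X" and J: "finite J"
    and B: "\<And>j. j \<in> J \<Longrightarrow> B j \<in> sets borel" "\<And>j. j \<in> J \<Longrightarrow> bounded (B j)" "\<And>j. j \<in> J \<Longrightarrow> B j \<noteq> {}"
    and disj: "\<And>i j. i \<in> J \<Longrightarrow> j \<in> J \<Longrightarrow> i \<noteq> j \<Longrightarrow> B i \<inter> B j = {}"
  shows "{\<omega> \<in> space M. \<forall>j\<in>J. X \<omega> \<inter> B j \<noteq> {} \<longleftrightarrow> j \<in> S} \<in> sets M" (is "?E \<in> _")
    and "measure M {\<omega> \<in> space M. \<forall>j\<in>J. X \<omega> \<inter> B j \<noteq> {} \<longleftrightarrow> j \<in> S} =
      (\<Prod>j\<in>J. if j \<in> S then 1 - exp (- measure lborel (B j)) else exp (- measure lborel (B j)))"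
proof -
  interpret prob_space M using X by (simp add: unit_poisson_process_def)
  define A :: "'j \<Rightarrow> nat set" where "A j = (if j \<in> S then - {0} else {0})" for j
  have occ: "X \<omega> \<inter> B j \<noteq> {} \<longleftrightarrow> j \<in> S \<longleftrightarrow> point_count X (B j) \<omega> \<in> A j" if "\<omega> \<in> space M" "j \<in> J" for \<omega> j
    using X B that by (auto simp: unit_poisson_process_def A_def point_count_def)
  have rv: "point_count X (B j) \<in> M \<rightarrow>\<^sub>M count_space UNIV" if "j \<in> J" for j
    using X B that by (auto simp: unit_poisson_process_def)
  have pr: "prob (point_count X (B j) -` A j \<inter> space M) =
      (if j \<in> S then 1 - exp (- measure lborel (B j)) else exp (- measure lborel (B j)))" if j: "j \<in> J" for j
  proof -
    have "measure M {\<omega> \<in> space M. point_count X (B j) \<omega> = 0} = exp (- measure lborel (B j))"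
      using X B[OF j] by (auto simp: unit_poisson_process_def)
    also have "{\<omega> \<in> space M. point_count X (B j) \<omega> = 0} = point_count X (B j) -` {0} \<inter> space M" by auto
    finally have 0: "prob (point_count X (B j) -` {0} \<inter> space M) = exp (- measure lborel (B j))" .
    have "point_count X (B j) -` (- {0}) \<inter> space M = space M - (point_count X (B j) -` {0} \<inter> space M)" by auto
    then show ?thesis using 0 prob_compl[OF measurable_sets[OF rv[OF j], of "{0}"]] by (auto simp: A_def)
  qed
  have eq: "?E = (\<Inter>j\<in>J. point_count X (B j) -` A j \<inter> space M) \<inter> space M"
    using occ by (auto simp: )
  show "?E \<in> sets M" unfolding eq
  proof (cases "J = {}")
    case False
    then show "(\<Inter>j\<in>J. point_count X (B j) -` A j \<inter> space M) \<inter> space M \<in> sets M"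
      using J by (intro sets.Int sets.finite_INT measurable_sets[OF rv]) auto
  qed simp
  show "prob ?E = (\<Prod>j\<in>J. if j \<in> S then 1 - exp (- measure lborel (B j)) else exp (- measure lborel (B j)))"
  proof (cases "J = {}")
    case True
    then show ?thesis by (simp add: prob_space)
  next
    case False
    \<comment> \<open>Disjoint nonempty sets are distinct, so the indexed family can be exchanged
      for its image, over which independence is stated.\<close>
    have inj: "inj_on B J" using B(3) disj by (metis inf.idem inj_onI)
    have "disjoint (B ` J)" using disj by (auto simp: disjoint_def)
    then have ind: "indep_vars (\<lambda>_. count_space UNIV) (point_count X) (B ` J)"
      using X J B by (auto simp: unit_poisson_process_def)
    let ?A = "\<lambda>b. A (the_inv_into J B b)"
    have "prob (\<Inter>b\<in>B ` J. point_count X b -` ?A b \<inter> space M) = (\<Prod>b\<in>B ` J. prob (point_count X b -` ?A b \<inter> space M))"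
      using False J by (intro indep_varsD_finite[OF ind]) auto
    also have "(\<Inter>b\<in>B ` J. point_count X b -` ?A b \<inter> space M) = ?E"
      unfolding eq using False by (auto simp: the_inv_into_f_f[OF inj])
    also have "(\<Prod>b\<in>B ` J. prob (point_count X b -` ?A b \<inter> space M)) = (\<Prod>j\<in>J. prob (point_count X (B j) -` A j \<inter> space M))"
      by (subst prod.reindex[OF inj]) (auto simp: the_inv_into_f_f[OF inj] intro!: prod.cong)
    finally show ?thesis using pr by simp
  qed
qed

lemma gidx_vimage_borel [measurable]: "gidx l a -` {z} \<in> sets borel"
proof -
  have [measurable]: "(\<lambda>x :: real ^ 'd. x $ i) \<in> borel_measurable borel" for i
    by (intro borel_measurable_continuous_onI continuous_intros)
  have "gidx l a -` {z} = {x \<in> space borel. \<forall>i\<in>UNIV. of_int (z $ i) \<le> (x $ i - a $ i) / l \<and> (x $ i - a $ i) / l < of_int (z $ i) + 1}"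
    by (auto simp: gidx_def vec_eq_iff floor_eq_iff)
  also have "\<dots> \<in> sets borel" by measurable
  finally show ?thesis .
qed

lemma cell_eq: "cell l e a z w = gidx l a -` {z} \<inter> gidx e a -` {w}"
  by (auto simp: cell_def)

lemma gidx_vimage_subset: "0 < l \<Longrightarrow> gidx l a -` {z} \<subseteq> grid_cube l a z"
  using gidx_mem_grid_cube[of l _ a] by auto

lemma cell_borel: "cell l e a z w \<in> sets borel"
  unfolding cell_eq by measurable

lemma cell_bounded: "0 < l \<Longrightarrow> bounded (cell l e a z w)"
  by (rule bounded_subset[of "grid_cube l a z"])
    (use gidx_vimage_subset[of l a z] in \<open>auto simp: grid_cube_def cell_eq intro: bounded_cbox\<close>)

lemma finite_cells:
  fixes a :: "real ^ 'd"
  assumes l: "0 < l" and e: "0 < e" shows "finite {w. cell l e a z w \<noteq> {}}"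
proof (cases "\<exists>y. gidx l a y = z")
  case False
  then have "{w. cell l e a z w \<noteq> {}} = {}" by (auto simp: cell_def)
  then show ?thesis by simp
next
  case True
  then obtain y where y: "gidx l a y = z" by blast
  have "{w. cell l e a z w \<noteq> {}} \<subseteq> region e a y (sqrt (real CARD('d)) * l)"
  proof
    fix w assume "w \<in> {w. cell l e a z w \<noteq> {}}"
    then obtain x where x: "gidx l a x = z" "gidx e a x = w" by (auto simp: cell_def)
    have "dist y x \<le> sqrt (real CARD('d)) * l"
      using gidx_mem_grid_cube[OF l, of y a] gidx_mem_grid_cube[OF l, of x a] x y l
      by (intro grid_cube_dist) auto
    then show "w \<in> region e a y (sqrt (real CARD('d)) * l)"
      using gidx_mem_grid_cube[OF e, of x a] x by (auto simp: region_def)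
  qed
  then show ?thesis using region_bound(1)[OF e, of "sqrt (real CARD('d)) * l" a y] l
    by (auto intro: finite_subset)
qed

text \<open>The law of the set of occupied cells of one cube, written without reference to a
  probability space or a process, so that all Poisson processes share it.\<close>

definition disc_pmf :: "real \<Rightarrow> real \<Rightarrow> real ^ 'd \<Rightarrow> int ^ 'd \<Rightarrow> (int ^ 'd) set pmf" where
  "disc_pmf l e a z = map_pmf Collect (Pi_pmf {w. cell l e a z w \<noteq> {}} False
     (\<lambda>w. bernoulli_pmf (1 - exp (- measure lborel (cell l e a z w)))))"

lemma pmf_disc_pmf:
  assumes "0 < l" "0 < e" "T \<subseteq> {w. cell l e a z w \<noteq> {}}"
  shows "pmf (disc_pmf l e a z) T = (\<Prod>w\<in>{w. cell l e a z w \<noteq> {}}. if w \<in> T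
    then 1 - exp (- measure lborel (cell l e a z w)) else exp (- measure lborel (cell l e a z w)))"
proof -
  have bern: "pmf (bernoulli_pmf (1 - exp (- measure lborel (cell l e a z w)))) (w \<in> T) = (if w \<in> T
      then 1 - exp (- measure lborel (cell l e a z w)) else exp (- measure lborel (cell l e a z w)))" for w
    by simp
  have "inj (Collect :: (int ^ 'd \<Rightarrow> bool) \<Rightarrow> _)" by (auto simp: inj_def)
  from pmf_map_inj'[OF this, of _ "\<lambda>w. w \<in> T"] have
    "pmf (disc_pmf l e a z) T = pmf (Pi_pmf {w. cell l e a z w \<noteq> {}} False
       (\<lambda>w. bernoulli_pmf (1 - exp (- measure lborel (cell l e a z w))))) (\<lambda>w. w \<in> T)"
    unfolding disc_pmf_def by simp
  also have "\<dots> = (\<Prod>w\<in>{w. cell l e a z w \<noteq> {}}. pmf (bernoulli_pmf (1 - exp (- measure lborel (cell l e a z w)))) (w \<in> T))"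
    using assms(3) by (subst pmf_Pi'[OF finite_cells[OF assms(1,2)]]) auto
  finally show ?thesis unfolding bern .
qed

lemma set_disc_pmf: "0 < l \<Longrightarrow> 0 < e \<Longrightarrow> set_pmf (disc_pmf l e a z) \<subseteq> Pow {w. cell l e a z w \<noteq> {}}"
  unfolding disc_pmf_def using set_Pi_pmf_subset[OF finite_cells[of l e a z], of False] by fastforce

lemma finite_set_disc_pmf: "0 < l \<Longrightarrow> 0 < e \<Longrightarrow> finite (set_pmf (disc_pmf l e a z))"
  by (rule finite_subset[OF set_disc_pmf]) (auto intro: finite_cells)

text \<open>\<open>disc_conf\<close> takes finitely many values, and prescribing its value
  prescribes which cells in \<open>Sigma I W\<close> are occupied. The probability factorises over
  the cells and regroups cube by cube into the product law.\<close>

lemma disc_conf_law: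
  fixes F :: "(int ^ 'd \<Rightarrow> (int ^ 'd) set) \<Rightarrow> real"
  assumes X: "unit_poisson_process M X" and I: "finite I" and l: "0 < l" and e: "0 < e"
  shows "(\<lambda>\<omega>. F (disc_conf l e a I (X \<omega>))) \<in> borel_measurable M" (is ?meas)
    and "(\<integral>\<omega>. F (disc_conf l e a I (X \<omega>)) \<partial>M) =
      measure_pmf.expectation (Pi_pmf I {} (disc_pmf l e a)) F" (is ?int)
proof -
  interpret prob_space M using X by (simp add: unit_poisson_process_def)
  define W where "W z = {w. cell l e a z w \<noteq> {}}" for z
  define S where "S = PiE_dflt I {} (\<lambda>z. Pow (W z))"
  have W: "finite (W z)" for z unfolding W_def by (rule finite_cells[OF l e])
  have S: "finite S" unfolding S_def using I W by (intro finite_PiE_dflt) auto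
  have mem: "w \<in> disc_conf l e a I P z \<longleftrightarrow> P \<inter> cell l e a z w \<noteq> {}" if "z \<in> I" for P z w
    using that by (auto simp: disc_conf_def cell_def)
  have conf: "disc_conf l e a I P \<in> S" for P
    by (auto simp: S_def PiE_dflt_def W_def disc_conf_def cell_def)
  define ev where "ev s = {\<omega> \<in> space M. disc_conf l e a I (X \<omega>) = s}" for s
  have ev: "ev s = {\<omega> \<in> space M. \<forall>j\<in>Sigma I W. X \<omega> \<inter> (case j of (z, w) \<Rightarrow> cell l e a z w) \<noteq> {} \<longleftrightarrow> j \<in> {(z, w). w \<in> s z}}"
    if s: "s \<in> S" for s
  proof -
    have "disc_conf l e a I P = s \<longleftrightarrow> (\<forall>z\<in>I. \<forall>w\<in>W z. P \<inter> cell l e a z w \<noteq> {} \<longleftrightarrow> w \<in> s z)" for P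
    proof
      assume *: "\<forall>z\<in>I. \<forall>w\<in>W z. P \<inter> cell l e a z w \<noteq> {} \<longleftrightarrow> w \<in> s z"
      show "disc_conf l e a I P = s"
      proof (intro ext set_eqI)
        fix z w
        show "w \<in> disc_conf l e a I P z \<longleftrightarrow> w \<in> s z"
        proof (cases "z \<in> I \<and> w \<in> W z")
          case True
          then show ?thesis using * mem by blast
        next
          case False
          then have "w \<notin> s z" "w \<notin> disc_conf l e a I P z"
            using s conf[of P] unfolding S_def PiE_dflt_def by auto
          then show ?thesis by simp
        qed
      qed
    qed (use mem in auto)
    then show ?thesis unfolding ev_def by (auto simp: Sigma_def)
  qed
  have occ: "ev s \<in> sets M \<and> prob (ev s) = pmf (Pi_pmf I {} (disc_pmf l e a)) s" if s: "s \<in> S" for s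
  proof -
    let ?B = "\<lambda>j. case j of (z, w) \<Rightarrow> cell l e a z w"
    have fin: "finite (Sigma I W)" using I W by auto
    have B: "?B j \<in> sets borel" "bounded (?B j)" for j
      using cell_borel cell_bounded[OF l] by (auto split: prod.split)
    have ne: "?B j \<noteq> {}" if "j \<in> Sigma I W" for j using that by (auto simp: W_def)
    have disj: "?B i \<inter> ?B j = {}" if "i \<in> Sigma I W" "j \<in> Sigma I W" "i \<noteq> j" for i j
      using that by (auto simp: cell_def)
    note occ = unit_poisson_process_occupancy[OF X fin B(1,2) ne disj, where S = "{(z, w). w \<in> s z}"]
    have "prob (ev s) = (\<Prod>j\<in>Sigma I W. if j \<in> {(z, w). w \<in> s z}
        then 1 - exp (- measure lborel (?B j)) else exp (- measure lborel (?B j)))"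
      unfolding ev[OF s] by (rule occ(2))
    also have "\<dots> = (\<Prod>z\<in>I. \<Prod>w\<in>W z. if w \<in> s z
        then 1 - exp (- measure lborel (cell l e a z w)) else exp (- measure lborel (cell l e a z w)))"
      using I W by (subst prod.Sigma) (auto intro!: prod.cong)
    also have "\<dots> = (\<Prod>z\<in>I. pmf (disc_pmf l e a z) (s z))"
      using s unfolding W_def S_def
      by (intro prod.cong refl pmf_disc_pmf[OF l e, symmetric]) (auto simp: PiE_dflt_def)
    also have "\<dots> = pmf (Pi_pmf I {} (disc_pmf l e a)) s"
      using s by (subst pmf_Pi'[OF I]) (auto simp: S_def PiE_dflt_def)
    finally have "prob (ev s) = pmf (Pi_pmf I {} (disc_pmf l e a)) s" .
    moreover have "ev s \<in> sets M" unfolding ev[OF s] by (rule occ(1))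
    ultimately show ?thesis by simp
  qed
  have sum: "F (disc_conf l e a I (X \<omega>)) = (\<Sum>s\<in>S. F s * indicator (ev s) \<omega>)" if "\<omega> \<in> space M" for \<omega>
  proof -
    have "(\<Sum>s\<in>S. F s * indicator (ev s) \<omega>) = (\<Sum>s\<in>S. if s = disc_conf l e a I (X \<omega>) then F s else 0)"
      using that by (intro sum.cong) (auto simp: ev_def indicator_def)
    then show ?thesis using S conf by simp
  qed
  have [measurable]: "(\<lambda>\<omega>. \<Sum>s\<in>S. F s * indicator (ev s) \<omega>) \<in> borel_measurable M"
    using occ by (intro borel_measurable_sum borel_measurable_times borel_measurable_indicator) auto
  show ?meas by (subst measurable_cong[OF sum]) auto
  have "(\<integral>\<omega>. F (disc_conf l e a I (X \<omega>)) \<partial>M) = (\<integral>\<omega>. (\<Sum>s\<in>S. F s * indicator (ev s) \<omega>) \<partial>M)"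
    by (intro Bochner_Integration.integral_cong sum) auto
  also have "\<dots> = (\<Sum>s\<in>S. F s * prob (ev s))"
    using occ by (subst Bochner_Integration.integral_sum) (auto simp: less_top[symmetric])
  also have "\<dots> = (\<Sum>s\<in>S. F s * pmf (Pi_pmf I {} (disc_pmf l e a)) s)" using occ by simp
  also have "\<dots> = measure_pmf.expectation (Pi_pmf I {} (disc_pmf l e a)) F"
  proof (rule integral_measure_pmf_real[OF S, symmetric])
    fix s assume "s \<in> set_pmf (Pi_pmf I {} (disc_pmf l e a))"
    then have "s \<in> PiE_dflt I {} (\<lambda>z. set_pmf (disc_pmf l e a z))"
      using subsetD[OF set_Pi_pmf_subset'[OF I, of "{}" "disc_pmf l e a"], of s] by (simp add: comp_def)
    then have s: "z \<in> I \<Longrightarrow> s z \<in> set_pmf (disc_pmf l e a z)" "z \<notin> I \<Longrightarrow> s z = {}" for z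
      by (auto simp: PiE_dflt_def)
    have "s z \<in> Pow (W z)" if "z \<in> I" for z
      unfolding W_def by (rule subsetD[OF set_disc_pmf[OF l e] s(1)[OF that]])
    then show "s \<in> S" using s(2) unfolding S_def PiE_dflt_def by simp
  qed
  finally show ?int .
qed

lemma box_subset_gidx:
  fixes a :: "real ^ 'd"
  assumes l: "0 < l"
  shows "box (\<chi> i. a $ i + l * real_of_int (z $ i)) (\<chi> i. a $ i + l * (real_of_int (z $ i) + 1)) \<subseteq> gidx l a -` {z}"
proof
  fix x assume "x \<in> box (\<chi> i. a $ i + l * real_of_int (z $ i)) (\<chi> i. a $ i + l * (real_of_int (z $ i) + 1))"
  then have *: "a $ i + l * of_int (z $ i) < x $ i \<and> x $ i < a $ i + l * (of_int (z $ i) + 1)" for i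
    by (auto simp: mem_box_cart)
  have "\<lfloor>(x $ i - a $ i) / l\<rfloor> = z $ i" for i
    using l *[of i] unfolding floor_eq_iff
    by (simp add: pos_le_divide_eq pos_divide_less_eq mult.commute[of _ l])
  then show "x \<in> gidx l a -` {z}" by (simp add: gidx_def vec_eq_iff)
qed

lemma enrich_eq_henrich:
  fixes a :: "real ^ 'd"
  assumes X: "unit_poisson_process M X" and l: "0 < l"
  shows "AE \<omega> in M. enrich l a c (X \<omega>) = henrich l a c (X \<omega>)"
proof -
  interpret prob_space M using X by (simp add: unit_poisson_process_def)
  define N where "N z = grid_cube l a z - gidx l a -` {z}" for z
  have "AE \<omega> in M. X \<omega> \<inter> N z = {}" for z
  proof (cases "N z = {}")
    case False
    let ?u = "(\<chi> i. a $ i + l * real_of_int (z $ i)) :: real ^ 'd"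
    let ?v = "(\<chi> i. a $ i + l * (real_of_int (z $ i) + 1)) :: real ^ 'd"
    have "box ?u ?v \<subseteq> gidx l a -` {z}"
      by (rule box_subset_gidx[OF l])
    then have sub: "N z \<subseteq> cbox ?u ?v - box ?u ?v" by (auto simp: N_def grid_cube_def)
    have Nb: "N z \<in> sets borel" unfolding N_def grid_cube_def by measurable
    have "measure lborel (cbox ?u ?v - box ?u ?v) = measure lborel (cbox ?u ?v) - measure lborel (box ?u ?v)"
      using emeasure_lborel_cbox_finite[of ?u ?v] by (intro measure_Diff) (auto simp: box_subset_cbox)
    also have "\<dots> = 0" by (simp add: measure_lborel_box_eq measure_lborel_cbox_eq)
    finally have "measure lborel (cbox ?u ?v - box ?u ?v) = 0" .
    moreover have "measure lborel (N z) \<le> measure lborel (cbox ?u ?v - box ?u ?v)"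
      using Nb sub emeasure_lborel_cbox_finite[of ?u ?v]
      by (intro measure_mono_fmeasurable) (auto intro!: fmeasurable.Diff simp: fmeasurable_cbox)
    ultimately have "measure lborel (N z) = 0" using measure_nonneg[of lborel "N z"] by linarith
    moreover have "bounded (N z)" using bounded_subset[OF bounded_cbox, of "N z"] sub by auto
    ultimately have *: "prob {\<omega> \<in> space M. \<forall>j\<in>{()}. X \<omega> \<inter> N z \<noteq> {} \<longleftrightarrow> j \<in> {}} = 1"
      "{\<omega> \<in> space M. \<forall>j\<in>{()}. X \<omega> \<inter> N z \<noteq> {} \<longleftrightarrow> j \<in> {}} \<in> sets M"
      using unit_poisson_process_occupancy[OF X, of "{()}" "\<lambda>_. N z" "{}"] Nb False by auto
    then have "AE \<omega> in M. \<omega> \<in> {\<omega> \<in> space M. \<forall>j\<in>{()}. X \<omega> \<inter> N z \<noteq> {} \<longleftrightarrow> j \<in> {}}"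
      using prob_eq_1 by blast
    then show ?thesis by eventually_elim auto
  qed simp
  then have "AE \<omega> in M. \<forall>z. X \<omega> \<inter> N z = {}" unfolding AE_all_countable by blast
  then show ?thesis
  proof eventually_elim
    case (elim \<omega>)
    have eq: "grid_cube l a z \<inter> X \<omega> = X \<omega> \<inter> gidx l a -` {z}" for z
      using elim[rule_format, of z] gidx_vimage_subset[OF l, of a z] by (auto simp: N_def)
    show ?case unfolding enrich_def henrich_def eq
    proof (intro equalityI subsetI)
      fix x assume "x \<in> X \<omega> \<union> c ` {z. X \<omega> \<inter> gidx l a -` {z} = {}}"
      then show "x \<in> (\<Union>z. cube_pts l a c (X \<omega>) z)"
      proof
        assume "x \<in> X \<omega>"
        then have "x \<in> cube_pts l a c (X \<omega>) (gidx l a x)" unfolding cube_pts_def by auto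
        then show ?thesis by blast
      next
        assume "x \<in> c ` {z. X \<omega> \<inter> gidx l a -` {z} = {}}"
        then obtain z where "X \<omega> \<inter> gidx l a -` {z} = {}" "x = c z" by blast
        then have "x \<in> cube_pts l a c (X \<omega>) z" by (simp add: cube_pts_def)
        then show ?thesis by blast
      qed
    next
      fix x assume "x \<in> (\<Union>z. cube_pts l a c (X \<omega>) z)"
      then obtain z where "x \<in> cube_pts l a c (X \<omega>) z" by blast
      then show "x \<in> X \<omega> \<union> c ` {z. X \<omega> \<inter> gidx l a -` {z} = {}}"
        by (cases "X \<omega> \<inter> gidx l a -` {z} = {}") (auto simp: cube_pts_def)
    qed
  qed
qed

lemma finite_henrich:
  fixes a :: "real ^ 'd"
  assumes l: "0 < l" and c: "\<And>z. c z \<in> grid_cube l a z" and P: "\<And>B. bounded B \<Longrightarrow> finite (P \<inter> B)" and R: "0 \<le> R"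
  shows "finite (henrich l a c P \<inter> cball x R)"
proof (rule finite_subset)
  show "henrich l a c P \<inter> cball x R \<subseteq> (P \<inter> cball x R) \<union> c ` region l a x R"
  proof
    fix p assume "p \<in> henrich l a c P \<inter> cball x R"
    then obtain z where p: "p \<in> cube_pts l a c P z" "p \<in> cball x R" by (auto simp: henrich_def)
    then have "z \<in> region l a x R" using cube_pts_subset[OF l c, where P = P and z = z] by (auto simp: region_def)
    then show "p \<in> (P \<inter> cball x R) \<union> c ` region l a x R" using p by (auto simp: cube_pts_def split: if_splits)
  qed
  show "finite ((P \<inter> cball x R) \<union> c ` region l a x R)"
    using P[OF bounded_cball, of x R] region_bound(1)[OF l R, of a x] by auto
qed

section \<open>Resampling the points of one cube\<close>

lemma grid_net_Union:
  fixes a :: "real ^ 'd" and Q :: "int ^ 'd \<Rightarrow> (real ^ 'd) set"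
  assumes "0 < l" "\<And>z. Q z \<noteq> {}" "\<And>z. Q z \<subseteq> grid_cube l a z" "const_C CARD('d) * l \<le> h"
  shows "net h (const_C CARD('d) * l) (const_C CARD('d)) (\<Union>z. Q z)"
proof (rule grid_net[OF assms(1) _ assms(4)])
  fix z
  obtain q where "q \<in> Q z" using assms(2) by blast
  then show "grid_cube l a z \<inter> (\<Union>z. Q z) \<noteq> {}" using assms(3)[of z] by blast
qed

text \<open>\<open>V\<close> lists the cubes visited by one nearly shortest route and is chosen
  before \<open>i\<close> and \<open>S\<close>. A route that misses cube \<open>i\<close> survives
  the change; otherwise it is rerouted through a point of \<open>S\<close>, which is within
  \<open>\<delta> / 2\<close>, the diameter bound of a cube, of all lost vertices.\<close>

lemma tdist_resample:
  fixes a :: "real ^ 'd" and Q :: "int ^ 'd \<Rightarrow> (real ^ 'd) set" and l :: real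
  defines "A \<equiv> const_C CARD('d)" and "\<delta> \<equiv> const_C CARD('d) * l"
  assumes l: "0 < l" and Q: "\<And>z. Q z \<noteq> {}" "\<And>z. Q z \<subseteq> grid_cube l a z" and h: "\<delta> \<le> h" and \<eta>: "0 < \<eta>"
  shows "\<exists>V. finite V \<and> h * real (card V) \<le> 2 * (A * dist x y + 4 * \<delta> + \<eta>) + h \<and>
    (\<forall>i S. S \<noteq> {} \<longrightarrow> S \<subseteq> grid_cube l a i \<longrightarrow>
      tdist h (\<Union>z. (Q(i := S)) z) x y \<le> tdist h (\<Union>z. Q z) x y + \<eta> + (if i \<in> V then 2 * detour A * \<delta> else 0))"
proof -
  interpret net h \<delta> A "\<Union>z. Q z" unfolding A_def \<delta>_def
    by (rule grid_net_Union[OF l Q h[unfolded \<delta>_def]])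
  obtain p where p: "route h (\<Union>z. Q z) x p y" "rlen x p y < tdist h (\<Union>z. Q z) x y + \<eta>"
      "h * real (length p) \<le> 2 * rlen x p y + h"
    using tdist_attain_short[OF chain \<eta>] delta_pos delta_le by force
  \<comment> \<open>Closed cubes overlap, so a vertex may lie in several \<open>Q z\<close>.
    Charging it to one of them keeps \<open>V\<close> no larger than the number of vertices.\<close>
  define own where "own u = (SOME z. u \<in> Q z)" for u
  have own: "u \<in> Q (own u)" if "u \<in> set p" for u
    unfolding own_def using that route_subset[OF p(1)] by (intro someI_ex[of "\<lambda>z. u \<in> Q z"]) auto
  show ?thesis
  proof (intro exI[of _ "own ` set p"] conjI allI impI)
    have "h * real (card (own ` set p)) \<le> h * real (length p)"
      using delta_pos delta_le card_image_le[of "set p" own] card_length[of p] by (intro mult_left_mono) auto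
    also have "\<dots> \<le> 2 * (A * dist x y + 4 * \<delta> + \<eta>) + h" using p tdist_bound[of x y] by simp
    finally show "h * real (card (own ` set p)) \<le> 2 * (A * dist x y + 4 * \<delta> + \<eta>) + h" .
  next
    fix i S assume S: "S \<noteq> {}" "S \<subseteq> grid_cube l a i"
    interpret Q': net h \<delta> A "\<Union>z. (Q(i := S)) z" unfolding A_def \<delta>_def
      by (rule grid_net_Union[OF l _ _ h[unfolded \<delta>_def]]) (use Q S in auto)
    show "tdist h (\<Union>z. (Q(i := S)) z) x y \<le> tdist h (\<Union>z. Q z) x y + \<eta> + (if i \<in> own ` set p then 2 * detour A * \<delta> else 0)"
    proof (cases "i \<in> own ` set p")
      case False
      have "u \<in> (Q(i := S)) (own u)" if "u \<in> set p" for u using own[OF that] that False by auto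
      then have "set p \<subseteq> (\<Union>z. (Q(i := S)) z)" by blast
      then have "route h (\<Union>z. (Q(i := S)) z) x p y" using route_mono[OF p(1)] by blast
      then show ?thesis using p False by (intro tdist_le) (auto simp: reach_def intro!: exI[of _ p])
    next
      case True
      obtain q where q: "q \<in> S" using S by blast
      let ?T = "{u \<in> set p. own u = i}"
      have "dist u q \<le> \<delta> / 2" if "u \<in> ?T" for u
        using own[of u] that Q(2)[of i] S(2) q l grid_cube_dist[of l u a i q] by (auto simp: \<delta>_def const_C_def)
      moreover have "u \<in> (Q(i := S)) (own u)" if "u \<in> set p - ?T" for u using own[of u] that by auto
      then have "set p - ?T \<subseteq> (\<Union>z. (Q(i := S)) z)" by blast
      moreover have "q \<in> (\<Union>z. (Q(i := S)) z)" using q by (intro UN_I[of i]) auto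
      ultimately have "reach h (\<Union>z. (Q(i := S)) z) x y (rlen x p y + 2 * detour A * \<delta>)"
        using Q'.reach_avoiding[OF p(1)] by blast
      from tdist_le[OF this] show ?thesis using p True by simp
    qed
  qed simp
qed

section \<open>Concentration of shortest routes\<close>

locale poisson_grid = prob_space M for M :: "'w measure" +
  fixes X :: "'w \<Rightarrow> (real ^ 'd) set" and l h :: real and a :: "real ^ 'd" and c :: "int ^ 'd \<Rightarrow> real ^ 'd"
  assumes X: "unit_poisson_process M X" and l_pos: "0 < l"
    and c: "\<And>z. c z \<in> grid_cube l a z" and step: "const_C CARD('d) * l \<le> h"
begin

definition U :: "real ^ 'd \<Rightarrow> real ^ 'd \<Rightarrow> real" where "U x y = const_C CARD('d) * dist x y + 4 * (const_C CARD('d) * l)"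

definition Z :: "real ^ 'd \<Rightarrow> real ^ 'd \<Rightarrow> 'w \<Rightarrow> real" where
  "Z x y \<omega> = tdist h (henrich l a c (X \<omega>)) x y"

lemma A_pos: "0 < const_C CARD('d)" by (simp add: const_C_def)

lemma delta_pos: "0 < (const_C CARD('d) * l)" using A_pos l_pos by simp

lemma h_pos: "0 < h" using delta_pos step by linarith

lemma U_pos: "0 < U x y"
  unfolding U_def using delta_pos mult_nonneg_nonneg[OF less_imp_le[OF A_pos] zero_le_dist[of x y]] by linarith

lemma henrich_net': "net h (const_C CARD('d) * l) (const_C CARD('d)) (henrich l a c (X \<omega>))"
  by (rule henrich_net[OF l_pos c step])

lemma finite_henrich': "\<omega> \<in> space M \<Longrightarrow> 0 \<le> R \<Longrightarrow> finite (henrich l a c (X \<omega>) \<inter> cball x R)"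
  using X by (intro finite_henrich[OF l_pos c]) (auto simp: unit_poisson_process_def)

lemma Z_bounds: "0 \<le> Z x y \<omega>" "Z x y \<omega> \<le> U x y"
  unfolding Z_def U_def using net.tdist_nonneg[OF henrich_net'] net.tdist_bound[OF henrich_net'] by auto

definition eps :: "nat \<Rightarrow> real" where "eps n = 1 / real (Suc n)"

text \<open>Twice the diameter of a fine cube is added, as \<open>tdist_limit\<close>
  requires.\<close>

definition hn :: "nat \<Rightarrow> real" where "hn n = h + 2 * (sqrt (real CARD('d)) * eps n)"

text \<open>Nearly shortest routes from \<open>x\<close> to \<open>y\<close>, with excess below 1,
  stay in this ball. Only the finitely many cubes meeting it need to be random in the
  approximation.\<close>

definition I :: "real ^ 'd \<Rightarrow> real ^ 'd \<Rightarrow> (int ^ 'd) set" where "I x y = region l a x (U x y + 1)"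

definition D :: "real ^ 'd \<Rightarrow> real ^ 'd \<Rightarrow> nat \<Rightarrow> (int ^ 'd \<Rightarrow> (int ^ 'd) set) \<Rightarrow> real" where
  "D x y n s = tdist (hn n) (\<Union>z. disc_pts l (eps n) a c z (s z)) x y"

definition conf :: "real ^ 'd \<Rightarrow> real ^ 'd \<Rightarrow> nat \<Rightarrow> 'w \<Rightarrow> int ^ 'd \<Rightarrow> (int ^ 'd) set" where
  "conf x y n \<omega> = disc_conf l (eps n) a (I x y) (X \<omega>)"

definition law :: "real ^ 'd \<Rightarrow> real ^ 'd \<Rightarrow> nat \<Rightarrow> (int ^ 'd \<Rightarrow> (int ^ 'd) set) pmf" where
  "law x y n = Pi_pmf (I x y) {} (disc_pmf l (eps n) a)"

lemma eps_pos: "0 < eps n" by (simp add: eps_def)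

lemma finite_I: "finite (I x y)"
  unfolding I_def using U_pos[of x y] by (intro region_bound(1)[OF l_pos]) auto

lemma h_le_hn: "h \<le> hn n" using eps_pos[of n] by (simp add: hn_def)

lemma disc_net': "net (hn n) (const_C CARD('d) * l) (const_C CARD('d)) (\<Union>z. disc_pts l (eps n) a c z (s z))"
  using step h_le_hn[of n] by (intro disc_net[OF l_pos c]) auto

lemma D_bounds: "0 \<le> D x y n s" "D x y n s \<le> U x y"
  unfolding D_def U_def using net.tdist_nonneg[OF disc_net'] net.tdist_bound[OF disc_net'] by auto

lemma Z_limit:
  assumes \<omega>: "\<omega> \<in> space M"
  shows "(\<lambda>n. D x y n (conf x y n \<omega>)) \<longlonglongrightarrow> Z x y \<omega>"
  unfolding D_def Z_def hn_def
proof (rule tdist_limit[OF henrich_net'[of \<omega>]])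
  have U': "const_C CARD('d) * dist x y + 4 * (const_C CARD('d) * l) + 1 = U x y + 1" by (simp add: U_def)
  show "finite (henrich l a c (X \<omega>) \<inter> cball x (const_C CARD('d) * dist x y + 4 * (const_C CARD('d) * l) + 1))"
    unfolding U' using U_pos[of x y] by (intro finite_henrich'[OF \<omega>]) auto
  show "net (h + 2 * (sqrt (real CARD('d)) * eps n)) (const_C CARD('d) * l) (const_C CARD('d)) (\<Union>z. disc_pts l (eps n) a c z (conf x y n \<omega> z))" for n
    using disc_net'[of n] by (simp add: hn_def)
  show "0 \<le> sqrt (real CARD('d)) * eps n" for n using eps_pos[of n] by simp
  have "eps \<longlonglongrightarrow> 0" unfolding eps_def by (rule LIMSEQ_inverse_real_of_nat[unfolded inverse_eq_divide])
  then show "(\<lambda>n. sqrt (real CARD('d)) * eps n) \<longlonglongrightarrow> 0" by (rule tendsto_mult_right_zero)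
  have z: "z \<in> I x y" if "p \<in> grid_cube l a z" "dist x p \<le> const_C CARD('d) * dist x y + 4 * (const_C CARD('d) * l) + 1" for p z
    using that unfolding I_def region_def U'[symmetric] by auto
  show "\<exists>p'\<in>\<Union>z. disc_pts l (eps n) a c z (conf x y n \<omega> z). dist p p' \<le> sqrt (real CARD('d)) * eps n"
    if p: "p \<in> henrich l a c (X \<omega>)" "dist x p \<le> const_C CARD('d) * dist x y + 4 * (const_C CARD('d) * l) + 1" for n p
  proof -
    obtain z where pz: "p \<in> cube_pts l a c (X \<omega>) z" using p(1) by (auto simp: henrich_def)
    have "p \<in> grid_cube l a z" by (rule subsetD[OF cube_pts_subset[OF l_pos c] pz])
    then have "z \<in> I x y" using p(2) by (rule z)
    from disc_approx(1)[OF l_pos c eps_pos this pz] obtain p'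
      where "p' \<in> disc_pts l (eps n) a c z (conf x y n \<omega> z)" "dist p p' \<le> sqrt (real CARD('d)) * eps n"
      unfolding conf_def by blast
    then show ?thesis by (intro bexI[of _ p'] UN_I[of z]) auto
  qed
  show "\<exists>p'\<in>henrich l a c (X \<omega>). dist p p' \<le> sqrt (real CARD('d)) * eps n"
    if p: "p \<in> (\<Union>z. disc_pts l (eps n) a c z (conf x y n \<omega> z))" "dist x p \<le> const_C CARD('d) * dist x y + 4 * (const_C CARD('d) * l) + 1" for n p
  proof -
    obtain z where pz: "p \<in> disc_pts l (eps n) a c z (conf x y n \<omega> z)" using p(1) by auto
    have "p \<in> grid_cube l a z" by (rule subsetD[OF disc_pts_subset[OF l_pos c] pz])
    then have "z \<in> I x y" using p(2) by (rule z)
    from disc_approx(2)[OF l_pos c eps_pos this pz[unfolded conf_def]] obtain p'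
      where "p' \<in> cube_pts l a c (X \<omega>) z" "dist p p' \<le> sqrt (real CARD('d)) * eps n" by blast
    then show ?thesis unfolding henrich_def by (intro bexI[of _ p'] UN_I[of z]) auto
  qed
qed

lemma D_measurable: "(\<lambda>\<omega>. F (conf x y n \<omega>)) \<in> borel_measurable M" for F :: "_ \<Rightarrow> real"
  unfolding conf_def by (rule disc_conf_law(1)[OF X finite_I l_pos eps_pos])

lemma expectation_conf: "expectation (\<lambda>\<omega>. F (conf x y n \<omega>)) = measure_pmf.expectation (law x y n) F" for F :: "_ \<Rightarrow> real"
  unfolding conf_def law_def by (rule disc_conf_law(2)[OF X finite_I l_pos eps_pos])

lemma Z_measurable [measurable]: "Z x y \<in> borel_measurable M"
  by (rule borel_measurable_LIMSEQ_real[where u = "\<lambda>n \<omega>. D x y n (conf x y n \<omega>)"])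
    (use Z_limit D_measurable[of "D x y n" for n] in auto)

lemma Z_integrable: "integrable M (Z x y)"
  by (rule integrable_const_bound[of _ "U x y"]) (use Z_bounds in \<open>auto intro!: AE_I2\<close>)

lemma expectation_Z_limit: "(\<lambda>n. measure_pmf.expectation (law x y n) (D x y n)) \<longlonglongrightarrow> expectation (Z x y)"
  unfolding expectation_conf[symmetric]
proof (rule integral_dominated_convergence[where w = "\<lambda>_. U x y"])
  show "(\<lambda>\<omega>. D x y n (conf x y n \<omega>)) \<in> borel_measurable M" for n by (rule D_measurable)
  show "AE \<omega> in M. norm (D x y n (conf x y n \<omega>)) \<le> U x y" for n
    using D_bounds by (intro AE_I2) simp
qed (auto intro!: AE_I2 Z_limit)

lemma finite_law: "finite (set_pmf (law x y n))"
  unfolding law_def by (intro finite_set_Pi_pmf finite_I finite_set_disc_pmf l_pos eps_pos)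

text \<open>The fluctuation scale: the rerouting cost \<open>d\<close> of one cube times the square
  root of a cube count. The numbers 8 and 13 come from
  \<open>d\<^sup>2 + (2 * U x y / h + 3) * (4 * d\<^sup>2)\<close> in
  \<open>discrete_deviation\<close>.\<close>

definition \<kappa> :: "real ^ 'd \<Rightarrow> real ^ 'd \<Rightarrow> real" where
  "\<kappa> x y = 2 * detour (const_C CARD('d)) * (const_C CARD('d) * l) * sqrt (8 * U x y / h + 13)"

lemma detour_delta_pos: "0 < 2 * detour (const_C CARD('d)) * (const_C CARD('d) * l)"
proof -
  have "0 < detour (const_C CARD('d))" unfolding detour_def using A_pos by linarith
  then show ?thesis using delta_pos by (simp only: mult_pos_pos zero_less_numeral)
qed

lemma kappa_pos: "0 < \<kappa> x y"
proof -
  have "0 \<le> 8 * U x y / h" using U_pos[of x y] h_pos by simp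
  then have "0 < sqrt (8 * U x y / h + 13)" by simp
  then show ?thesis unfolding \<kappa>_def by (rule mult_pos_pos[OF detour_delta_pos])
qed

text \<open>The moment bound is applied to the mean minus \<open>D\<close>, whose decreases are the
  increases of \<open>D\<close>. With \<open>(\<kappa> x y)\<^sup>2\<close> as variance bound,
  \<open>1 / \<kappa> x y\<close> is the largest admissible parameter.\<close>

lemma discrete_deviation:
  "measure_pmf.expectation (law x y n)
    (\<lambda>s. exp ((measure_pmf.expectation (law x y n) (D x y n) - D x y n s) / \<kappa> x y)) \<le> exp 1"
proof -
  define m where "m = measure_pmf.expectation (law x y n) (D x y n)"
  define f where "f s = m - D x y n s" for s
  define d where "d = 2 * detour (const_C CARD('d)) * (const_C CARD('d) * l)"
  have d: "0 < d" unfolding d_def by (rule detour_delta_pos)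
  let ?N = "real (card (I x y))"
  \<comment> \<open>The slack of nearly shortest routes enters once for each of the
    \<open>?N\<close> cubes, visited or not. Dividing by \<open>?N + 1\<close> keeps the sum of its
    squares below \<open>d\<^sup>2\<close>, and \<open>\<eta> \<le> h\<close> keeps the number of
    visited cubes below \<open>2 * U x y / h + 3\<close>.\<close>
  define \<eta> where "\<eta> = min h (d / (?N + 1))"
  have \<eta>: "0 < \<eta>" "\<eta> \<le> h" "\<eta> \<le> d / (?N + 1)" using h_pos d by (auto simp: \<eta>_def)
  have "?N * \<eta>\<^sup>2 \<le> d\<^sup>2"
  proof -
    have "?N * \<eta> \<le> ?N * (d / (?N + 1))" using \<eta> by (intro mult_left_mono) auto
    also have "\<dots> \<le> d" using d by (simp add: field_simps)
    finally have 1: "?N * \<eta> \<le> d" .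
    have "d / (?N + 1) \<le> d" using d by (simp add: field_simps)
    then have "\<eta> \<le> d" using \<eta> by linarith
    then have "(?N * \<eta>) * \<eta> \<le> d * d" using 1 \<eta> d by (intro mult_mono) auto
    then show ?thesis by (simp add: power2_eq_square)
  qed
  note N\<eta> = this
  have \<eta>d: "\<eta> \<le> d"
  proof -
    have "d / (?N + 1) \<le> d" using d by (simp add: field_simps)
    then show ?thesis using \<eta> by linarith
  qed
  have fin: "finite (set_pmf (disc_pmf l (eps n) a i))" for i by (rule finite_set_disc_pmf[OF l_pos eps_pos])
  let ?P = "Pi_pmf (I x y) {} (disc_pmf l (eps n) a)"
  note [simp] = integrable_measure_pmf_finite[OF finite_law]
  have "measure_pmf.expectation ?P (\<lambda>s. exp (1 / \<kappa> x y * f s)) \<le> exp ((\<kappa> x y)\<^sup>2 * (1 / \<kappa> x y)\<^sup>2)"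
  proof (rule exponential_moment_pmf[OF finite_I fin])
    show "measure_pmf.expectation ?P f = 0"
      unfolding f_def law_def[symmetric] m_def by simp
    show "(\<kappa> x y)\<^sup>2 * (1 / \<kappa> x y)\<^sup>2 \<le> 1" using kappa_pos[of x y] by (simp add: power_divide)
    fix s assume "s \<in> set_pmf ?P"
    have "\<exists>V. finite V \<and> hn n * real (card V) \<le> 2 * (U x y + \<eta>) + hn n \<and>
        (\<forall>i S. D x y n (s(i := S)) \<le> D x y n s + \<eta> + (if i \<in> V then d else 0))"
    proof -
      let ?Q = "\<lambda>s z. disc_pts l (eps n) a c z (s z)"
      have upd: "?Q (s(i := S)) = (?Q s)(i := disc_pts l (eps n) a c i S)" for i S by (intro ext) auto
      obtain V where V: "finite V" "hn n * real (card V) \<le> 2 * (const_C CARD('d) * dist x y + 4 * (const_C CARD('d) * l) + \<eta>) + hn n"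
        "\<forall>i S. S \<noteq> {} \<longrightarrow> S \<subseteq> grid_cube l a i \<longrightarrow> tdist (hn n) (\<Union>z. ((?Q s)(i := S)) z) x y
          \<le> tdist (hn n) (\<Union>z. ?Q s z) x y + \<eta> + (if i \<in> V then 2 * detour (const_C CARD('d)) * (const_C CARD('d) * l) else 0)"
        using tdist_resample[of l "?Q s" a "hn n" \<eta> x y, OF l_pos disc_pts_nonempty[OF l_pos c]
          disc_pts_subset[OF l_pos c] order_trans[OF step h_le_hn] \<eta>(1)] by blast
      have "D x y n (s(i := S)) \<le> D x y n s + \<eta> + (if i \<in> V then d else 0)" for i S
        unfolding D_def upd d_def
        using V(3)[rule_format, OF disc_pts_nonempty[OF l_pos c] disc_pts_subset[OF l_pos c]] .
      then show ?thesis using V(1,2) unfolding U_def by blast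
    qed
    then obtain V where V: "finite V" "hn n * real (card V) \<le> 2 * (U x y + \<eta>) + hn n"
      "\<And>i S. D x y n (s(i := S)) \<le> D x y n s + \<eta> + (if i \<in> V then d else 0)" by blast
    have hn: "0 < hn n" using h_pos h_le_hn[of n] by linarith
    have "real (card V) \<le> 2 * U x y / h + 3"
    proof -
      have "real (card V) \<le> (2 * (U x y + \<eta>) + hn n) / hn n" using V(2) hn by (simp add: field_simps)
      also have "\<dots> = 2 * (U x y + \<eta>) / hn n + 1" using hn by (simp add: add_divide_distrib)
      also have "2 * (U x y + \<eta>) / hn n \<le> 2 * (U x y + \<eta>) / h"
        using U_pos[of x y] \<eta> h_pos h_le_hn[of n] by (intro divide_left_mono) auto
      also have "\<dots> \<le> 2 * (U x y + h) / h" using \<eta> h_pos by (intro divide_right_mono) auto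
      also have "\<dots> = 2 * U x y / h + 2" using h_pos by (simp add: field_simps)
      finally show ?thesis by simp
    qed
    note cardV = this
    have "measure_pmf.expectation (disc_pmf l (eps n) a i) (\<lambda>S. (max 0 (f s - f (s(i := S))))\<^sup>2)
        \<le> \<eta>\<^sup>2 + (if i \<in> V then 4 * d\<^sup>2 else 0)" for i
    proof -
      have "measure_pmf.expectation (disc_pmf l (eps n) a i) (\<lambda>S. (max 0 (f s - f (s(i := S))))\<^sup>2)
          \<le> measure_pmf.expectation (disc_pmf l (eps n) a i) (\<lambda>S. (\<eta> + (if i \<in> V then d else 0))\<^sup>2)"
      proof (rule expectation_mono_pmf_finite[OF fin])
        fix S
        have "f s - f (s(i := S)) \<le> \<eta> + (if i \<in> V then d else 0)" using V(3)[of i S] by (simp add: f_def)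
        then show "(max 0 (f s - f (s(i := S))))\<^sup>2 \<le> (\<eta> + (if i \<in> V then d else 0))\<^sup>2"
          using \<eta> d by (intro power_mono) auto
      qed
      also have "\<dots> = (\<eta> + (if i \<in> V then d else 0))\<^sup>2" by simp
      also have "\<dots> \<le> \<eta>\<^sup>2 + (if i \<in> V then 4 * d\<^sup>2 else 0)"
      proof -
        have "2 * \<eta> * d \<le> 2 * d * d" using \<eta>d d by (intro mult_right_mono) auto
        then show ?thesis using d by (auto simp: power2_eq_square algebra_simps)
      qed
      finally show ?thesis .
    qed
    then have "(\<Sum>i\<in>I x y. measure_pmf.expectation (disc_pmf l (eps n) a i) (\<lambda>S. (max 0 (f s - f (s(i := S))))\<^sup>2))
        \<le> (\<Sum>i\<in>I x y. \<eta>\<^sup>2 + (if i \<in> V then 4 * d\<^sup>2 else 0))" by (intro sum_mono)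
    also have "\<dots> = ?N * \<eta>\<^sup>2 + real (card (I x y \<inter> V)) * (4 * d\<^sup>2)"
      using finite_I by (simp add: sum.distrib sum.If_cases)
    also have "\<dots> \<le> d\<^sup>2 + (2 * U x y / h + 3) * (4 * d\<^sup>2)"
    proof (intro add_mono N\<eta> mult_right_mono)
      have "card (I x y \<inter> V) \<le> card V" using V(1) by (intro card_mono) auto
      then show "real (card (I x y \<inter> V)) \<le> 2 * U x y / h + 3" using cardV by linarith
    qed simp
    also have "\<dots> = d\<^sup>2 * (8 * U x y / h + 13)" by (simp add: algebra_simps)
    also have "\<dots> = (\<kappa> x y)\<^sup>2"
      using U_pos[of x y] h_pos unfolding \<kappa>_def d_def[symmetric] by (simp add: power_mult_distrib)
    finally show "(\<Sum>i\<in>I x y. measure_pmf.expectation (disc_pmf l (eps n) a i) (\<lambda>S. (max 0 (f s - f (s(i := S))))\<^sup>2)) \<le> (\<kappa> x y)\<^sup>2" .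
  qed (use kappa_pos[of x y] in auto)
  also have "(\<kappa> x y)\<^sup>2 * (1 / \<kappa> x y)\<^sup>2 = 1" using kappa_pos[of x y] by (simp add: power_divide)
  finally show ?thesis unfolding f_def m_def law_def by simp
qed

text \<open>The discrete bound is uniform in \<open>n\<close>, and
  \<open>U x y / \<kappa> x y\<close> dominates all exponents, so dominated convergence carries the
  bound to \<open>Z\<close>.\<close>

theorem deviation: "expectation (\<lambda>\<omega>. exp ((expectation (Z x y) - Z x y \<omega>) / \<kappa> x y)) \<le> exp 1"
proof -
  define m where "m n = measure_pmf.expectation (law x y n) (D x y n)" for n
  note k = kappa_pos[of x y]
  have mU: "m n \<le> U x y" for n
  proof -
    have "m n \<le> measure_pmf.expectation (law x y n) (\<lambda>_. U x y)"
      unfolding m_def by (intro expectation_mono_pmf_finite[OF finite_law] D_bounds)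
    then show ?thesis by simp
  qed
  have "(\<lambda>n. expectation (\<lambda>\<omega>. exp ((m n - D x y n (conf x y n \<omega>)) / \<kappa> x y)))
      \<longlonglongrightarrow> expectation (\<lambda>\<omega>. exp ((expectation (Z x y) - Z x y \<omega>) / \<kappa> x y))"
  proof (rule integral_dominated_convergence[where w = "\<lambda>_. exp (U x y / \<kappa> x y)"])
    show "(\<lambda>\<omega>. exp ((m n - D x y n (conf x y n \<omega>)) / \<kappa> x y)) \<in> borel_measurable M" for n
      by (rule D_measurable[where F = "\<lambda>s. exp ((m n - D x y n s) / \<kappa> x y)"])
    show "AE \<omega> in M. (\<lambda>n. exp ((m n - D x y n (conf x y n \<omega>)) / \<kappa> x y))
        \<longlonglongrightarrow> exp ((expectation (Z x y) - Z x y \<omega>) / \<kappa> x y)"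
      using k by (intro AE_I2 tendsto_intros Z_limit) (auto simp: m_def intro: expectation_Z_limit)
    show "AE \<omega> in M. norm (exp ((m n - D x y n (conf x y n \<omega>)) / \<kappa> x y)) \<le> exp (U x y / \<kappa> x y)" for n
    proof (rule AE_I2)
      fix \<omega>
      have "m n - D x y n (conf x y n \<omega>) \<le> U x y" using mU[of n] D_bounds(1)[of x y n] by (smt (verit))
      then show "norm (exp ((m n - D x y n (conf x y n \<omega>)) / \<kappa> x y)) \<le> exp (U x y / \<kappa> x y)"
        using k by (simp add: divide_right_mono)
    qed
  qed auto
  moreover have "expectation (\<lambda>\<omega>. exp ((m n - D x y n (conf x y n \<omega>)) / \<kappa> x y)) \<le> exp 1" for n
    using discrete_deviation[of x y n]
      expectation_conf[of "\<lambda>s. exp ((m n - D x y n s) / \<kappa> x y)" x y n] unfolding m_def by simp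
  ultimately show ?thesis by (intro LIMSEQ_le_const2) auto
qed

end

text \<open>Both expectations are limits of one sequence, because the discrete laws and distances
  are built from the grid data alone. In this way the counting probabilities determine the
  expectation.\<close>

lemma expectation_Z_unique:
  assumes "poisson_grid M X l h a c" "poisson_grid N Y l h a c"
  shows "(\<integral>\<omega>. poisson_grid.Z X l h a c x y \<omega> \<partial>M) = (\<integral>\<omega>. poisson_grid.Z Y l h a c x y \<omega> \<partial>N)"
  using LIMSEQ_unique[OF poisson_grid.expectation_Z_limit[OF assms(1), of x y]]
    poisson_grid.expectation_Z_limit[OF assms(2), of x y]
  by (simp add: poisson_grid.law_def[OF assms(1)] poisson_grid.law_def[OF assms(2)])

section \<open>Rigid motions and the graph distance\<close>

context
  fixes \<phi> :: "'a::metric_space \<Rightarrow> 'a"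
  assumes iso: "\<And>u v. dist (\<phi> u) (\<phi> v) = dist u v" and surj: "surj \<phi>"
begin

lemma route_vimage: "route h (\<phi> -` Q) x p y \<longleftrightarrow> route h Q (\<phi> x) (map \<phi> p) (\<phi> y)"
  by (induction p arbitrary: x) (auto simp: iso)

lemma rlen_isometry: "rlen (\<phi> x) (map \<phi> p) (\<phi> y) = rlen x p y"
  by (induction p arbitrary: x) (auto simp: iso)

lemma route_isometry_rep:
  assumes "route h Q (\<phi> x) p (\<phi> y)"
  shows "\<exists>p'. p = map \<phi> p' \<and> route h (\<phi> -` Q) x p' y \<and> rlen x p' y = rlen (\<phi> x) p (\<phi> y)"
proof -
  have p: "p = map \<phi> (map (inv \<phi>) p)" by (simp add: map_idI surj_f_inv_f[OF surj])
  then show ?thesis using assms rlen_isometry[of x "map (inv \<phi>) p" y] route_vimage[of h Q x "map (inv \<phi>) p" y] by metis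
qed

lemma reach_vimage: "reach h (\<phi> -` Q) x y L \<longleftrightarrow> reach h Q (\<phi> x) (\<phi> y) L"
  unfolding reach_def using route_isometry_rep[of h Q x _ y] route_vimage[of h Q x _ y] rlen_isometry[of x _ y]
  by metis

lemma tdist_vimage: "tdist h (\<phi> -` Q) x y = tdist h Q (\<phi> x) (\<phi> y)"
proof -
  have "(\<lambda>p. rlen x p y) ` {p. route h (\<phi> -` Q) x p y} = (\<lambda>p. rlen (\<phi> x) p (\<phi> y)) ` {p. route h Q (\<phi> x) p (\<phi> y)}"
    (is "?L = ?R")
  proof
    show "?L \<subseteq> ?R"
    proof safe
      fix p assume "route h (\<phi> -` Q) x p y"
      then have "route h Q (\<phi> x) (map \<phi> p) (\<phi> y)" by (simp add: route_vimage)
      then show "rlen x p y \<in> ?R" by (intro image_eqI[of _ _ "map \<phi> p"]) (auto simp: rlen_isometry)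
    qed
    show "?R \<subseteq> ?L"
    proof safe
      fix p assume "route h Q (\<phi> x) p (\<phi> y)"
      then obtain p' where "route h (\<phi> -` Q) x p' y" "rlen x p' y = rlen (\<phi> x) p (\<phi> y)"
        using route_isometry_rep by blast
      then show "rlen (\<phi> x) p (\<phi> y) \<in> ?L" by (intro image_eqI[of _ _ p']) auto
    qed
  qed
  then show ?thesis unfolding tdist_def by (rule arg_cong)
qed

end

lemma net_vimage:
  fixes \<phi> :: "'a::real_normed_vector \<Rightarrow> 'a"
  assumes iso: "\<And>u v. dist (\<phi> u) (\<phi> v) = dist u v" and surj: "surj \<phi>" and Q: "net h \<delta> A Q"
  shows "net h \<delta> A (\<phi> -` Q)"
proof -
  interpret net h \<delta> A Q by fact
  show ?thesis
  proof
    fix u v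
    obtain q where q: "q \<in> Q" "dist (\<phi> u) q \<le> \<delta> / 2" using cover by blast
    have "\<phi> (inv \<phi> q) = q" by (rule surj_f_inv_f[OF surj])
    then show "\<exists>q\<in>\<phi> -` Q. dist u q \<le> \<delta> / 2" using q iso[of u "inv \<phi> q"] by (intro bexI[of _ "inv \<phi> q"]) auto
    show "reach h (\<phi> -` Q) u v (A * dist u v + 4 * \<delta>)"
      unfolding reach_vimage[OF iso surj] iso[symmetric, of u v] by (rule chain)
  qed (use delta_pos delta_le A_nonneg in auto)
qed

text \<open>The perturbation estimate with displacement 0: nearly shortest routes do not leave the
  ball on which the two sets agree.\<close>

lemma tdist_local:
  assumes "net h \<delta> A P" "net h \<delta> A P'"
    and "\<And>p. dist x p \<le> A * dist x y + 4 * \<delta> + 1 \<Longrightarrow> p \<in> P \<longleftrightarrow> p \<in> P'"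
  shows "tdist h P x y = tdist h P' x y"
proof -
  have "tdist h P' x y \<le> tdist h P x y" if "net h \<delta> A P" "net h \<delta> A P'"
    "\<And>p. dist x p \<le> A * dist x y + 4 * \<delta> + 1 \<Longrightarrow> p \<in> P \<longleftrightarrow> p \<in> P'" for P P'
    using tdist_perturb_le[of h \<delta> A P 0 P' x y] that by fastforce
  from this[OF assms] this[OF assms(2,1)] assms(3) show ?thesis by force
qed

section \<open>Empty cubes and near invariance of the mean\<close>

lemma measure_gidx_vimage_ge:
  fixes a :: "real ^ 'd"
  assumes l: "0 < l" shows "l ^ CARD('d) \<le> measure lborel (gidx l a -` {z})"
proof -
  let ?u = "(\<chi> i. a $ i + l * real_of_int (z $ i)) :: real ^ 'd"
  let ?v = "(\<chi> i. a $ i + l * (real_of_int (z $ i) + 1)) :: real ^ 'd"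
  have "measure lborel (cbox ?u ?v) = (\<Prod>i\<in>(UNIV :: 'd set). ?v $ i - ?u $ i)"
  proof (rule content_cbox_cart)
    have "?u \<in> cbox ?u ?v" using l by (simp add: mem_box_cart)
    then show "cbox ?u ?v \<noteq> {}" by blast
  qed
  also have "\<dots> = l ^ CARD('d)" by (simp add: algebra_simps)
  also have "measure lborel (cbox ?u ?v) = measure lborel (box ?u ?v)"
    by (simp add: measure_lborel_box_eq measure_lborel_cbox_eq)
  finally have "l ^ CARD('d) = measure lborel (box ?u ?v)" by simp
  also have "\<dots> \<le> measure lborel (gidx l a -` {z})"
  proof (rule measure_mono_fmeasurable[OF box_subset_gidx[OF l]])
    have "gidx l a -` {z} \<subseteq> cbox ?u ?v" using gidx_vimage_subset[OF l, of a z] by (simp add: grid_cube_def)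
    then show "gidx l a -` {z} \<in> fmeasurable lborel"
      by (rule fmeasurableI2[OF fmeasurable_cbox]) (simp add: gidx_vimage_borel)
  qed simp
  finally show ?thesis .
qed

lemma prob_empty_cube:
  fixes a :: "real ^ 'd"
  assumes X: "unit_poisson_process M X" and l: "0 < l"
  shows "{\<omega> \<in> space M. X \<omega> \<inter> gidx l a -` {z} = {}} \<in> sets M"
    and "measure M {\<omega> \<in> space M. X \<omega> \<inter> gidx l a -` {z} = {}} \<le> exp (- (l ^ CARD('d)))"
proof -
  have ne: "gidx l a -` {z} \<noteq> {}"
  proof
    assume "gidx l a -` {z} = {}"
    then show False using measure_gidx_vimage_ge[OF l, of a z] zero_less_power[OF l, of "CARD('d)"] by simp
  qed
  have b: "bounded (gidx l a -` {z})"
    by (rule bounded_subset[OF _ gidx_vimage_subset[OF l]]) (simp add: grid_cube_def bounded_cbox)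
  note occ = unit_poisson_process_occupancy[OF X, of "{()}" "\<lambda>_. gidx l a -` {z}" "{}"]
  show "{\<omega> \<in> space M. X \<omega> \<inter> gidx l a -` {z} = {}} \<in> sets M"
    using occ(1) ne b gidx_vimage_borel by simp
  have "measure M {\<omega> \<in> space M. X \<omega> \<inter> gidx l a -` {z} = {}} = exp (- measure lborel (gidx l a -` {z}))"
    using occ(2) ne b gidx_vimage_borel by simp
  then show "measure M {\<omega> \<in> space M. X \<omega> \<inter> gidx l a -` {z} = {}} \<le> exp (- (l ^ CARD('d)))"
    using measure_gidx_vimage_ge[OF l, of a z] by simp
qed

lemma (in poisson_grid) prob_empty_region:
  fixes x y :: "real ^ 'd"
  defines "E \<equiv> (\<Union>z\<in>I x y. {\<omega> \<in> space M. X \<omega> \<inter> gidx l a -` {z} = {}})"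
  shows "E \<in> sets M" "prob E \<le> real (card (I x y)) * exp (- (l ^ CARD('d)))"
proof -
  show "E \<in> sets M" unfolding E_def using finite_I prob_empty_cube(1)[OF X l_pos] by (intro sets.finite_UN) auto
  have "prob E \<le> (\<Sum>z\<in>I x y. prob {\<omega> \<in> space M. X \<omega> \<inter> gidx l a -` {z} = {}})"
    unfolding E_def using prob_empty_cube(1)[OF X l_pos] by (intro finite_measure_subadditive_finite finite_I) auto
  also have "\<dots> \<le> (\<Sum>z\<in>I x y. exp (- (l ^ CARD('d))))" by (intro sum_mono prob_empty_cube(2)[OF X l_pos])
  finally show "prob E \<le> real (card (I x y)) * exp (- (l ^ CARD('d)))" by simp
qed

lemma (in poisson_grid) henrich_eq_near:
  assumes "\<And>z. z \<in> I x y \<Longrightarrow> X \<omega> \<inter> gidx l a -` {z} \<noteq> {}" "dist x p \<le> U x y + 1"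
  shows "p \<in> henrich l a c (X \<omega>) \<longleftrightarrow> p \<in> X \<omega>"
proof
  assume "p \<in> henrich l a c (X \<omega>)"
  then obtain z where z: "p \<in> cube_pts l a c (X \<omega>) z" by (auto simp: henrich_def)
  have "p \<in> grid_cube l a z" by (rule subsetD[OF cube_pts_subset[OF l_pos c] z])
  then have "z \<in> I x y" using assms(2) by (auto simp: I_def region_def)
  then show "p \<in> X \<omega>" using assms(1) z by (auto simp: cube_pts_def split: if_splits)
next
  assume "p \<in> X \<omega>"
  then have "p \<in> cube_pts l a c (X \<omega>) (gidx l a p)" by (auto simp: cube_pts_def)
  then show "p \<in> henrich l a c (X \<omega>)" by (auto simp: henrich_def)
qed

text \<open>Enrichment breaks the invariance under rigid motions, but only where some cube is empty.\<close>

lemma (in poisson_grid) expectation_Z_isometric: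
  assumes eq: "dist x y = dist x' y'"
  shows "\<bar>expectation (Z x y) - expectation (Z x' y')\<bar>
    \<le> U x y * ((real (card (I x y)) + real (card (I x' y'))) * exp (- (l ^ CARD('d))))"
proof -
  have "norm (y - x) = norm (y' - x')" using eq by (simp add: dist_norm norm_minus_commute)
  then obtain f where f: "orthogonal_transformation f" "f (y - x) = y' - x'" by (rule orthogonal_transformation_exists)
  define \<phi> where "\<phi> = (\<lambda>v. (x' - f x) + f v)"
  have lin: "linear f" using f(1) by (rule orthogonal_transformation_linear)
  have \<phi>x: "\<phi> x = x'" by (simp add: \<phi>_def)
  have \<phi>y: "\<phi> y = y'" using f(2) by (simp add: \<phi>_def linear_diff[OF lin] algebra_simps)
  have iso: "dist (\<phi> u) (\<phi> v) = dist u v" for u v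
    using orthogonal_transformation_isometry[of f] f by (simp add: \<phi>_def)
  have inj: "inj \<phi>" by (rule injI) (metis iso dist_eq_0_iff)
  have surj: "surj \<phi>"
  proof -
    have "\<exists>v. w = \<phi> v" for w
      using orthogonal_transformation_surj[OF f(1)] unfolding \<phi>_def by (metis surj_def add.commute diff_add_cancel)
    then show ?thesis by (auto simp: surj_def)
  qed
  have "unit_poisson_process M (\<lambda>\<omega>. \<phi> ` X \<omega>)"
    by (rule unit_poisson_process_rigid[OF X f(1) \<phi>_def])
  \<comment> \<open>The moved process is enriched on the unmoved grid. Hence it has the mean of
    \<open>Z x' y'\<close>, while pulled back by \<open>\<phi>\<close> it agrees with
    \<open>Z x y\<close> pointwise wherever no relevant cube is empty for either
    configuration.\<close>
  then interpret Y: poisson_grid M "\<lambda>\<omega>. \<phi> ` X \<omega>" l h a c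
    using l_pos c step by unfold_locales auto
  have law: "expectation (Y.Z x' y') = expectation (Z x' y')"
    by (rule expectation_Z_unique[OF Y.poisson_grid_axioms poisson_grid_axioms])
  have U: "U x' y' = U x y" by (simp add: U_def eq)
  define E where "E = (\<Union>z\<in>I x y. {\<omega> \<in> space M. X \<omega> \<inter> gidx l a -` {z} = {}})"
  define E' where "E' = (\<Union>z\<in>I x' y'. {\<omega> \<in> space M. \<phi> ` X \<omega> \<inter> gidx l a -` {z} = {}})"
  have E: "E \<in> sets M" "prob E \<le> real (card (I x y)) * exp (- (l ^ CARD('d)))"
    unfolding E_def by (rule prob_empty_region)+
  have E': "E' \<in> sets M" "prob E' \<le> real (card (I x' y')) * exp (- (l ^ CARD('d)))"
    unfolding E'_def by (rule Y.prob_empty_region)+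
  have good: "Z x y \<omega> = Y.Z x' y' \<omega>" if "\<omega> \<in> space M" "\<omega> \<notin> E" "\<omega> \<notin> E'" for \<omega>
  proof -
    have "Z x y \<omega> = tdist h (\<phi> -` henrich l a c (\<phi> ` X \<omega>)) x y"
      unfolding Z_def
    proof (rule tdist_local[OF henrich_net' net_vimage[OF iso surj Y.henrich_net']])
      fix p assume "dist x p \<le> const_C CARD('d) * dist x y + 4 * (const_C CARD('d) * l) + 1"
      then have p: "dist x p \<le> U x y + 1" by (simp add: U_def)
      then have p': "dist x' (\<phi> p) \<le> Y.U x' y' + 1" using iso[of x p] by (simp add: U \<phi>x)
      have "p \<in> henrich l a c (X \<omega>) \<longleftrightarrow> p \<in> X \<omega>"
        using that p by (intro henrich_eq_near[of x y]) (auto simp: E_def)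
      moreover have "\<phi> p \<in> henrich l a c (\<phi> ` X \<omega>) \<longleftrightarrow> \<phi> p \<in> \<phi> ` X \<omega>"
        using that p' by (intro Y.henrich_eq_near[of x' y']) (auto simp: E'_def)
      ultimately show "p \<in> henrich l a c (X \<omega>) \<longleftrightarrow> p \<in> \<phi> -` henrich l a c (\<phi> ` X \<omega>)"
        using inj by (simp add: inj_image_mem_iff)
    qed
    then show ?thesis by (simp add: tdist_vimage[OF iso surj] \<phi>x \<phi>y Y.Z_def)
  qed
  have EE: "E \<union> E' \<in> sets M" using E E' by auto
  have "\<bar>expectation (Z x y) - expectation (Z x' y')\<bar> = \<bar>expectation (\<lambda>\<omega>. Z x y \<omega> - Y.Z x' y' \<omega>)\<bar>"
    using Z_integrable Y.Z_integrable by (simp add: law)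
  also have "\<dots> \<le> expectation (\<lambda>\<omega>. \<bar>Z x y \<omega> - Y.Z x' y' \<omega>\<bar>)"
    by (rule integral_abs_bound)
  also have "\<dots> \<le> expectation (\<lambda>\<omega>. U x y * indicator (E \<union> E') \<omega>)"
  proof (rule integral_mono)
    show "integrable M (\<lambda>\<omega>. \<bar>Z x y \<omega> - Y.Z x' y' \<omega>\<bar>)" using Z_integrable Y.Z_integrable by auto
    show "integrable M (\<lambda>\<omega>. U x y * indicator (E \<union> E') \<omega>)" using EE by (auto simp: less_top[symmetric])
    fix \<omega> assume \<omega>: "\<omega> \<in> space M"
    have "\<bar>Z x y \<omega> - Y.Z x' y' \<omega>\<bar> \<le> U x y"
      using Z_bounds[of x y \<omega>] Y.Z_bounds[of x' y' \<omega>] by (simp add: U abs_le_iff)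
    then show "\<bar>Z x y \<omega> - Y.Z x' y' \<omega>\<bar> \<le> U x y * indicator (E \<union> E') \<omega>"
      using good[OF \<omega>] by (auto simp: indicator_def)
  qed
  also have "\<dots> = U x y * prob (E \<union> E')" using EE by simp
  also have "\<dots> \<le> U x y * (real (card (I x y)) * exp (- (l ^ CARD('d))) + real (card (I x' y')) * exp (- (l ^ CARD('d))))"
    using E E' measure_Un_le[OF E(1) E'(1)] U_pos[of x y] by (intro mult_left_mono) auto
  finally show ?thesis by (simp add: distrib_right)
qed

section \<open>Comparing routes with the graph distance\<close>

lemma path_len_Cons: "path_len (u # v # p) = dist u v + path_len (v # p)"
  by (simp add: path_len_def sum.lessThan_Suc_shift dist_norm norm_minus_commute del: sum.lessThan_Suc)

lemma path_len_eq_rlen: "path_len (u # p @ [v]) = rlen u p v"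
proof (induction p arbitrary: u)
  case Nil
  then show ?case by (simp add: path_len_Cons) (simp add: path_len_def)
next
  case (Cons w p)
  then show ?case by (simp add: path_len_Cons)
qed

lemma route_successively:
  "route h P u p v \<longleftrightarrow> set p \<subseteq> P \<and> successively (\<lambda>u v. dist u v \<le> h) (u # p @ [v])"
  by (induction p arbitrary: u) auto

text \<open>Hops from \<open>x\<close> to the first point and from the last point to
  \<open>y\<close> turn a path into a route; each has length at most \<open>h / 2\<close>.\<close>

lemma reach_of_path:
  assumes "p \<in> paths h P x y" "0 \<le> h"
  shows "reach h P x y (path_len p + h)"
proof -
  have suc: "successively (\<lambda>u v. dist u v \<le> h) p" and p: "p \<noteq> []" "set p \<subseteq> P"
    and ends: "dist x (hd p) \<le> h / 2" "dist y (last p) \<le> h / 2"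
    using assms by (auto simp: paths_def successively_conv_nth dist_norm)
  show ?thesis
  proof (cases "length p = 1")
    case True
    then obtain u where u: "p = [u]" by (auto simp: length_Suc_conv)
    then show ?thesis using assms p ends unfolding reach_def
      by (intro exI[of _ "[u]"]) (auto simp: path_len_def dist_commute)
  next
    case False
    then obtain u q where "p = u # q" "q \<noteq> []" using p by (cases p) auto
    then obtain r v where r: "p = u # r @ [v]" by (cases q rule: rev_cases) auto
    have "route h P u r v" using suc p unfolding r route_successively by auto
    moreover have "dist x u \<le> h / 2" "dist v y \<le> h / 2" "u \<in> P" "v \<in> P" using ends p r by (auto simp: dist_commute)
    ultimately have "route h P x (u # r @ [v]) y" "rlen x (u # r @ [v]) y \<le> path_len p + h"
      using assms(2) by (auto simp: route_append rlen_append r path_len_eq_rlen)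
    then show ?thesis unfolding reach_def by blast
  qed
qed

lemma path_of_route:
  assumes "route h P u r v" "u \<in> closest_points P x" "v \<in> closest_points P y" "dist x u \<le> h / 2" "dist y v \<le> h / 2"
  shows "u # r @ [v] \<in> paths h P x y"
proof -
  have "successively (\<lambda>u v. dist u v \<le> h) (u # r @ [v])" "set r \<subseteq> P" using assms(1) by (auto simp: route_successively)
  then show ?thesis using assms(2-) unfolding successively_conv_nth
    by (auto simp: paths_def dist_norm closest_points_def)
qed

lemma (in net) reach_move_both:
  assumes "reach h P x y L" "dist x u \<le> \<delta> / 2" "dist y v \<le> \<delta> / 2"
  shows "reach h P u v (L + 2 * detour A * \<delta>)"
  using move_end[OF reach_sym[OF move_end[OF assms(1,3)]] assms(2), THEN reach_sym]
  by (simp add: algebra_simps)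

lemma closest_point_exists:
  fixes P :: "(real ^ 'd) set"
  assumes "net h \<delta> A P" "finite (P \<inter> cball x \<delta>)" shows "\<exists>q\<in>closest_points P x. dist x q \<le> \<delta> / 2"
proof -
  interpret net h \<delta> A P by fact
  obtain q0 where q0: "q0 \<in> P" "dist x q0 \<le> \<delta> / 2" using cover by blast
  then have "P \<inter> cball x \<delta> \<noteq> {}" using delta_pos by fastforce
  then obtain q where q: "q \<in> P \<inter> cball x \<delta>" "\<And>y. y \<in> P \<inter> cball x \<delta> \<Longrightarrow> dist x q \<le> dist x y"
    using ex_is_arg_min_if_finite[OF assms(2), of "dist x"] by (auto simp: is_arg_min_linorder)
  have "dist x q \<le> dist x q0" using q0 delta_pos by (intro q(2)) auto
  then have "dist x q \<le> \<delta> / 2" using q0(2) by (rule order_trans)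
  moreover have "dist x q \<le> dist x y" if "y \<in> P" for y
    using q that by (cases "dist x y \<le> \<delta>") auto
  ultimately show ?thesis using q(1) by (intro bexI[of _ q]) (auto simp: closest_points_def dist_norm)
qed

text \<open>A nearly shortest route is moved at both ends to closest points. These are within
  \<open>\<delta> / 2\<close>, hence within the permitted \<open>h / 2\<close>, and the two moves
  cost \<open>2 * detour A * \<delta>\<close>.\<close>

lemma graph_dist_le:
  fixes P :: "(real ^ 'd) set"
  assumes "net h \<delta> A P" "\<And>x. finite (P \<inter> cball x \<delta>)"
  shows "graph_dist h P x y \<le> ennreal (tdist h P x y + 2 * detour A * \<delta>)"
proof (rule ennreal_le_epsilon)
  interpret net h \<delta> A P by fact
  fix e :: real assume e: "0 < e"
  obtain u where u: "u \<in> closest_points P x" "dist x u \<le> \<delta> / 2" using closest_point_exists[OF assms] by blast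
  obtain v where v: "v \<in> closest_points P y" "dist y v \<le> \<delta> / 2" using closest_point_exists[OF assms] by blast
  have "reach h P x y (tdist h P x y + e)" using tdist_attain[OF chain e, of x y] unfolding reach_def by (meson less_imp_le)
  from reach_move_both[OF this u(2) v(2)] obtain r where r: "route h P u r v"
    "rlen u r v \<le> tdist h P x y + e + 2 * detour A * \<delta>" by (auto simp: reach_def)
  have "u # r @ [v] \<in> paths h P x y"
    using u v delta_le by (intro path_of_route[OF r(1)]) auto
  then have "graph_dist h P x y \<le> ennreal (path_len (u # r @ [v]))" unfolding graph_dist_def by (rule INF_lower)
  also have "\<dots> \<le> ennreal (tdist h P x y + 2 * detour A * \<delta> + e)"
    using r(2) by (intro ennreal_leI) (simp add: path_len_eq_rlen)
  also have "\<dots> = ennreal (tdist h P x y + 2 * detour A * \<delta>) + ennreal e"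
    using e tdist_nonneg[of x y] A_nonneg delta_pos by (intro ennreal_plus) (auto simp: detour_def)
  finally show "graph_dist h P x y \<le> ennreal (tdist h P x y + 2 * detour A * \<delta>) + ennreal e" .
qed

lemma graph_dist_ge:
  assumes "0 \<le> h" shows "ennreal (tdist h P x y - h) \<le> graph_dist h P x y"
  unfolding graph_dist_def
proof (rule INF_greatest)
  fix p assume "p \<in> paths h P x y"
  from tdist_le[OF reach_of_path[OF this assms]] show "ennreal (tdist h P x y - h) \<le> ennreal (path_len p)"
    by (intro ennreal_leI) simp
qed

text \<open>The comparison rests on monotonicity of the integral, as \<open>graph_dist\<close> is
  not shown to be measurable. The upper bound also gives finiteness, so \<open>enn2real\<close> does
  not collapse the integral to 0.\<close>

lemma (in poisson_grid) expected_dist_bounds: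
  shows "expectation (Z x y) - h \<le> expected_dist M (\<lambda>\<omega>. enrich l a c (X \<omega>)) h x y"
    and "expected_dist M (\<lambda>\<omega>. enrich l a c (X \<omega>)) h x y
      \<le> expectation (Z x y) + 2 * detour (const_C CARD('d)) * (const_C CARD('d) * l)"
proof -
  let ?c = "2 * detour (const_C CARD('d)) * (const_C CARD('d) * l)"
  let ?G = "\<integral>\<^sup>+ \<omega>. graph_dist h (enrich l a c (X \<omega>)) x y \<partial>M"
  have G: "?G = (\<integral>\<^sup>+ \<omega>. graph_dist h (henrich l a c (X \<omega>)) x y \<partial>M)"
  proof (rule nn_integral_cong_AE)
    show "AE \<omega> in M. graph_dist h (enrich l a c (X \<omega>)) x y = graph_dist h (henrich l a c (X \<omega>)) x y"
      using enrich_eq_henrich[OF X l_pos, of a c] by eventually_elim simp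
  qed
  note [simp] = Z_integrable
  have c0: "0 \<le> ?c" using detour_delta_pos by simp
  have "?G \<le> (\<integral>\<^sup>+ \<omega>. ennreal (Z x y \<omega> + ?c) \<partial>M)"
    unfolding G Z_def using delta_pos
    by (intro nn_integral_mono graph_dist_le[OF henrich_net'] finite_henrich') auto
  also have "\<dots> = ennreal (expectation (\<lambda>\<omega>. Z x y \<omega> + ?c))"
    using c0 Z_bounds(1)[of x y] by (intro nn_integral_eq_integral) auto
  also have "expectation (\<lambda>\<omega>. Z x y \<omega> + ?c) = expectation (Z x y) + ?c" by (simp add: prob_space)
  finally have up: "?G \<le> ennreal (expectation (Z x y) + ?c)" .
  have EZ: "0 \<le> expectation (Z x y)" using Z_bounds(1) by (intro Bochner_Integration.integral_nonneg) auto
  show "expected_dist M (\<lambda>\<omega>. enrich l a c (X \<omega>)) h x y \<le> expectation (Z x y) + ?c"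
    unfolding expected_dist_def using up EZ c0 by (metis add_nonneg_nonneg enn2real_leI)
  have "ennreal (expectation (Z x y) - h) \<le> ennreal (expectation (\<lambda>\<omega>. max 0 (Z x y \<omega> - h)))"
  proof (rule ennreal_leI)
    have "expectation (Z x y) - h = expectation (\<lambda>\<omega>. Z x y \<omega> - h)" by (simp add: prob_space)
    also have "\<dots> \<le> expectation (\<lambda>\<omega>. max 0 (Z x y \<omega> - h))" by (intro integral_mono) auto
    finally show "expectation (Z x y) - h \<le> expectation (\<lambda>\<omega>. max 0 (Z x y \<omega> - h))" .
  qed
  also have "\<dots> = (\<integral>\<^sup>+ \<omega>. ennreal (max 0 (Z x y \<omega> - h)) \<partial>M)"
    by (intro nn_integral_eq_integral[symmetric]) auto
  also have "\<dots> = (\<integral>\<^sup>+ \<omega>. ennreal (Z x y \<omega> - h) \<partial>M)"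
    by (intro nn_integral_cong) (simp add: max_def ennreal_neg)
  also have "\<dots> \<le> ?G"
    unfolding G Z_def using h_pos by (intro nn_integral_mono graph_dist_ge) auto
  finally have "ennreal (expectation (Z x y) - h) \<le> ?G" .
  moreover have "?G < top" using up by (simp add: le_less_trans)
  ultimately have "enn2real (ennreal (expectation (Z x y) - h)) \<le> enn2real ?G" by (intro enn2real_mono)
  moreover have "expectation (Z x y) - h \<le> enn2real (ennreal (expectation (Z x y) - h))"
    by (cases "0 \<le> expectation (Z x y) - h") (auto simp: ennreal_neg)
  ultimately show "expectation (Z x y) - h \<le> expected_dist M (\<lambda>\<omega>. enrich l a c (X \<omega>)) h x y"
    unfolding expected_dist_def by linarith
qed

section \<open>Near additivity under doubling\<close>

lemma route_crossing:
  assumes "route h P x p y" "\<not> f x" "f y" "0 \<le> h"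
  shows "\<exists>u v L L'. \<not> f u \<and> f v \<and> dist u v \<le> h \<and> reach h P x v L \<and> reach h P v y L' \<and> L + L' \<le> rlen x p y \<and> 0 \<le> L"
  using assms
proof (induction p arbitrary: x)
  case Nil
  then show ?case
    by (intro exI[of _ x] exI[of _ y] exI[of _ "dist x y"] exI[of _ 0]) (auto intro: reach_direct)
next
  case (Cons w p)
  show ?case
  proof (cases "f w")
    case True
    have "reach h P w y (rlen w p y)" using Cons.prems by (auto simp: reach_def)
    then show ?thesis using Cons.prems True
      by (intro exI[of _ x] exI[of _ w] exI[of _ "dist x w"] exI[of _ "rlen w p y"]) (auto intro: reach_direct)
  next
    case False
    then obtain u v L L' where *: "\<not> f u" "f v" "dist u v \<le> h" "reach h P w v L" "reach h P v y L'"
        "L + L' \<le> rlen w p y" "0 \<le> L"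
      using Cons.IH[of w] Cons.prems by auto
    have "reach h P x v (dist x w + L)"
      using Cons.prems by (intro reach_trans[OF reach_direct *(4)]) auto
    then show ?thesis using *
      by (intro exI[of _ u] exI[of _ v] exI[of _ "dist x w + L"] exI[of _ L']) auto
  qed
qed

text \<open>\<open>v\<close> is the first vertex outside the open ball about \<open>x\<close>, and
  \<open>w\<close> is sought only on the remainder of the route, so the two portions do not overlap
  and their lengths add up. A single step overshoots each sphere by at most
  \<open>h\<close>.\<close>

lemma (in net) crossing_points:
  assumes s: "0 < s" "dist x y = 2 * s" and \<eta>: "0 < \<eta>"
  shows "\<exists>v w. s \<le> dist x v \<and> dist x v \<le> s + h \<and> s - h \<le> dist w y \<and> dist w y \<le> s \<and>
    tdist h P x v + tdist h P w y \<le> tdist h P x y + \<eta>"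
proof -
  have h: "0 \<le> h" using delta_pos delta_le by simp
  obtain p where p: "route h P x p y" "rlen x p y < tdist h P x y + \<eta>" using tdist_attain[OF chain \<eta>] by blast
  obtain u v L L' where 1: "\<not> s \<le> dist x u" "s \<le> dist x v" "dist u v \<le> h" "reach h P x v L" "reach h P v y L'"
      "L + L' \<le> rlen x p y" "0 \<le> L"
    using route_crossing[OF p(1), of "\<lambda>v. s \<le> dist x v"] s h by auto
  have xv: "dist x v \<le> s + h" using 1 dist_triangle[of x v u] by simp
  have vy: "s - h \<le> dist v y" using xv s dist_triangle[of x y v] by simp
  have "\<exists>w. s - h \<le> dist w y \<and> dist w y \<le> s \<and> tdist h P w y \<le> L'"
  \<comment> \<open>If \<open>v\<close> already lies in the ball about \<open>y\<close>, it serves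
    as \<open>w\<close>; it is not too deep inside because \<open>x\<close> and \<open>y\<close> are
    \<open>2 * s\<close> apart.\<close>
  proof (cases "dist v y \<le> s")
    case True
    then show ?thesis using vy tdist_le[OF 1(5)] by blast
  next
    case False
    obtain q where q: "route h P v q y" "rlen v q y \<le> L'" using 1(5) by (auto simp: reach_def)
    obtain u' w K K' where 2: "\<not> dist u' y \<le> s" "dist w y \<le> s" "dist u' w \<le> h" "reach h P w y K'"
        "K + K' \<le> rlen v q y" "0 \<le> K"
      using route_crossing[OF q(1), of "\<lambda>w. dist w y \<le> s"] s h False by auto
    have "s - h \<le> dist w y" using 2 dist_triangle[of u' y w] by simp
    moreover have "tdist h P w y \<le> L'" using tdist_le[OF 2(4)] 2 q by simp
    ultimately show ?thesis using 2 by blast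
  qed
  then obtain w where "s - h \<le> dist w y" "dist w y \<le> s" "tdist h P w y \<le> L'" by blast
  moreover have "tdist h P x v \<le> L" by (rule tdist_le[OF 1(4)])
  ultimately show ?thesis using 1 xv p by (intro exI[of _ v] exI[of _ w]) auto
qed

text \<open>The integer vectors give polynomially many directions, fine enough for errors of order \<open>h\<close>.\<close>

definition sphere_pt :: "'d \<Rightarrow> real \<Rightarrow> real ^ 'd \<Rightarrow> int ^ 'd \<Rightarrow> real ^ 'd" where
  "sphere_pt i s b z = (let v = (\<chi> j. of_int (z $ j)) - b in b + s *\<^sub>R (if v = 0 then axis i 1 else v /\<^sub>R norm v))"

lemma dist_sphere_pt: "0 \<le> s \<Longrightarrow> dist b (sphere_pt i s b z) = s"
  by (simp add: sphere_pt_def Let_def dist_norm)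

text \<open>Rounding moves \<open>v\<close> by at most sqrt d; the radial projection then moves the
  rounded point by its distance to the sphere, at most \<open>r\<close> plus sqrt d.\<close>

lemma sphere_pt_near:
  fixes b v :: "real ^ 'd"
  assumes s: "0 \<le> s" and v: "\<bar>dist b v - s\<bar> \<le> r"
  shows "dist v (sphere_pt i s b (\<chi> j. \<lfloor>v $ j\<rfloor>)) \<le> r + const_C CARD('d)"
proof -
  define u :: "real ^ 'd" where "u = (\<chi> j. of_int ((\<chi> j. \<lfloor>v $ j\<rfloor>) $ j))"
  have uv: "dist v u \<le> sqrt (real CARD('d)) * 1"
    unfolding dist_norm by (rule norm_le_sqrt_card) (simp add: u_def abs_le_iff, linarith)
  let ?S = "sphere_pt i s b (\<chi> j. \<lfloor>v $ j\<rfloor>)"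
  have S: "?S = b + s *\<^sub>R (if u - b = 0 then axis i 1 else (u - b) /\<^sub>R norm (u - b))"
    by (simp add: sphere_pt_def u_def Let_def)
  have "dist u ?S = \<bar>norm (u - b) - s\<bar>"
  proof (cases "u = b")
    case True
    then show ?thesis using s by (simp add: S dist_norm)
  next
    case False
    have "u - ?S = (1 - s / norm (u - b)) *\<^sub>R (u - b)" using False
      by (simp add: S algebra_simps divide_inverse)
    then have "norm (u - ?S) = \<bar>1 - s / norm (u - b)\<bar> * norm (u - b)" by (metis norm_scaleR)
    also have "\<dots> = \<bar>(1 - s / norm (u - b)) * norm (u - b)\<bar>" by (simp add: abs_mult)
    also have "(1 - s / norm (u - b)) * norm (u - b) = norm (u - b) - s" using False by (simp add: field_simps)
    finally show ?thesis by (simp add: dist_norm)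
  qed
  also have "\<dots> = \<bar>dist b u - s\<bar>" by (simp add: dist_norm norm_minus_commute)
  also have "\<dots> \<le> r + sqrt (real CARD('d))"
    using v uv dist_triangle[of b u v] dist_triangle[of b v u] by (simp add: dist_commute abs_le_iff)
  finally have "dist v ?S \<le> r + 2 * sqrt (real CARD('d))" using uv dist_triangle[of v ?S u] by simp
  then show ?thesis by (simp add: const_C_def)
qed

text \<open>Crossing points near the far end lie within \<open>s\<close> of a point of norm
  \<open>2 * s\<close>, so the box must contain the integer parts of all vectors of norm at most
  \<open>3 * s\<close>.\<close>

definition dir_idx :: "real \<Rightarrow> (int ^ 'd) set" where
  "dir_idx s = {z. \<forall>j. z $ j \<in> {- \<lceil>3 * s\<rceil> - 1..\<lceil>3 * s\<rceil>}}"

lemma dir_idx: "finite (dir_idx s :: (int ^ 'd) set)" "1 \<le> s \<Longrightarrow> dir_idx s \<noteq> ({} :: (int ^ 'd) set)"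
  "1 \<le> s \<Longrightarrow> real (card (dir_idx s :: (int ^ 'd) set)) \<le> (10 * s) ^ CARD('d)"
proof -
  show "finite (dir_idx s :: (int ^ 'd) set)" unfolding dir_idx_def by (rule finite_vec_box(1)) auto
  assume s: "1 \<le> s"
  have c: "3 * s \<le> of_int \<lceil>3 * s\<rceil>" "of_int \<lceil>3 * s\<rceil> \<le> 3 * s + 1" by linarith+
  have "0 \<le> \<lceil>3 * s\<rceil>" using s by linarith
  then have "- \<lceil>3 * s\<rceil> - 1 \<le> 0 \<and> 0 \<le> \<lceil>3 * s\<rceil>" by linarith
  then have "(\<chi> j. 0) \<in> (dir_idx s :: (int ^ 'd) set)"
    unfolding dir_idx_def by (simp only: mem_Collect_eq vec_lambda_beta atLeastAtMost_iff simp_thms)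
  then show "dir_idx s \<noteq> ({} :: (int ^ 'd) set)" by blast
  have "card (dir_idx s :: (int ^ 'd) set) = (\<Prod>i\<in>(UNIV :: 'd set). card {- \<lceil>3 * s\<rceil> - 1..\<lceil>3 * s\<rceil>})"
    unfolding dir_idx_def by (rule finite_vec_box(2)) auto
  then have "real (card (dir_idx s :: (int ^ 'd) set)) = real (card {- \<lceil>3 * s\<rceil> - 1..\<lceil>3 * s\<rceil>}) ^ CARD('d)" by simp
  also have "\<dots> \<le> (10 * s) ^ CARD('d)"
    by (intro power_mono) (use s c in \<open>auto, linarith\<close>)
  finally show "real (card (dir_idx s :: (int ^ 'd) set)) \<le> (10 * s) ^ CARD('d)" .
qed

lemma floor_mem_dir_idx:
  fixes v :: "real ^ 'd" assumes "norm v \<le> 3 * s" shows "(\<chi> j. \<lfloor>v $ j\<rfloor>) \<in> dir_idx s"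
proof -
  have "\<bar>v $ j\<bar> \<le> 3 * s" for j using component_le_norm_cart[of v j] assms by linarith
  then have "- \<lceil>3 * s\<rceil> - 1 \<le> \<lfloor>v $ j\<rfloor> \<and> \<lfloor>v $ j\<rfloor> \<le> \<lceil>3 * s\<rceil>" for j
    unfolding abs_le_iff le_floor_iff floor_le_iff
    using le_of_int_ceiling[of "3 * s"] by (smt (verit) of_int_add of_int_diff of_int_minus of_int_1)
  then show ?thesis by (simp add: dir_idx_def)
qed

lemma norm_axis_real: "norm (axis i r :: real ^ 'd) = \<bar>r\<bar>"
  by (simp add: norm_eq_sqrt_inner inner_axis_axis)

lemma scaleR_axis_one: "r *\<^sub>R axis i 1 = (axis i r :: real ^ 'd)"
  by (simp add: vec_eq_iff axis_def)

text \<open>Generous rather than sharp: three times the bound of \<open>isometric_error\<close>,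
  plus detours, rounding on the spheres and the comparison with the graph distance, enough for both
  signs of the defect.\<close>

definition rate_C1 :: "nat \<Rightarrow> real" where
  "rate_C1 d = (let A = const_C d in 3 * (2 * (A + 4) * (2 * A + 12) ^ d) + 8 * (2 * detour A) + 4 * A + 11)"

text \<open>One deviation term for each end, times the factor of \<open>kappa_le\<close>, in which
  45 is \<open>8 * 4 + 13\<close>, times the factor of \<open>ln_card_le\<close>.\<close>

definition rate_C2 :: "nat \<Rightarrow> real" where
  "rate_C2 d = (let A = const_C d in 2 * (2 * detour A * sqrt (8 * A + 45)) * (real d * 10 + 3))"

context poisson_grid
begin

lemma Z_triangle: "Z x y \<omega> \<le> Z x v \<omega> + Z v y \<omega> + 2 * detour (const_C CARD('d)) * (const_C CARD('d) * l)"
  unfolding Z_def by (rule net.tdist_triangle[OF henrich_net'])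

lemma Z_sym: "Z x y \<omega> = Z y x \<omega>"
  unfolding Z_def by (rule net.tdist_sym[OF henrich_net'])

lemma Z_ge_dist: "dist x y \<le> Z x y \<omega>"
  unfolding Z_def by (rule tdist_ge_dist[OF net.chain[OF henrich_net']])

text \<open>Uses \<open>u \<le> ln N + exp u / N\<close>, so that no tail bound is needed.\<close>

lemma simultaneous_deviation:
  fixes f g :: "'j \<Rightarrow> real ^ 'd"
  assumes K: "finite K" "K \<noteq> {}" and s: "\<And>j. j \<in> K \<Longrightarrow> dist (f j) (g j) = dist x y"
  shows "\<exists>W. integrable M W \<and> expectation W \<le> \<kappa> x y * (ln (real (card K)) + exp 1) \<and>
    (\<forall>\<omega>\<in>space M. \<forall>j\<in>K. expectation (Z (f j) (g j)) - W \<omega> \<le> Z (f j) (g j) \<omega>)"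
proof -
  let ?N = "real (card K)"
  have N: "0 < ?N" using K by (simp add: card_gt_0_iff)
  note k = kappa_pos[of x y]
  have k_eq: "\<kappa> (f j) (g j) = \<kappa> x y" if "j \<in> K" for j using s[OF that] by (simp add: \<kappa>_def U_def)
  define e where "e j \<omega> = exp ((expectation (Z (f j) (g j)) - Z (f j) (g j) \<omega>) / \<kappa> x y)" for j \<omega>
  have e_fun: "e j = (\<lambda>\<omega>. exp ((expectation (Z (f j) (g j)) - Z (f j) (g j) \<omega>) / \<kappa> x y))" for j
    by (intro ext) (simp add: e_def)
  have e_int: "integrable M (e j)" if "j \<in> K" for j
  proof (rule integrable_const_bound)
    show "AE \<omega> in M. norm (e j \<omega>) \<le> exp (expectation (Z (f j) (g j)) / \<kappa> x y)"
      using Z_bounds(1) k by (intro AE_I2) (simp add: e_def divide_right_mono)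
    show "e j \<in> borel_measurable M" unfolding e_fun by measurable
  qed
  have e_exp: "expectation (e j) \<le> exp 1" if "j \<in> K" for j
    using deviation[of "f j" "g j"] unfolding k_eq[OF that] e_def .
  \<comment> \<open>One integrable variable bounds the deviations for all of \<open>K\<close> at
    once, so it remains valid at an index chosen depending on the configuration, such as that of a
    crossing point.\<close>
  define W where "W \<omega> = \<kappa> x y * (ln ?N + (\<Sum>j\<in>K. e j \<omega>) / ?N)" for \<omega>
  have "integrable M W" unfolding W_def using e_int by (intro integrable_mult_right) auto
  moreover have "expectation W = \<kappa> x y * (ln ?N + (\<Sum>j\<in>K. expectation (e j)) / ?N)"
    unfolding W_def using e_int by (simp add: prob_space)
  then have "expectation W \<le> \<kappa> x y * (ln ?N + exp 1)"
  proof -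
    have "(\<Sum>j\<in>K. expectation (e j)) \<le> (\<Sum>j\<in>K. exp 1)" by (intro sum_mono e_exp)
    then have "(\<Sum>j\<in>K. expectation (e j)) / ?N \<le> exp 1" using N by (simp add: field_simps)
    then show ?thesis using k \<open>expectation W = _\<close> by (simp add: mult_left_mono)
  qed
  moreover have "expectation (Z (f j) (g j)) - W \<omega> \<le> Z (f j) (g j) \<omega>" if j: "j \<in> K" for j \<omega>
  proof -
    define u where "u = (expectation (Z (f j) (g j)) - Z (f j) (g j) \<omega>) / \<kappa> x y"
    have "u - ln ?N \<le> exp (u - ln ?N)" using exp_ge_add_one_self[of "u - ln ?N"] by linarith
    also have "\<dots> = exp u / ?N" using N by (simp add: exp_diff)
    also have "\<dots> \<le> (\<Sum>j\<in>K. e j \<omega>) / ?N"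
    proof (intro divide_right_mono)
      show "exp u \<le> (\<Sum>j\<in>K. e j \<omega>)"
        using member_le_sum[of j K "\<lambda>j. e j \<omega>"] K j by (simp add: e_def u_def)
    qed simp
    finally have "\<kappa> x y * u \<le> W \<omega>" unfolding W_def using k by (intro mult_left_mono) auto
    then show ?thesis using k by (simp add: u_def)
  qed
  ultimately show ?thesis by blast
qed

context
  fixes s :: real
  assumes l1: "1 \<le> l" and hs: "h \<le> s" and s: "exp 1 \<le> s"
    and decay: "(real CARD('d) + 1) * ln s \<le> l ^ CARD('d)"
begin

lemma s1: "1 \<le> s" using s exp_ge_add_one_self[of 1] by linarith

lemma U_le: "dist x y = s \<Longrightarrow> U x y \<le> (const_C CARD('d) + 4) * s"
  unfolding U_def using step hs by (simp add: distrib_right)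

text \<open>\<open>U x y\<close> is of order \<open>s\<close>, the number of relevant cubes of order
  \<open>s ^ d\<close>, and \<open>decay\<close> bounds the probability of an empty cube by
  \<open>1 / s ^ (d + 1)\<close>; the powers cancel. This is the role of k > d + 1.\<close>

lemma isometric_error:
  assumes "dist x y = s" "dist x' y' = s"
  shows "\<bar>expectation (Z x y) - expectation (Z x' y')\<bar>
    \<le> 2 * (const_C CARD('d) + 4) * (2 * const_C CARD('d) + 12) ^ CARD('d)"
proof -
  let ?A = "const_C CARD('d)"
  have card: "real (card (I x y)) \<le> ((2 * ?A + 12) * s) ^ CARD('d)" if "dist x y = s" for x y
  proof -
    have "real (card (I x y)) \<le> (2 * (U x y + 1) / l + 2) ^ CARD('d)"
      unfolding I_def using U_pos[of x y] by (intro region_bound(2)[OF l_pos]) simp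
    also have "\<dots> \<le> ((2 * ?A + 12) * s) ^ CARD('d)"
    proof (intro power_mono)
      have "2 * (U x y + 1) / l \<le> 2 * (U x y + 1)" using U_pos[of x y] l1 by (simp add: divide_le_eq mult_le_cancel_left1)
      also have "\<dots> + 2 \<le> (2 * ?A + 12) * s" using U_le[OF that] s1 by (simp add: algebra_simps)
      finally show "2 * (U x y + 1) / l + 2 \<le> (2 * ?A + 12) * s" by simp
      show "0 \<le> 2 * (U x y + 1) / l + 2" using U_pos[of x y] l1 by simp
    qed
    finally show ?thesis .
  qed
  have s0: "0 < s" using s1 by simp
  have "exp (- (l ^ CARD('d))) \<le> exp (- (real (CARD('d) + 1) * ln s))" using decay by (simp add: add.commute)
  also have "\<dots> = 1 / s ^ (CARD('d) + 1)"
    using s0 by (simp only: exp_minus exp_of_nat_mult exp_ln inverse_eq_divide)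
  finally have ex: "exp (- (l ^ CARD('d))) \<le> 1 / s ^ (CARD('d) + 1)" .
  have "\<bar>expectation (Z x y) - expectation (Z x' y')\<bar>
      \<le> U x y * ((real (card (I x y)) + real (card (I x' y'))) * exp (- (l ^ CARD('d))))"
    using assms by (intro expectation_Z_isometric) simp
  also have "\<dots> \<le> ((?A + 4) * s) * ((((2 * ?A + 12) * s) ^ CARD('d) + ((2 * ?A + 12) * s) ^ CARD('d)) * (1 / s ^ (CARD('d) + 1)))"
    using U_le[OF assms(1)] card[OF assms(1)] card[OF assms(2)] ex U_pos[of x y] A_pos s0
    by (intro mult_mono add_mono) (auto intro!: mult_nonneg_nonneg add_nonneg_nonneg)
  also have "\<dots> = 2 * (?A + 4) * (2 * ?A + 12) ^ CARD('d)"
  proof -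
    have "((?A + 4) * s) * (((y * s) ^ CARD('d) + (y * s) ^ CARD('d)) * (1 / s ^ (CARD('d) + 1))) =
        2 * (?A + 4) * y ^ CARD('d)" for y
      using s0 by (simp add: power_mult_distrib field_simps)
    then show ?thesis .
  qed
  finally show ?thesis .
qed

lemma kappa_le:
  assumes "dist x y = s"
  shows "\<kappa> x y \<le> 2 * detour (const_C CARD('d)) * sqrt (8 * const_C CARD('d) + 45) * sqrt ((const_C CARD('d) * l)\<^sup>2 * s / h)"
proof -
  let ?A = "const_C CARD('d)"
  have "8 * U x y / h + 13 \<le> 8 * ((?A + 4) * s) / h + 13 * (s / h)"
  proof (intro add_mono divide_right_mono mult_left_mono U_le assms)
    show "(13::real) \<le> 13 * (s / h)" using hs h_pos by (simp add: le_divide_eq)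
  qed (use h_pos in auto)
  also have "\<dots> = (8 * ?A + 45) * (s / h)" by (simp add: algebra_simps add_divide_distrib)
  finally have "sqrt (8 * U x y / h + 13) \<le> sqrt (8 * ?A + 45) * sqrt (s / h)"
    by (metis real_sqrt_le_mono real_sqrt_mult)
  then have "\<kappa> x y \<le> 2 * detour ?A * (?A * l) * (sqrt (8 * ?A + 45) * sqrt (s / h))"
    unfolding \<kappa>_def using detour_delta_pos by (intro mult_left_mono) auto
  also have "sqrt ((?A * l)\<^sup>2 * s / h) = (?A * l) * sqrt (s / h)"
    using delta_pos by (simp add: real_sqrt_mult real_sqrt_divide del: power_mult_distrib)
  then have "2 * detour ?A * (?A * l) * (sqrt (8 * ?A + 45) * sqrt (s / h)) =
      2 * detour ?A * sqrt (8 * ?A + 45) * sqrt ((?A * l)\<^sup>2 * s / h)" by (simp only: mult_ac)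
  finally show ?thesis .
qed

text \<open>From \<open>s \<ge> exp 1\<close> follows \<open>ln s \<ge> 1\<close>, which absorbs the
  crude bounds \<open>ln 10 \<le> 9\<close> and \<open>exp 1 \<le> 3\<close>.\<close>

lemma ln_card_le: "ln (real (card (dir_idx s :: (int ^ 'd) set))) + exp 1 \<le> (real CARD('d) * 10 + 3) * ln s"
proof -
  let ?N = "real (card (dir_idx s :: (int ^ 'd) set))"
  have s0: "0 < s" using s1 by simp
  have ls: "1 \<le> ln s" using s s0 by (simp add: ln_ge_iff)
  have "0 < ?N" using dir_idx(1)[where 'd = 'd and s = s] dir_idx(2)[where 'd = 'd, OF s1] by (simp add: card_gt_0_iff)
  then have "ln ?N \<le> ln ((10 * s) ^ CARD('d))" using dir_idx(3)[OF s1] s0 by (subst ln_le_cancel_iff) auto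
  also have "\<dots> = real CARD('d) * (ln 10 + ln s)" using s0 by (simp add: ln_realpow ln_mult distrib_left)
  also have "ln (10::real) \<le> 9" using ln_le_minus_one[of "10::real"] by simp
  then have "real CARD('d) * (ln 10 + ln s) \<le> real CARD('d) * (9 * ln s + ln s)"
    using ls by (intro mult_left_mono add_mono) (auto intro: order_trans)
  finally have "ln ?N \<le> real CARD('d) * (10 * ln s)" by simp
  moreover have "exp (1::real) \<le> 3 * ln s" using exp_le ls by linarith
  ultimately show ?thesis by (simp add: algebra_simps)
qed

text \<open>Because \<open>l \<ge> 1\<close>, the rounding error \<open>const_C\<close> is at most
  \<open>h\<close>. So \<open>v\<close> and its substitute are within \<open>2 * h\<close>, and the
  a priori bound \<open>U\<close> for that short distance suffices.\<close>

lemma Z_sphere_pt_le: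
  assumes "\<bar>dist b v - s\<bar> \<le> h"
  shows "Z b (sphere_pt i s b (\<chi> j. \<lfloor>v $ j\<rfloor>)) \<omega>
    \<le> Z b v \<omega> + (2 * const_C CARD('d) + 4 + 2 * detour (const_C CARD('d))) * h"
proof -
  let ?A = "const_C CARD('d)" and ?S = "sphere_pt i s b (\<chi> j. \<lfloor>v $ j\<rfloor>)"
  have "?A * 1 \<le> ?A * l" using l1 A_pos by (intro mult_left_mono) auto
  then have Ah: "?A \<le> h" using step by simp
  have "dist v ?S \<le> 2 * h" using sphere_pt_near[OF _ assms, of i] s1 Ah by simp
  then have "?A * dist v ?S \<le> ?A * (2 * h)" using A_pos by (intro mult_left_mono) auto
  then have "Z v ?S \<omega> \<le> 2 * ?A * h + 4 * h" using Z_bounds(2)[of v ?S \<omega>] step by (simp add: U_def)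
  moreover have "2 * detour ?A * (?A * l) \<le> 2 * detour ?A * h"
    using step A_pos by (intro mult_left_mono) (auto simp: detour_def)
  ultimately show ?thesis using Z_triangle[of b ?S \<omega> v] by (simp add: algebra_simps)
qed

lemma superadditivity:
  fixes i :: 'd
  shows "2 * expectation (Z 0 (axis i s)) - expectation (Z 0 (axis i (2 * s)))
    \<le> 2 * (2 * (const_C CARD('d) + 4) * (2 * const_C CARD('d) + 12) ^ CARD('d))
      + 2 * (2 * const_C CARD('d) + 4 + 2 * detour (const_C CARD('d))) * h
      + 2 * (\<kappa> 0 (axis i s) * (ln (real (card (dir_idx s :: (int ^ 'd) set))) + exp 1))"
proof -
  let ?A = "const_C CARD('d)"
  let ?p = "axis i s :: real ^ 'd" and ?q = "axis i (2 * s) :: real ^ 'd"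
  let ?K = "dir_idx s :: (int ^ 'd) set"
  define a where "a = expectation (Z 0 ?p)"
  define \<epsilon> where "\<epsilon> = 2 * (?A + 4) * (2 * ?A + 12) ^ CARD('d)"
  define k where "k = (2 * ?A + 4 + 2 * detour ?A) * h"
  define E where "E = \<kappa> 0 ?p * (ln (real (card ?K)) + exp 1)"
  have s0: "0 < s" using s1 by simp
  have p: "dist 0 ?p = s" using s0 by (simp add: dist_norm norm_axis_real)
  have q: "dist 0 ?q = 2 * s" "norm ?q = 2 * s" using s0 by (auto simp: dist_norm norm_axis_real)
  have sph: "dist b (sphere_pt i s b z) = s" for b z using s0 by (simp add: dist_sphere_pt)
  \<comment> \<open>Used for both centres; the isometric error replaces the individual means by the
    common value \<open>a\<close>.\<close>
  have low: "\<exists>W. integrable M W \<and> expectation W \<le> E \<and>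
      (\<forall>\<omega>\<in>space M. \<forall>z\<in>?K. a - \<epsilon> - W \<omega> \<le> Z b (sphere_pt i s b z) \<omega>)" for b
  proof -
    from simultaneous_deviation[of ?K "\<lambda>_. b" "sphere_pt i s b" 0 ?p,
        OF dir_idx(1) dir_idx(2)[OF s1] trans[OF sph p[symmetric]]]
    obtain W where W: "integrable M W" "expectation W \<le> E"
      "\<And>\<omega> z. \<omega> \<in> space M \<Longrightarrow> z \<in> ?K \<Longrightarrow> expectation (Z b (sphere_pt i s b z)) - W \<omega> \<le> Z b (sphere_pt i s b z) \<omega>"
      unfolding E_def by blast
    have "a - \<epsilon> \<le> expectation (Z b (sphere_pt i s b z))" for z
      using isometric_error[OF p sph, of b z] unfolding a_def \<epsilon>_def by (simp add: abs_le_iff)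
    then have "a - \<epsilon> - W \<omega> \<le> Z b (sphere_pt i s b z) \<omega>" if "\<omega> \<in> space M" "z \<in> ?K" for \<omega> z
      using W(3)[OF that] by (smt (verit))
    then show ?thesis using W(1,2) by blast
  qed
  obtain W0 where W0: "integrable M W0" "expectation W0 \<le> E"
    "\<And>\<omega> z. \<omega> \<in> space M \<Longrightarrow> z \<in> ?K \<Longrightarrow> a - \<epsilon> - W0 \<omega> \<le> Z 0 (sphere_pt i s 0 z) \<omega>"
    using low[of 0] by blast
  obtain W1 where W1: "integrable M W1" "expectation W1 \<le> E"
    "\<And>\<omega> z. \<omega> \<in> space M \<Longrightarrow> z \<in> ?K \<Longrightarrow> a - \<epsilon> - W1 \<omega> \<le> Z ?q (sphere_pt i s ?q z) \<omega>"
    using low[of ?q] by blast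
  have pw: "2 * (a - \<epsilon> - k) - W0 \<omega> - W1 \<omega> \<le> Z 0 ?q \<omega>" if \<omega>: "\<omega> \<in> space M" for \<omega>
  proof (rule field_le_epsilon)
    fix \<eta> :: real assume \<eta>: "0 < \<eta>"
    obtain v w where vw: "s \<le> dist 0 v" "dist 0 v \<le> s + h" "s - h \<le> dist w ?q" "dist w ?q \<le> s"
        "Z 0 v \<omega> + Z w ?q \<omega> \<le> Z 0 ?q \<omega> + \<eta>"
      using net.crossing_points[OF henrich_net' s0 q(1) \<eta>, of \<omega>] unfolding Z_def by blast
    have "norm w \<le> dist w ?q + norm ?q" using dist_triangle[of w 0 ?q] by simp
    then have w: "(\<chi> j. \<lfloor>w $ j\<rfloor>) \<in> ?K" using vw q by (intro floor_mem_dir_idx) simp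
    have v: "(\<chi> j. \<lfloor>v $ j\<rfloor>) \<in> ?K" using vw hs s0 by (intro floor_mem_dir_idx) simp
    have "a - \<epsilon> - W0 \<omega> - k \<le> Z 0 v \<omega>"
      using W0(3)[OF \<omega> v] Z_sphere_pt_le[of 0 v i \<omega>] vw h_pos unfolding k_def by (simp add: abs_le_iff)
    moreover have "a - \<epsilon> - W1 \<omega> - k \<le> Z ?q w \<omega>"
      using W1(3)[OF \<omega> w] Z_sphere_pt_le[of ?q w i \<omega>] vw h_pos unfolding k_def
      by (simp add: abs_le_iff dist_commute)
    ultimately show "2 * (a - \<epsilon> - k) - W0 \<omega> - W1 \<omega> \<le> Z 0 ?q \<omega> + \<eta>"
      using vw(5) Z_sym[of w ?q \<omega>] by simp
  qed
  have "2 * (a - \<epsilon> - k) - expectation W0 - expectation W1 = expectation (\<lambda>\<omega>. 2 * (a - \<epsilon> - k) - W0 \<omega> - W1 \<omega>)"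
    using W0 W1 by (simp add: prob_space)
  also have "\<dots> \<le> expectation (Z 0 ?q)"
    using W0 W1 pw Z_integrable by (intro integral_mono) auto
  finally have "2 * (a - \<epsilon> - k) - expectation W0 - expectation W1 \<le> expectation (Z 0 ?q)" .
  then have "2 * (a - \<epsilon> - k) - E - E \<le> expectation (Z 0 ?q)" using W0(2) W1(2) by linarith
  then have "2 * a - expectation (Z 0 ?q) \<le> 2 * \<epsilon> + 2 * k + 2 * E" by (simp add: algebra_simps)
  then show ?thesis unfolding a_def \<epsilon>_def k_def E_def by (simp only: mult.assoc)
qed

lemma subadditivity:
  fixes i :: 'd
  shows "expectation (Z 0 (axis i (2 * s))) - 2 * expectation (Z 0 (axis i s))
    \<le> 2 * (const_C CARD('d) + 4) * (2 * const_C CARD('d) + 12) ^ CARD('d) + 2 * detour (const_C CARD('d)) * h"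
proof -
  let ?A = "const_C CARD('d)"
  let ?p = "axis i s :: real ^ 'd" and ?q = "axis i (2 * s) :: real ^ 'd"
  have s0: "0 < s" using s1 by simp
  have "?p - ?q = axis i (- s)" by (simp add: vec_eq_iff axis_def)
  then have p: "dist 0 ?p = s" "dist ?p ?q = s" using s0 by (auto simp: dist_norm norm_axis_real)
  note [simp] = Z_integrable
  have "expectation (Z 0 ?q) \<le> expectation (\<lambda>\<omega>. Z 0 ?p \<omega> + Z ?p ?q \<omega> + 2 * detour ?A * (?A * l))"
    by (intro integral_mono Z_triangle) auto
  also have "\<dots> = expectation (Z 0 ?p) + expectation (Z ?p ?q) + 2 * detour ?A * (?A * l)"
    by (simp add: prob_space)
  also have "2 * detour ?A * (?A * l) \<le> 2 * detour ?A * h"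
    using step A_pos by (intro mult_left_mono) (auto simp: detour_def)
  finally show ?thesis using isometric_error[OF p] by (simp add: abs_le_iff)
qed

theorem doubling_defect:
  fixes i :: 'd
  defines "d \<equiv> \<lambda>y. expected_dist M (\<lambda>\<omega>. enrich l a c (X \<omega>)) h 0 y"
  shows "\<bar>2 * d (axis i s) - d (axis i (2 * s))\<bar>
    \<le> rate_C1 CARD('d) * h + rate_C2 CARD('d) * (sqrt ((const_C CARD('d) * l)\<^sup>2 * s / h) * ln s)"
    and "s \<le> d (axis i (2 * s))"
proof -
  let ?A = "const_C CARD('d)"
  let ?p = "axis i s :: real ^ 'd" and ?q = "axis i (2 * s) :: real ^ 'd"
  define \<epsilon> where "\<epsilon> = 2 * (?A + 4) * (2 * ?A + 12) ^ CARD('d)"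
  define b where "b = 2 * detour ?A"
  have s0: "0 < s" using s1 by simp
  have b0: "0 \<le> b" using A_pos by (simp add: b_def detour_def)
  have bl: "b * (?A * l) \<le> b * h" using step b0 by (intro mult_left_mono)
  have d: "expectation (Z 0 y) - h \<le> d y" "d y \<le> expectation (Z 0 y) + b * h" for y
    using expected_dist_bounds[of 0 y] bl unfolding d_def b_def by auto
  have "?A * 1 \<le> ?A * l" using l1 A_pos by (intro mult_left_mono) auto
  moreover have "2 * 1 \<le> ?A" unfolding const_C_def by (intro mult_left_mono) auto
  ultimately have h1: "1 \<le> h" using step by linarith
  have \<epsilon>0: "0 \<le> \<epsilon>" using A_pos by (auto simp: \<epsilon>_def)
  have \<epsilon>h: "\<epsilon> \<le> \<epsilon> * h" using mult_left_mono[OF h1 \<epsilon>0] by simp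
  have q: "dist 0 ?q = 2 * s" "dist 0 ?p = s" using s0 by (auto simp: dist_norm norm_axis_real)
  have "2 * s = expectation (\<lambda>_. 2 * s)" by (simp add: prob_space)
  also have "\<dots> \<le> expectation (Z 0 ?q)" using Z_integrable Z_ge_dist[of 0 ?q] q by (intro integral_mono) auto
  \<comment> \<open>The mean is at least \<open>2 * s\<close>, and passing to the graph distance
    loses at most \<open>h \<le> s\<close>.\<close>
  finally show "s \<le> d ?q" using d(1)[of ?q] hs by simp
  have "\<kappa> 0 ?p * (ln (real (card (dir_idx s :: (int ^ 'd) set))) + exp 1)
      \<le> (2 * detour ?A * sqrt (8 * ?A + 45) * sqrt ((?A * l)\<^sup>2 * s / h)) * ((real CARD('d) * 10 + 3) * ln s)"
  proof (intro mult_mono kappa_le[OF q(2)] ln_card_le)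
    show "0 \<le> 2 * detour ?A * sqrt (8 * ?A + 45) * sqrt ((?A * l)\<^sup>2 * s / h)"
      by (rule order_trans[OF less_imp_le[OF kappa_pos] kappa_le[OF q(2)]])
    show "0 \<le> ln (real (card (dir_idx s :: (int ^ 'd) set))) + exp 1"
    proof -
      have "1 \<le> real (card (dir_idx s :: (int ^ 'd) set))"
        using dir_idx(1)[where 'd = 'd and s = s] dir_idx(2)[where 'd = 'd, OF s1] by (simp add: Suc_le_eq card_gt_0_iff)
      then show ?thesis by (intro add_nonneg_nonneg) auto
    qed
  qed
  also have "\<dots> = rate_C2 CARD('d) * (sqrt ((?A * l)\<^sup>2 * s / h) * ln s) / 2"
    by (simp add: rate_C2_def Let_def)
  finally have dev: "2 * (\<kappa> 0 ?p * (ln (real (card (dir_idx s :: (int ^ 'd) set))) + exp 1))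
      \<le> rate_C2 CARD('d) * (sqrt ((?A * l)\<^sup>2 * s / h) * ln s)" by simp
  have lo: "2 * expectation (Z 0 ?p) - expectation (Z 0 ?q)
      \<le> 2 * \<epsilon> + 2 * (2 * ?A + 4 + b) * h + rate_C2 CARD('d) * (sqrt ((?A * l)\<^sup>2 * s / h) * ln s)"
    using superadditivity[of i] dev unfolding \<epsilon>_def b_def by linarith
  have up: "expectation (Z 0 ?q) - 2 * expectation (Z 0 ?p) \<le> \<epsilon> + b * h"
    using subadditivity[of i] unfolding \<epsilon>_def b_def by simp
  have C1: "rate_C1 CARD('d) * h = 3 * (\<epsilon> * h) + 8 * (b * h) + 4 * (?A * h) + 11 * h"
    by (simp add: rate_C1_def Let_def \<epsilon>_def b_def algebra_simps)
  have nn: "0 \<le> b * h" "0 \<le> ?A * h" "0 \<le> h" using b0 A_pos h_pos by auto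
  have dev0: "0 \<le> rate_C2 CARD('d) * (sqrt ((?A * l)\<^sup>2 * s / h) * ln s)"
    using A_pos s1 h_pos by (intro mult_nonneg_nonneg) (auto simp: rate_C2_def Let_def detour_def)
  have lo': "2 * expectation (Z 0 ?p) - expectation (Z 0 ?q)
      \<le> 2 * \<epsilon> + 4 * (?A * h) + 8 * h + 2 * (b * h) + rate_C2 CARD('d) * (sqrt ((?A * l)\<^sup>2 * s / h) * ln s)"
    using lo by (simp add: algebra_simps)
  show "\<bar>2 * d ?p - d ?q\<bar> \<le> rate_C1 CARD('d) * h + rate_C2 CARD('d) * (sqrt ((?A * l)\<^sup>2 * s / h) * ln s)"
    unfolding C1 abs_le_iff
    using d[of ?p] d[of ?q] up lo' nn dev0 \<epsilon>h \<epsilon>0 by linarith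
qed

end

end

theorem proposition5p4:
  shows "\<exists>K::real. \<forall>C'. C' \<ge> K \<and> C' \<ge> 1 \<and> C' \<ge> const_C CARD('d::finite) + 3 / 2 \<longrightarrow>
    (\<exists>C1>0. \<exists>C2>0.
      \<forall>k::real. k > real CARD('d) + 1 \<longrightarrow>
        (\<exists>s0>1. \<forall>s\<ge>s0. \<forall>h.
          delta CARD('d) C' k s \<le> h \<and> h \<le> s \<longrightarrow>
          (\<forall>(M :: 'w measure) (X :: 'w \<Rightarrow> (real ^ 'd) set) (a :: real ^ 'd)
              (c :: int ^ 'd \<Rightarrow> real ^ 'd) (i :: 'd).
            unit_poisson_process M X \<and>
            (\<forall>z. c z \<in> grid_cube (delta CARD('d) C' k s / const_C CARD('d)) a z) \<longrightarrow>
            (let Xs = (\<lambda>\<omega>. enrich (delta CARD('d) C' k s / const_C CARD('d)) a c (X \<omega>));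
                 e1 = axis i 1
             in \<bar>expected_dist M Xs h 0 (s *\<^sub>R e1) / expected_dist M Xs h 0 ((2 * s) *\<^sub>R e1) - 1 / 2\<bar>
                  \<le> C1 * (h / s)
                     + C2 * sqrt ((delta CARD('d) C' k s)\<^sup>2 / h) * (ln s / sqrt s)))))"
proof (rule exI[of _ 0], intro allI impI)
  let ?A = "const_C CARD('d)"
  have A0: "0 < ?A" by (simp add: const_C_def)
  have D0: "0 < detour ?A" using A0 by (simp add: detour_def)
  have C1: "0 < rate_C1 CARD('d)"
    unfolding rate_C1_def Let_def using A0 D0 by (intro add_pos_pos mult_pos_pos) auto
  have C2: "0 < rate_C2 CARD('d)"
    unfolding rate_C2_def Let_def using A0 D0 by (intro mult_pos_pos add_nonneg_pos) auto
  fix C' :: real assume C': "0 \<le> C' \<and> 1 \<le> C' \<and> ?A + 3 / 2 \<le> C'"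
  show "\<exists>C1>0. \<exists>C2>0.
      \<forall>k::real. k > real CARD('d) + 1 \<longrightarrow>
        (\<exists>s0>1. \<forall>s\<ge>s0. \<forall>h.
          delta CARD('d) C' k s \<le> h \<and> h \<le> s \<longrightarrow>
          (\<forall>(M :: 'w measure) (X :: 'w \<Rightarrow> (real ^ 'd) set) (a :: real ^ 'd)
              (c :: int ^ 'd \<Rightarrow> real ^ 'd) (i :: 'd).
            unit_poisson_process M X \<and>
            (\<forall>z. c z \<in> grid_cube (delta CARD('d) C' k s / const_C CARD('d)) a z) \<longrightarrow>
            (let Xs = (\<lambda>\<omega>. enrich (delta CARD('d) C' k s / const_C CARD('d)) a c (X \<omega>));
                 e1 = axis i 1
             in \<bar>expected_dist M Xs h 0 (s *\<^sub>R e1) / expected_dist M Xs h 0 ((2 * s) *\<^sub>R e1) - 1 / 2\<bar>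
                  \<le> C1 * (h / s)
                     + C2 * sqrt ((delta CARD('d) C' k s)\<^sup>2 / h) * (ln s / sqrt s))))"
  \<comment> \<open>Both constants are fixed before \<open>k\<close>, from the dimension alone. The
    threshold \<open>exp 1\<close> ensures \<open>ln s \<ge> 1\<close>.\<close>
  proof (rule exI[of _ "rate_C1 CARD('d)"], rule conjI[OF C1], rule exI[of _ "rate_C2 CARD('d)"], rule conjI[OF C2],
      intro allI impI, rule exI[of _ "exp 1"], intro conjI allI impI)
    show "1 < exp (1::real)" by simp
    fix k s h :: real and M :: "'w measure" and X :: "'w \<Rightarrow> (real ^ 'd) set"
      and a :: "real ^ 'd" and c :: "int ^ 'd \<Rightarrow> real ^ 'd" and i :: 'd
    assume k: "k > real CARD('d) + 1" and s: "exp 1 \<le> s"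
      and h: "delta CARD('d) C' k s \<le> h \<and> h \<le> s"
      and X: "unit_poisson_process M X \<and> (\<forall>z. c z \<in> grid_cube (delta CARD('d) C' k s / ?A) a z)"
    define l where "l = delta CARD('d) C' k s / ?A"
    have s_gt: "1 < s" using s exp_gt_one[of "1::real"] by linarith
    have ls: "1 \<le> ln s" using s s_gt by (simp add: ln_ge_iff)
    have "4 * ?A + 2 \<le> const_C'' CARD('d) C'" by (simp add: const_C''_def)
    then have C'': "1 \<le> const_C'' CARD('d) C'" using A0 by linarith
    have lC: "ln s \<le> ln (const_C'' CARD('d) C' * s)" using C'' s_gt by simp
    have kl: "(real CARD('d) + 1) * ln s \<le> k * ln (const_C'' CARD('d) C' * s)"
      using k lC ls by (intro mult_mono) auto
    have l: "l = (k * ln (const_C'' CARD('d) C' * s)) powr (1 / real CARD('d))"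
      using A0 by (simp add: l_def delta_def)
    have "1 * 1 \<le> (real CARD('d) + 1) * ln s" using ls by (intro mult_mono) auto
    then have kl1: "1 \<le> k * ln (const_C'' CARD('d) C' * s)" using kl by linarith
    then have l1: "1 \<le> l" unfolding l by (intro ge_one_powr_ge_zero) auto
    \<comment> \<open>By the choice of \<open>delta\<close>, the volume of a cube is
      \<open>k\<close> times the logarithm, which turns k > d + 1 into the decay condition.\<close>
    have "l ^ CARD('d) = l powr real CARD('d)" using l1 by (subst powr_realpow) auto
    also have "\<dots> = k * ln (const_C'' CARD('d) C' * s)" using kl1 by (simp add: l powr_powr)
    finally have ld: "(real CARD('d) + 1) * ln s \<le> l ^ CARD('d)" using kl by simp
    have dl: "delta CARD('d) C' k s = ?A * l" using A0 by (simp add: l_def)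
    interpret poisson_grid M X l h a c
    proof (intro poisson_grid.intro poisson_grid_axioms.intro)
      show "prob_space M" using X by (simp add: unit_poisson_process_def)
      show "c z \<in> grid_cube l a z" for z using X unfolding l_def by blast
    qed (use X h l1 dl in auto)
    let ?d = "expected_dist M (\<lambda>\<omega>. enrich l a c (X \<omega>)) h 0"
    have defect: "\<bar>2 * ?d (axis i s) - ?d (axis i (2 * s))\<bar>
        \<le> rate_C1 CARD('d) * h + rate_C2 CARD('d) * (sqrt ((?A * l)\<^sup>2 * s / h) * ln s)" "s \<le> ?d (axis i (2 * s))"
      using doubling_defect[OF l1 _ s ld, of i] h by auto
    have d0: "0 < ?d (axis i (2 * s))" using defect(2) s_gt by linarith
    \<comment> \<open>The deviation of the ratio from 1/2 is the doubling defect divided by twice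
      the denominator, which the lower bound \<open>s\<close> controls.\<close>
    have "\<bar>?d (axis i s) / ?d (axis i (2 * s)) - 1 / 2\<bar> = \<bar>2 * ?d (axis i s) - ?d (axis i (2 * s))\<bar> / (2 * ?d (axis i (2 * s)))"
    proof -
      have "?d (axis i s) / ?d (axis i (2 * s)) - 1 / 2 = (2 * ?d (axis i s) - ?d (axis i (2 * s))) / (2 * ?d (axis i (2 * s)))"
        using d0 by (simp add: field_simps)
      then show ?thesis using d0 by (simp add: abs_divide)
    qed
    also have "\<dots> \<le> \<bar>2 * ?d (axis i s) - ?d (axis i (2 * s))\<bar> / s"
      using defect(2) s_gt d0 by (intro divide_left_mono) auto
    also have "\<dots> \<le> (rate_C1 CARD('d) * h + rate_C2 CARD('d) * (sqrt ((?A * l)\<^sup>2 * s / h) * ln s)) / s"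
      using defect(1) s_gt by (intro divide_right_mono) auto
    also have "\<dots> = rate_C1 CARD('d) * (h / s) + rate_C2 CARD('d) * sqrt ((?A * l)\<^sup>2 / h) * (ln s / sqrt s)"
    proof -
      have "sqrt ((?A * l)\<^sup>2 * s / h) = sqrt ((?A * l)\<^sup>2 / h) * sqrt s"
        using real_sqrt_mult[of "(?A * l)\<^sup>2 / h" s] by simp
      then have "rate_C2 CARD('d) * (sqrt ((?A * l)\<^sup>2 * s / h) * ln s) / s =
          rate_C2 CARD('d) * sqrt ((?A * l)\<^sup>2 / h) * (ln s * (sqrt s / s))"
        by (simp only: times_divide_eq_right times_divide_eq_left mult_ac)
      also have "sqrt s / s = 1 / sqrt s" using s_gt by (simp add: field_simps)
      finally show ?thesis by (simp add: add_divide_distrib)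
    qed
    finally show "let Xs = (\<lambda>\<omega>. enrich (delta CARD('d) C' k s / ?A) a c (X \<omega>)); e1 = axis i 1
       in \<bar>expected_dist M Xs h 0 (s *\<^sub>R e1) / expected_dist M Xs h 0 ((2 * s) *\<^sub>R e1) - 1 / 2\<bar>
          \<le> rate_C1 CARD('d) * (h / s) + rate_C2 CARD('d) * sqrt ((delta CARD('d) C' k s)\<^sup>2 / h) * (ln s / sqrt s)"
      unfolding Let_def scaleR_axis_one l_def[symmetric] unfolding dl .
  qed
qed

end
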